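(* There is a constant $c>0$ such that the following holds. Let $G$ be an Eulerian solid subgraph of the triangular lattice with $f$ bounded faces. Then the mixing time of the face-reversal Markov chain $\mathcal{M}$ on $EO(G)$ satisfies $\tau_{\mathcal{M}}(\epsilon)\le c\, f^6\log\epsilon^{-1}$ for $0<\epsilon<1$, i.e. $\tau_{\mathcal{M}}(\epsilon)\in O(f^6\log\epsilon^{-1})$.
   Context: Triangular lattice: vertices $v_{i,j}$ ($i,j\in\mathbb{Z}$), edges $\{v_{i,j},v_{i+1,j}\}$, $\{v_{i,j},v_{i,j+1}\}$, $\{v_{i,j},v_{i+1,j-1}\}$, standard planar embedding with triangular bounded faces. A solid subgraph is obtained by choosing a cycle of the lattice as boundary and taking this cycle together with everything in its interior. A graph is Eulerian if all degrees are even; $EO(G)$ is the set of Eulerian orientations (in-degree equals out-degree at every vertex). A bounded face is directed in an orientation if its boundary edges form a directed cycle. One step of the face-reversal chain $\mathcal{M}$ from state $X$: with probability $1/2$ set $X'=X$; otherwise choose a bounded face $F$ uniformly at random; if $F$ is directed in $X$, obtain $X'$ by reversing all edges of $F$, otherwise set $X'=X$. This chain is ergodic with uniform stationary distribution $\pi$ on $EO(G)$. The mixing time is $\tau(\epsilon)=\max_{x}\min\{t:\|P^t(x,\cdot)-\pi\|_{TV}\le\epsilon\}$, with $\|\rho-\mu\|_{TV}=\sup_A|\rho(A)-\mu(A)|$.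
   Formalization: The bound proved is c f^6 ⌈ln(1/ε)⌉ instead of c f^6 log(1/ε); without the ceiling it fails for ε near 1 (triangle of side n, ε = 1 − 2/|EO(G)|). For ε ≤ δ < 1 the stated bound follows with a constant depending on δ. *)

theory Defs
  imports "HOL-Analysis.Analysis" "HOL-Probability.Probability"
begin

section \<open>The triangular lattice and its solid subgraphs\<close>

text \<open>The vertex \<open>v\<^sub>i\<^sub>,\<^sub>j\<close> is the pair \<open>(i, j)\<close>. Undirected edges are two-element sets of
  vertices, directed edges are ordered pairs.\<close>

type_synonym vertex = "int \<times> int"

record graph =
  verts :: "vertex set"
  edges :: "vertex set set"

definition lattice_edges :: "vertex set set" where
  "lattice_edges =
     (\<Union>i j. {{(i, j), (i + 1, j)}, {(i, j), (i, j + 1)}, {(i, j), (i + 1, j - 1)}})"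

text \<open>The standard embedding, with unit equilateral triangles as faces.\<close>

definition embed :: "vertex \<Rightarrow> complex" where
  "embed v = of_int (fst v) + of_int (snd v) * cis (pi / 3)"

definition edge_segment :: "vertex set \<Rightarrow> complex set" where
  "edge_segment e = convex hull (embed ` e)"

definition cycle_arcs :: "vertex list \<Rightarrow> (vertex \<times> vertex) set" where
  "cycle_arcs vs = set (zip vs (rotate1 vs))"

definition lattice_cycle :: "vertex list \<Rightarrow> bool" where
  "lattice_cycle vs \<longleftrightarrow>
     distinct vs \<and> 3 \<le> length vs \<and> (\<forall>(u, v) \<in> cycle_arcs vs. {u, v} \<in> lattice_edges)"

definition cycle_curve :: "vertex list \<Rightarrow> complex set" where
  "cycle_curve vs = (\<Union>(u, v) \<in> cycle_arcs vs. edge_segment {u, v})"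

definition solid_graph :: "vertex list \<Rightarrow> graph" where
  "solid_graph vs =
     (let R = cycle_curve vs \<union> inside (cycle_curve vs)
      in \<lparr>verts = {v. embed v \<in> R}, edges = {e \<in> lattice_edges. edge_segment e \<subseteq> R}\<rparr>)"

definition solid_subgraph :: "graph \<Rightarrow> bool" where
  "solid_subgraph G \<longleftrightarrow> (\<exists>vs. lattice_cycle vs \<and> G = solid_graph vs)"

definition degree :: "graph \<Rightarrow> vertex \<Rightarrow> nat" where
  "degree G v = card {e \<in> edges G. v \<in> e}"

definition eulerian :: "graph \<Rightarrow> bool" where
  "eulerian G \<longleftrightarrow> (\<forall>v \<in> verts G. even (degree G v))"

section \<open>Bounded faces\<close>

definition drawing :: "graph \<Rightarrow> complex set" where
  "drawing G = embed ` verts G \<union> (\<Union>e \<in> edges G. edge_segment e)"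

definition bounded_faces :: "graph \<Rightarrow> complex set set" where
  "bounded_faces G = {F \<in> components (- drawing G). bounded F}"

definition face_edges :: "graph \<Rightarrow> complex set \<Rightarrow> vertex set set" where
  "face_edges G F = {e \<in> edges G. edge_segment e \<subseteq> frontier F}"

section \<open>Eulerian orientations\<close>

type_synonym orientation = "(vertex \<times> vertex) set"

definition orientations :: "graph \<Rightarrow> orientation set" where
  "orientations G =
     {X. (\<forall>(u, v) \<in> X. {u, v} \<in> edges G) \<and>
         (\<forall>u v. {u, v} \<in> edges G \<longrightarrow> ((u, v) \<in> X) \<noteq> ((v, u) \<in> X))}"

definition EO :: "graph \<Rightarrow> orientation set" where
  "EO G =
     {X \<in> orientations G. \<forall>v \<in> verts G. card {u. (u, v) \<in> X} = card {w. (v, w) \<in> X}}"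

definition face_arcs :: "graph \<Rightarrow> orientation \<Rightarrow> complex set \<Rightarrow> (vertex \<times> vertex) set" where
  "face_arcs G X F = {(u, v) \<in> X. {u, v} \<in> face_edges G F}"

definition directed_face :: "graph \<Rightarrow> orientation \<Rightarrow> complex set \<Rightarrow> bool" where
  "directed_face G X F \<longleftrightarrow>
     (\<exists>vs. distinct vs \<and> 3 \<le> length vs \<and> face_arcs G X F = cycle_arcs vs)"

definition reverse_face :: "graph \<Rightarrow> orientation \<Rightarrow> complex set \<Rightarrow> orientation" where
  "reverse_face G X F = (X - face_arcs G X F) \<union> (face_arcs G X F)\<inverse>"

section \<open>The face-reversal chain and its mixing time\<close>

definition face_step :: "graph \<Rightarrow> orientation \<Rightarrow> orientation pmf" where
  "face_step G X =
     bind_pmf (bernoulli_pmf (1 / 2)) (\<lambda>stay.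
       if stay then return_pmf X
       else map_pmf (\<lambda>F. if directed_face G X F then reverse_face G X F else X)
              (pmf_of_set (bounded_faces G)))"

definition chain_power :: "('s \<Rightarrow> 's pmf) \<Rightarrow> nat \<Rightarrow> 's \<Rightarrow> 's pmf" where
  "chain_power P t x = ((\<lambda>p. bind_pmf p P) ^^ t) (return_pmf x)"

definition tv_dist :: "'s pmf \<Rightarrow> 's pmf \<Rightarrow> real" where
  "tv_dist p q = (SUP A. \<bar>measure_pmf.prob p A - measure_pmf.prob q A\<bar>)"

definition mixing_time :: "'s set \<Rightarrow> ('s \<Rightarrow> 's pmf) \<Rightarrow> 's pmf \<Rightarrow> real \<Rightarrow> nat" where
  "mixing_time S P \<pi> \<epsilon> = (MAX x \<in> S. LEAST t. tv_dist (chain_power P t x) \<pi> \<le> \<epsilon>)"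

text \<open>Pitfall: no bound \<open>\<tau>(\<epsilon>) \<le> c f\<^sup>6 ln (1/\<epsilon>)\<close> can hold uniformly for \<open>\<epsilon>\<close> up to 1. The upward faces of a
  triangle of side \<open>n\<close> (with \<open>f = n\<^sup>2\<close>) partition its edges, so it has \<open>N \<ge> 2 powr (f/2)\<close> Eulerian
  orientations; for \<open>\<epsilon> = 1 - 2/N\<close> the mixing time is at least 1, as the distance at time 0 is \<open>1 - 1/N\<close>,
  while \<open>f\<^sup>6 ln (1/\<epsilon>)\<close> tends to 0. Bounds valid for all \<open>0 < \<epsilon> < 1\<close> therefore use \<open>\<lceil>ln (1/\<epsilon>)\<rceil>\<close>, as in
  the path coupling theorem; for \<open>\<epsilon>\<close> bounded away from 1 this agrees with \<open>ln (1/\<epsilon>)\<close> up to a constant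
  factor.\<close>

definition face_mixing_time :: "graph \<Rightarrow> real \<Rightarrow> nat" where
  "face_mixing_time G \<epsilon> = mixing_time (EO G) (face_step G) (pmf_of_set (EO G)) \<epsilon>"

end

theory Submission
  imports Defs "HOL-Library.Z2"
begin

text \<open>
  Eulerian orientations correspond to height functions on the triangles inside the boundary cycle:
  heights of adjacent triangles differ by one, and the outer face has height zero. Reversing a
  directed face flips a local maximum into a local minimum or conversely.

  The single-flip chain is compared with a chain that moves whole towers, that is, straight strips
  of triangles in which each element has the next one as its only higher neighbour. For tower
  probabilities proportional to 1/2 (length 1) and 1/(6k) (length k at least 2) the expected area
  between two coupled height functions does not increase; since the area also fluctuates, a concave
  function of it contracts, which bounds the spectral gap of the tower chain below by a constant
  times \<open>f\<^sup>-\<^sup>4\<close>. Heights, and hence tower lengths, are of order at most the square root of \<open>f\<close>, so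
  decomposing towers into single flips costs a factor of order \<open>f\<close>. The resulting gap of order
  \<open>f\<^sup>-\<^sup>5\<close> and \<open>ln |EO(G)| = O(f)\<close> give the bound.
\<close>

section \<open>Reversible chains: decay, spectral gap and mixing\<close>

text \<open>Single flips alone do not contract: the triangle where two height functions differ can
  have three neighbours, each a local extremum in only one of them, and flips there separate the
  copies more often than flips at the triangle itself merge them. Long moves with small
  probabilities restore the balance, but only to drift zero, which gives no rate. The rate comes
  from the variance. The distance lies in [0, D] with D of order f^(3/2) and has second moment of
  change at least 1 / (8 f) per step, so the mean of z (2 D - z) shrinks by the factor 1 - 1 / (8 f
  D^2), whence the fourth power. The coupling is then turned into a bound on Rayleigh quotients,
  because the two chains are compared through their Dirichlet forms. On the geometric side one
  discrete Poincare lemma serves three times: over the integers for the heights of an orientation,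
  over the integers again as winding number of the boundary cycle, and over the field with two
  elements for the existence of a height function.\<close>

lemma rayleigh_le_decay_rate:
  fixes P :: "('s \<Rightarrow> real) \<Rightarrow> 's \<Rightarrow> real" and g :: "'s \<Rightarrow> real"
  assumes sym: "\<And>f g. (\<Sum>x\<in>\<Omega>. f x * P g x) = (\<Sum>x\<in>\<Omega>. P f x * g x)"
    and decay: "\<And>t x. x \<in> \<Omega> \<Longrightarrow> \<bar>(P ^^ t) g x\<bar> \<le> C * \<rho> ^ t"
    and rho: "0 \<le> \<rho>"
  shows "(\<Sum>x\<in>\<Omega>. g x * P g x) \<le> \<rho> * (\<Sum>x\<in>\<Omega>. (g x)\<^sup>2)"
proof -
  define m where "m t = (\<Sum>x\<in>\<Omega>. ((P ^^ t) g x)\<^sup>2)" for t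
  have m0: "m t \<ge> 0" for t
    unfolding m_def by (simp add: sum_nonneg)
  \<comment> \<open>Self-adjointness moves one application of \<open>P\<close> across the inner
    product; Cauchy-Schwarz then makes \<open>m\<close> log-convex.\<close>
  have convex: "(m (Suc t))\<^sup>2 \<le> m t * m (Suc (Suc t))" for t
  proof -
    have "m (Suc t) = (\<Sum>x\<in>\<Omega>. P ((P ^^ t) g) x * P ((P ^^ t) g) x)"
      by (simp add: m_def power2_eq_square)
    also have "\<dots> = (\<Sum>x\<in>\<Omega>. (P ^^ t) g x * P (P ((P ^^ t) g)) x)"
      by (rule sym[symmetric])
    finally have "m (Suc t) = (\<Sum>x\<in>\<Omega>. (P ^^ t) g x * (P ^^ Suc (Suc t)) g x)"
      by simp
    then show ?thesis
      unfolding m_def using Cauchy_Schwarz_ineq_sum by metis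
  qed
  have m1: "m 1 \<le> \<rho>\<^sup>2 * m 0"
  proof (cases "m 0 = 0")
    case True
    then show ?thesis using convex[of 0] by simp
  next
    case False
    then have pos: "m 0 > 0" using m0[of 0] by linarith
    define r where "r = m 1 / m 0"
    have r0: "r \<ge> 0" unfolding r_def using m0 by simp
    \<comment> \<open>By log-convexity the successive quotients of \<open>m\<close> never fall below
      the first one, \<open>r\<close>, so the decay of \<open>m\<close> for large \<open>t\<close>
      already bounds \<open>r\<close>.\<close>
    have ratio: "r * m t \<le> m (Suc t)" for t
    proof (induction t)
      case 0
      then show ?case using pos by (simp add: r_def)
    next
      case (Suc t)
      show ?case
      proof (cases "m (Suc t) = 0")
        case True
        then show ?thesis using m0 by simp
      next
        case False
        then have p1: "m (Suc t) > 0" using m0[of "Suc t"] by linarith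
        have "m t \<noteq> 0" using convex[of t] p1 by auto
        then have p0: "m t > 0" using m0[of t] by linarith
        have "r * m t * m (Suc t) \<le> m (Suc t) * m (Suc t)"
          using Suc p1 by (intro mult_right_mono) auto
        also have "\<dots> \<le> m t * m (Suc (Suc t))"
          using convex[of t] by (simp add: power2_eq_square)
        finally have "m t * (r * m (Suc t)) \<le> m t * m (Suc (Suc t))"
          by (simp add: algebra_simps)
        then show ?thesis using p0 by simp
      qed
    qed
    have lower: "r ^ t * m 0 \<le> m t" for t
    proof (induction t)
      case (Suc t)
      have "r * (r ^ t * m 0) \<le> r * m t" using Suc r0 by (rule mult_left_mono)
      then show ?case using ratio[of t] by (simp add: algebra_simps)
    qed simp
    have upper: "m t \<le> (real (card \<Omega>) * C\<^sup>2) * (\<rho>\<^sup>2) ^ t" for t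
    proof -
      have "((P ^^ t) g x)\<^sup>2 \<le> C\<^sup>2 * (\<rho>\<^sup>2) ^ t" if "x \<in> \<Omega>" for x
      proof -
        have "\<bar>(P ^^ t) g x\<bar>\<^sup>2 \<le> (C * \<rho> ^ t)\<^sup>2"
          using decay[OF that, of t] by (intro power_mono) auto
        then show ?thesis by (simp add: power_mult_distrib flip: power_mult) (simp add: mult.commute)
      qed
      then have "m t \<le> real (card \<Omega>) * (C\<^sup>2 * (\<rho>\<^sup>2) ^ t)"
        unfolding m_def by (intro sum_bounded_above)
      then show ?thesis by simp
    qed
    have "r \<le> \<rho>\<^sup>2"
    proof (rule ccontr)
      assume "\<not> r \<le> \<rho>\<^sup>2"
      then have rr: "r > \<rho>\<^sup>2" by simp
      then have rp: "r > 0" using zero_le_power2[of \<rho>] by linarith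
      define q where "q = \<rho>\<^sup>2 / r"
      have q: "0 \<le> q" "q < 1" using rr rp by (auto simp: q_def)
      have "m 0 \<le> (real (card \<Omega>) * C\<^sup>2) * q ^ t" for t
        using order_trans[OF lower upper, of t] rp
        by (simp add: q_def power_divide field_simps)
      moreover have "(\<lambda>t. (real (card \<Omega>) * C\<^sup>2) * q ^ t) \<longlonglongrightarrow> (real (card \<Omega>) * C\<^sup>2) * 0"
        using q by (intro tendsto_mult_left LIMSEQ_power_zero) auto
      ultimately have "m 0 \<le> 0"
        by (metis LIMSEQ_le_const mult_zero_right)
      then show False using pos by simp
    qed
    then show ?thesis using pos by (simp add: r_def field_simps)
  qed
  have "(\<Sum>x\<in>\<Omega>. g x * P g x)\<^sup>2 \<le> m 0 * m 1"
    unfolding m_def using Cauchy_Schwarz_ineq_sum[of g "P g" \<Omega>] by simp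
  also have "\<dots> \<le> m 0 * (\<rho>\<^sup>2 * m 0)"
    using m1 m0 by (rule mult_left_mono)
  also have "\<dots> = (\<rho> * m 0)\<^sup>2"
    by (simp add: power2_eq_square algebra_simps)
  finally have "(\<Sum>x\<in>\<Omega>. g x * P g x) \<le> \<rho> * m 0"
    using rho m0[of 0] by (meson mult_nonneg_nonneg power2_le_imp_le)
  then show ?thesis by (simp add: m_def)
qed

lemma tv_dist_le_sum:
  fixes p q :: "'s pmf"
  assumes fin: "finite \<Omega>" and "set_pmf p \<subseteq> \<Omega>" "set_pmf q \<subseteq> \<Omega>"
  shows "tv_dist p q \<le> (\<Sum>x\<in>\<Omega>. \<bar>pmf p x - pmf q x\<bar>)"
proof -
  have pr: "measure_pmf.prob r A = (\<Sum>x\<in>\<Omega> \<inter> A. pmf r x)" if "set_pmf r \<subseteq> \<Omega>" for r :: "'s pmf" and A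
  proof -
    have "measure_pmf.prob r A = measure_pmf.prob r (\<Omega> \<inter> A)"
      using that by (intro measure_prob_cong_0) (auto simp: set_pmf_eq)
    also have "\<dots> = (\<Sum>x\<in>\<Omega> \<inter> A. pmf r x)"
      using fin by (intro measure_measure_pmf_finite) auto
    finally show ?thesis .
  qed
  show ?thesis unfolding tv_dist_def
  proof (rule cSUP_least)
    fix A :: "'s set"
    have "\<bar>measure_pmf.prob p A - measure_pmf.prob q A\<bar> = \<bar>\<Sum>x\<in>\<Omega> \<inter> A. pmf p x - pmf q x\<bar>"
      by (simp add: pr assms sum_subtractf)
    also have "\<dots> \<le> (\<Sum>x\<in>\<Omega> \<inter> A. \<bar>pmf p x - pmf q x\<bar>)" by (rule sum_abs)
    also have "\<dots> \<le> (\<Sum>x\<in>\<Omega>. \<bar>pmf p x - pmf q x\<bar>)"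
      using fin by (intro sum_mono2) auto
    finally show "\<bar>measure_pmf.prob p A - measure_pmf.prob q A\<bar> \<le> \<dots>" .
  qed simp
qed

section \<open>Lazy chains of involutive moves: from a Poincare inequality to total
  variation\<close>

locale lazy_involution_chain =
  fixes \<Omega> :: "'s set" and Fs :: "'f set" and m :: "'f \<Rightarrow> 's \<Rightarrow> 's" and K :: "'s \<Rightarrow> 's pmf"
  assumes finite_states: "finite \<Omega>"
    and finite_moves: "finite Fs" and nonempty_moves: "Fs \<noteq> {}"
    and closed: "\<And>F x. F \<in> Fs \<Longrightarrow> x \<in> \<Omega> \<Longrightarrow> m F x \<in> \<Omega>"
    and involution: "\<And>F x. F \<in> Fs \<Longrightarrow> x \<in> \<Omega> \<Longrightarrow> m F (m F x) = x"
    and step: "\<And>x. x \<in> \<Omega> \<Longrightarrow> K x =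
      bind_pmf (bernoulli_pmf (1 / 2))
        (\<lambda>stay. if stay then return_pmf x else map_pmf (\<lambda>F. m F x) (pmf_of_set Fs))"
begin

abbreviation "f \<equiv> real (card Fs)"

definition avg :: "('s \<Rightarrow> real) \<Rightarrow> 's \<Rightarrow> real" where
  "avg g x = (\<Sum>F\<in>Fs. g (m F x)) / f"

definition lazy_avg :: "('s \<Rightarrow> real) \<Rightarrow> 's \<Rightarrow> real" where
  "lazy_avg g x = (g x + avg g x) / 2"

lemma f_pos: "f > 0"
  using finite_moves nonempty_moves by (simp add: card_gt_0_iff)

lemma sum_move: "F \<in> Fs \<Longrightarrow> (\<Sum>x\<in>\<Omega>. g (m F x)) = (\<Sum>x\<in>\<Omega>. g x)" for g :: "'s \<Rightarrow> real"
  by (rule sum.reindex_bij_witness[of _ "m F" "m F"]) (auto simp: closed involution)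

text \<open>With Q the non-lazy averaging operator, expanding the squares turns the sum over moves
  into 2 f (|g|^2 - <g, Q g>). As Q does not increase the norm, |(g + Q g) / 2|^2 is at most (|g|^2
  + <g, Q g>) / 2. Laziness thus makes eigenvalues of Q near -1 harmless, and \<gamma> is passed on
  without loss.\<close>

lemma lazy_avg_contraction:
  assumes poincare: "\<gamma> * (\<Sum>x\<in>\<Omega>. (g x)\<^sup>2) \<le> (\<Sum>F\<in>Fs. \<Sum>x\<in>\<Omega>. (g x - g (m F x))\<^sup>2) / (4 * f)"
  shows "(\<Sum>x\<in>\<Omega>. (lazy_avg g x)\<^sup>2) \<le> (1 - \<gamma>) * (\<Sum>x\<in>\<Omega>. (g x)\<^sup>2)"
proof -
  define N where "N = (\<Sum>x\<in>\<Omega>. (g x)\<^sup>2)"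
  define I where "I = (\<Sum>x\<in>\<Omega>. g x * avg g x)"
  define A where "A = (\<Sum>x\<in>\<Omega>. (avg g x)\<^sup>2)"
  have "A \<le> (\<Sum>x\<in>\<Omega>. (\<Sum>F\<in>Fs. (g (m F x))\<^sup>2) / f)"
    unfolding A_def
  proof (rule sum_mono)
    fix x
    have "(\<Sum>F\<in>Fs. g (m F x))\<^sup>2 \<le> f * (\<Sum>F\<in>Fs. (g (m F x))\<^sup>2)"
      using Cauchy_Schwarz_ineq_sum[of "\<lambda>_. 1" "\<lambda>F. g (m F x)" Fs] by simp
    then show "(avg g x)\<^sup>2 \<le> (\<Sum>F\<in>Fs. (g (m F x))\<^sup>2) / f"
      using f_pos unfolding avg_def power_divide by (simp add: field_simps power2_eq_square)
  qed
  also have "\<dots> = (\<Sum>F\<in>Fs. \<Sum>x\<in>\<Omega>. (g (m F x))\<^sup>2) / f"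
    by (simp only: sum_divide_distrib[symmetric] sum.swap[of _ \<Omega> Fs])
  also have "\<dots> = N"
    using f_pos sum_move[of _ "\<lambda>y. (g y)\<^sup>2"] by (simp add: N_def)
  finally have AN: "A \<le> N" .
  have "(\<Sum>F\<in>Fs. \<Sum>x\<in>\<Omega>. g x * g (m F x)) = (\<Sum>x\<in>\<Omega>. \<Sum>F\<in>Fs. g x * g (m F x))"
    by (rule sum.swap)
  also have "\<dots> = f * I"
    using f_pos by (simp add: I_def avg_def sum_distrib_left[symmetric] sum_divide_distrib[symmetric])
  finally have cross: "(\<Sum>F\<in>Fs. \<Sum>x\<in>\<Omega>. g x * g (m F x)) = f * I" .
  have "(\<Sum>F\<in>Fs. \<Sum>x\<in>\<Omega>. (g x - g (m F x))\<^sup>2)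
      = (\<Sum>F\<in>Fs. (\<Sum>x\<in>\<Omega>. (g x)\<^sup>2) + (\<Sum>x\<in>\<Omega>. (g (m F x))\<^sup>2) - 2 * (\<Sum>x\<in>\<Omega>. g x * g (m F x)))"
    by (simp add: power2_diff sum.distrib sum_subtractf sum_distrib_left mult.assoc)
  also have "\<dots> = (\<Sum>F\<in>Fs. 2 * N - 2 * (\<Sum>x\<in>\<Omega>. g x * g (m F x)))"
    using sum_move[of _ "\<lambda>y. (g y)\<^sup>2"] by (intro sum.cong) (auto simp: N_def)
  also have "\<dots> = 2 * f * N - 2 * (f * I)"
    by (simp add: sum_subtractf sum_distrib_left[symmetric] cross)
  finally have E: "(\<Sum>F\<in>Fs. \<Sum>x\<in>\<Omega>. (g x - g (m F x))\<^sup>2) / (4 * f) = (N - I) / 2"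
    using f_pos by (simp add: field_simps)
  have "(\<Sum>x\<in>\<Omega>. (lazy_avg g x)\<^sup>2) = (\<Sum>x\<in>\<Omega>. ((g x)\<^sup>2 + 2 * (g x * avg g x) + (avg g x)\<^sup>2) / 4)"
    by (intro sum.cong refl) (simp add: lazy_avg_def power2_sum power_divide)
  also have "\<dots> = (N + 2 * I + A) / 4"
    by (simp only: sum_divide_distrib[symmetric] sum.distrib sum_distrib_left[symmetric] N_def I_def A_def)
  finally have "(\<Sum>x\<in>\<Omega>. (lazy_avg g x)\<^sup>2) = (N + 2 * I + A) / 4" .
  moreover have "\<gamma> * N \<le> (N - I) / 2" using poincare by (simp only: E N_def)
  ultimately show ?thesis using AN by (simp add: N_def[symmetric] algebra_simps)
qed

lemma set_pmf_step: "x \<in> \<Omega> \<Longrightarrow> set_pmf (K x) \<subseteq> \<Omega>"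
  using closed[of _ x]
  by (auto simp: step set_bind_pmf set_pmf_of_set[OF nonempty_moves finite_moves] split: if_splits)

lemma set_pmf_chain: "x \<in> \<Omega> \<Longrightarrow> set_pmf (chain_power K t x) \<subseteq> \<Omega>"
proof (induction t)
  case (Suc t)
  then show ?case using set_pmf_step by (force simp: chain_power_def set_bind_pmf)
qed (simp add: chain_power_def)

lemma pmf_step:
  assumes "x \<in> \<Omega>"
  shows "pmf (K x) y = of_bool (x = y) / 2 + (\<Sum>F\<in>Fs. of_bool (m F x = y)) / (2 * f)"
proof -
  have "pmf (map_pmf (\<lambda>F. m F x) (pmf_of_set Fs)) y = (\<Sum>F\<in>Fs. of_bool (m F x = y)) / f"
    using finite_moves nonempty_moves
    by (simp add: pmf_map measure_pmf_of_set vimage_def Int_def of_bool_def sum.If_cases conj_commute)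
  then show ?thesis
    by (simp add: step[OF assms] pmf_bind pmf_return indicator_def of_bool_def)
qed

text \<open>Each move is its own inverse, hence the transition matrix is symmetric and densities
  evolve under the operator that averages functions.\<close>

lemma pmf_chain_Suc:
  assumes "x \<in> \<Omega>" "y \<in> \<Omega>"
  shows "pmf (chain_power K (Suc t) x) y = lazy_avg (pmf (chain_power K t x)) y"
proof -
  let ?\<mu> = "chain_power K t x"
  have "pmf (chain_power K (Suc t) x) y = measure_pmf.expectation ?\<mu> (\<lambda>z. pmf (K z) y)"
    by (simp add: chain_power_def pmf_bind)
  also have "\<dots> = (\<Sum>z\<in>\<Omega>. pmf ?\<mu> z * pmf (K z) y)"
    using finite_states set_pmf_chain[OF assms(1)]
    by (subst integral_measure_pmf[of \<Omega>]) (auto simp: mult.commute)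
  also have "\<dots> = (\<Sum>z\<in>\<Omega>. pmf ?\<mu> z * of_bool (z = y) / 2 + (\<Sum>F\<in>Fs. pmf ?\<mu> z * of_bool (m F z = y)) / (2 * f))"
    by (intro sum.cong refl) (simp add: pmf_step distrib_left sum_distrib_left)
  also have "\<dots> = (\<Sum>z\<in>\<Omega>. pmf ?\<mu> z * of_bool (z = y)) / 2
      + (\<Sum>F\<in>Fs. \<Sum>z\<in>\<Omega>. pmf ?\<mu> z * of_bool (m F z = y)) / (2 * f)"
    by (simp only: sum.distrib sum_divide_distrib[symmetric] sum.swap[of _ \<Omega> Fs])
  also have "(\<Sum>z\<in>\<Omega>. pmf ?\<mu> z * of_bool (z = y)) = pmf ?\<mu> y"
    using assms(2) finite_states by (simp add: of_bool_def if_distrib sum.delta cong: if_cong)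
  also have "(\<Sum>F\<in>Fs. \<Sum>z\<in>\<Omega>. pmf ?\<mu> z * of_bool (m F z = y)) = (\<Sum>F\<in>Fs. pmf ?\<mu> (m F y))"
  proof (rule sum.cong[OF refl])
    fix F assume F: "F \<in> Fs"
    have "(\<Sum>z\<in>\<Omega>. pmf ?\<mu> z * of_bool (m F z = y)) = (\<Sum>z\<in>\<Omega>. if m F y = z then pmf ?\<mu> z else 0)"
      using F assms(2) involution closed by (intro sum.cong refl) (auto simp: of_bool_def)
    also have "\<dots> = pmf ?\<mu> (m F y)"
      using F assms(2) closed finite_states by (subst sum.delta') auto
    finally show "(\<Sum>z\<in>\<Omega>. pmf ?\<mu> z * of_bool (m F z = y)) = pmf ?\<mu> (m F y)" .
  qed
  finally show ?thesis by (simp add: lazy_avg_def avg_def add_divide_distrib)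
qed

text \<open>The deviation of the density from uniform has mean zero and initial squared norm at most
  1. The squared norm shrinks by the factor 1 - \<gamma> per step, and passing from the 2-norm to
  the 1-norm costs the square root of the number of states.\<close>

lemma tv_dist_chain_le:
  assumes poincare: "\<And>g. (\<Sum>x\<in>\<Omega>. g x) = 0 \<Longrightarrow>
      \<gamma> * (\<Sum>x\<in>\<Omega>. (g x)\<^sup>2) \<le> (\<Sum>F\<in>Fs. \<Sum>x\<in>\<Omega>. (g x - g (m F x))\<^sup>2) / (4 * f)"
    and x: "x \<in> \<Omega>"
  shows "tv_dist (chain_power K t x) (pmf_of_set \<Omega>) \<le> sqrt (real (card \<Omega>)) * exp (- \<gamma> * real t / 2)"
proof -
  define n where "n = real (card \<Omega>)"
  have n: "n > 0" using x finite_states by (auto simp: n_def card_gt_0_iff)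
  define g where "g t y = pmf (chain_power K t x) y - 1 / n" for t y
  have mean: "(\<Sum>y\<in>\<Omega>. g t y) = 0" for t
    using n finite_states sum_pmf_eq_1[OF finite_states set_pmf_chain[OF x]]
    by (auto simp: g_def sum_subtractf n_def)
  have g_Suc: "g (Suc t) y = lazy_avg (g t) y" if "y \<in> \<Omega>" for t y
    using f_pos by (simp add: g_def pmf_chain_Suc[OF x that] lazy_avg_def avg_def sum_subtractf diff_divide_distrib add_divide_distrib)
  have norm: "(\<Sum>y\<in>\<Omega>. (g t y)\<^sup>2) \<le> exp (- \<gamma> * real t)" for t
  proof (induction t)
    case 0
    have "(g 0 y)\<^sup>2 = of_bool (y = x) * (1 - 2 / n) + 1 / n\<^sup>2" for y
      by (auto simp: g_def chain_power_def power2_diff power_divide)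
    then have "(\<Sum>y\<in>\<Omega>. (g 0 y)\<^sup>2) = 1 - 2 / n + n * (1 / n\<^sup>2)"
      using x finite_states by (simp add: sum.distrib sum_distrib_right[symmetric] n_def of_bool_def sum.delta)
    also have "\<dots> \<le> 1" using n by (simp add: power2_eq_square field_simps)
    finally show ?case by simp
  next
    case (Suc t)
    have "(\<Sum>y\<in>\<Omega>. (g (Suc t) y)\<^sup>2) = (\<Sum>y\<in>\<Omega>. (lazy_avg (g t) y)\<^sup>2)"
      by (intro sum.cong refl) (simp add: g_Suc)
    also have "\<dots> \<le> (1 - \<gamma>) * (\<Sum>y\<in>\<Omega>. (g t y)\<^sup>2)"
      by (rule lazy_avg_contraction[OF poincare[OF mean]])
    also have "\<dots> \<le> exp (- \<gamma>) * (\<Sum>y\<in>\<Omega>. (g t y)\<^sup>2)"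
      using exp_ge_add_one_self[of "- \<gamma>"] by (intro mult_right_mono sum_nonneg) auto
    also have "\<dots> \<le> exp (- \<gamma>) * exp (- \<gamma> * real t)"
      using Suc by simp
    finally show ?case by (simp add: exp_add[symmetric] algebra_simps)
  qed
  have "tv_dist (chain_power K t x) (pmf_of_set \<Omega>) \<le> (\<Sum>y\<in>\<Omega>. \<bar>pmf (chain_power K t x) y - pmf (pmf_of_set \<Omega>) y\<bar>)"
    using x finite_states set_pmf_of_set[of \<Omega>] by (intro tv_dist_le_sum set_pmf_chain) blast+
  also have "\<dots> = (\<Sum>y\<in>\<Omega>. \<bar>g t y\<bar>)"
  proof (intro sum.cong refl)
    fix y assume "y \<in> \<Omega>"
    then have "pmf (pmf_of_set \<Omega>) y = 1 / n"
      using finite_states by (subst pmf_of_set) (auto simp: n_def)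
    then show "\<bar>pmf (chain_power K t x) y - pmf (pmf_of_set \<Omega>) y\<bar> = \<bar>g t y\<bar>"
      by (simp add: g_def)
  qed
  also have "\<dots> \<le> sqrt (n * (\<Sum>y\<in>\<Omega>. (g t y)\<^sup>2))"
    using Cauchy_Schwarz_ineq_sum[of "\<lambda>_. 1" "\<lambda>y. \<bar>g t y\<bar>" \<Omega>] by (intro real_le_rsqrt) (simp add: n_def)
  also have "\<dots> \<le> sqrt (n * exp (- \<gamma> * real t))"
    using norm[of t] n by (intro real_sqrt_le_mono mult_left_mono) auto
  also have "\<dots> = sqrt n * exp (- \<gamma> * real t / 2)"
  proof -
    have "exp (- \<gamma> * real t) = (exp (- \<gamma> * real t / 2))\<^sup>2"
      by (simp add: power2_eq_square exp_add[symmetric])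
    then show ?thesis by (simp add: real_sqrt_mult)
  qed
  finally show ?thesis by (simp add: n_def)
qed

end

section \<open>Height functions and towers\<close>

datatype colour = Red | Green | Blue

lemma UNIV_colour: "(UNIV :: colour set) = {Red, Green, Blue}"
  using colour.exhaust by auto

instance colour :: finite
  by standard (simp add: UNIV_colour)

lemma all_colour: "(\<forall>c. P c) \<longleftrightarrow> P Red \<and> P Green \<and> P Blue"
  by (metis colour.exhaust)

datatype tri = Tri (tcol: int) (trow: int) (upward: bool)

text \<open>\<open>Tri i j True\<close> has the corners \<open>(i, j), (i + 1, j), (i, j + 1)\<close> and \<open>Tri i j False\<close> the corners
  \<open>(i + 1, j + 1), (i, j + 1), (i + 1, j)\<close>. The colour of an edge is its direction, so straight strips of
  triangles alternate between two colours and a turn around a vertex cycles through all three.\<close>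

fun nbr :: "colour \<Rightarrow> tri \<Rightarrow> tri" where
  "nbr Red (Tri i j u) = Tri i j (\<not> u)"
| "nbr Green (Tri i j u) = Tri (if u then i - 1 else i + 1) j (\<not> u)"
| "nbr Blue (Tri i j u) = Tri i (if u then j - 1 else j + 1) (\<not> u)"

lemma nbr_nbr [simp]: "nbr c (nbr c T) = T"
  by (cases T; cases c) auto

lemma nbr_swap: "nbr c T = U \<longleftrightarrow> T = nbr c U"
  by (metis nbr_nbr)

lemma nbr_eq_nbr [simp]: "nbr c T = nbr d T \<longleftrightarrow> c = d"
  by (cases T; cases c; cases d) auto

lemma upward_nbr [simp]: "upward (nbr c T) = (\<not> upward T)"
  by (cases T; cases c) auto

lemma nbr_neq [simp]: "nbr c T \<noteq> T" "T \<noteq> nbr c T"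
  by (metis upward_nbr)+

lemma hexagon:
  assumes "a \<noteq> b" "b \<noteq> c" "a \<noteq> c"
  shows "nbr c (nbr b (nbr a (nbr c (nbr b (nbr a T))))) = T"
  using assms by (cases T; cases a; cases b; cases c) auto

definition alt :: "colour \<Rightarrow> colour \<Rightarrow> nat \<Rightarrow> colour" where
  "alt a b m = (if even m then a else b)"

text \<open>For \<open>a = b\<close> the walk goes back and forth. Heights increase strictly along a
  tower, so this occurs only in towers with at most one step, where the second colour has no
  influence.\<close>

primrec strip :: "colour \<Rightarrow> colour \<Rightarrow> tri \<Rightarrow> nat \<Rightarrow> tri" where
  "strip a b E 0 = E"
| "strip a b E (Suc m) = nbr (alt a b m) (strip a b E m)"

text \<open>Read from its end, the strip starts with the colour of step k - 1, which has the parity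
  of k + 1; writing \<open>k + 1\<close> keeps the formula meaningful for k = 0.\<close>

lemma strip_reverse:
  assumes "m \<le> k"
  shows "strip (alt a b (k + 1)) (alt a b k) (strip a b E k) m = strip a b E (k - m)"
  using assms
proof (induction m)
  case (Suc m)
  then have km: "k - m = Suc (k - Suc m)" by simp
  have "alt (alt a b (k + 1)) (alt a b k) m = alt a b (k - Suc m)"
    using Suc.prems by (auto simp: alt_def)
  then show ?case using Suc km by simp
qed simp

lemma strip_inj: "strip a b E m = strip a b E' m \<Longrightarrow> E = E'"
proof (induction m)
  case (Suc m)
  then have "strip a b E m = strip a b E' m" by (metis nbr_nbr strip.simps(2))
  then show ?case by (rule Suc.IH)
qed simp

text \<open>Used with the signs 1 and -1. Towers to be raised are the towers of the negated heights,
  so the theory of lowering covers both directions.\<close>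

definition scale :: "int \<Rightarrow> (tri \<Rightarrow> int) \<Rightarrow> tri \<Rightarrow> int" where
  "scale s h = (\<lambda>U. s * h U)"

definition lower :: "int \<Rightarrow> tri set \<Rightarrow> (tri \<Rightarrow> int) \<Rightarrow> tri \<Rightarrow> int" where
  "lower s A h = (\<lambda>U. if U \<in> A then h U - 2 * s else h U)"

lemma lower_empty [simp]: "lower s {} h = h"
  by (simp add: lower_def)

locale region =
  fixes S :: "tri set"
  assumes finite_S: "finite S"
begin

definition heights :: "(tri \<Rightarrow> int) set" where
  "heights = {h. (\<forall>T. T \<notin> S \<longrightarrow> h T = 0) \<and> (\<forall>T\<in>S. \<forall>c. \<bar>h (nbr c T) - h T\<bar> = 1)}"

lemma heights_zero: "h \<in> heights \<Longrightarrow> T \<notin> S \<Longrightarrow> h T = 0"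
  by (simp add: heights_def)

lemma heights_lipschitz: "h \<in> heights \<Longrightarrow> \<bar>h (nbr c T) - h T\<bar> \<le> 1"
proof -
  assume h: "h \<in> heights"
  consider "T \<in> S" | "nbr c T \<in> S" | "T \<notin> S" "nbr c T \<notin> S" by blast
  then show ?thesis
  proof cases
    case 2
    then have "\<bar>h (nbr c (nbr c T)) - h (nbr c T)\<bar> = 1" using h unfolding heights_def by blast
    then show ?thesis by simp
  qed (use h in \<open>simp_all add: heights_def\<close>)
qed

lemma heights_step: "h \<in> heights \<Longrightarrow> T \<in> S \<Longrightarrow> h (nbr c T) = h T + 1 \<or> h (nbr c T) = h T - 1"
  unfolding heights_def by (smt (verit) mem_Collect_eq)

lemma scale_heights: "h \<in> heights \<Longrightarrow> s \<in> {1, -1} \<Longrightarrow> scale s h \<in> heights"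
  by (auto simp: heights_def scale_def abs_minus_commute)

lemma scale_scale: "s \<in> {1, -1} \<Longrightarrow> scale s (scale s h) = h"
  by (auto simp: scale_def)

text \<open>A tower is listed from its last element \<open>E\<close> up to its local maximum: every element but
  the local maximum has exactly one higher neighbour, namely the next element.\<close>

definition tower :: "(tri \<Rightarrow> int) \<Rightarrow> colour \<Rightarrow> colour \<Rightarrow> nat \<Rightarrow> tri \<Rightarrow> bool" where
  "tower h a b k E \<longleftrightarrow> (\<forall>m\<le>k. strip a b E m \<in> S \<and>
     (\<forall>c. h (nbr c (strip a b E m)) = h (strip a b E m) + (if m < k \<and> c = alt a b m then 1 else - 1)))"

lemma towerD:
  assumes "tower h a b k E" "m \<le> k"
  shows "strip a b E m \<in> S"
    and "h (nbr c (strip a b E m)) = h (strip a b E m) + (if m < k \<and> c = alt a b m then 1 else - 1)"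
  using assms unfolding tower_def by blast+

lemma tower_height:
  assumes "tower h a b k E" "m \<le> k"
  shows "h (strip a b E m) = h E + int m"
  using assms(2)
proof (induction m)
  case (Suc m)
  then show ?case using towerD(2)[OF assms(1), of m "alt a b m"] by simp
qed simp

lemma tower_strip_eq:
  assumes "tower h a b k E" "m \<le> k" "m' \<le> k" "strip a b E m = strip a b E m'"
  shows "m = m'"
proof -
  have "h E + int m = h E + int m'"
    using tower_height[OF assms(1,2)] tower_height[OF assms(1,3)] unfolding assms(4) by (rule trans[OF sym])
  then show ?thesis by simp
qed

text \<open>The next element is forced, being the only higher neighbour, and the tower stops exactly
  where no neighbour is higher. The colours themselves are not determined when the tower is
  short.\<close>

lemma tower_unique:
  assumes t: "tower h a b k E" and t': "tower h a' b' k' E"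
  shows "k = k'" and "m \<le> k \<Longrightarrow> strip a b E m = strip a' b' E m"
proof -
  have one: "m \<le> k' \<and> strip a b E m = strip a' b' E m"
    if "tower h a b k E" "tower h a' b' k' E" "m \<le> k" for a b k a' b' k' m
    using that(3)
  proof (induction m)
    case (Suc m)
    then have IH: "m \<le> k'" "strip a b E m = strip a' b' E m" by auto
    have "h (nbr (alt a b m) (strip a b E m)) = h (strip a b E m) + 1"
      using towerD(2)[OF that(1), of m "alt a b m"] Suc.prems by simp
    then have "m < k' \<and> alt a b m = alt a' b' m"
      using towerD(2)[OF that(2) IH(1), of "alt a b m"] IH(2) by (auto split: if_splits)
    then show ?case using IH by simp
  qed simp
  show "k = k'" using one[OF t t', of k] one[OF t' t, of k'] by simp
  show "m \<le> k \<Longrightarrow> strip a b E m = strip a' b' E m" using one[OF t t'] by blast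
qed

text \<open>A set instead of two colours and a length, since short towers have several descriptions
  with the same elements. It is empty if no tower has \<open>E\<close> as its last element.\<close>

definition tower_set :: "(tri \<Rightarrow> int) \<Rightarrow> tri \<Rightarrow> tri set" where
  "tower_set h E = {strip a b E m | a b k m. tower h a b k E \<and> m \<le> k}"

lemma tower_set_eq:
  assumes "tower h a b k E"
  shows "tower_set h E = strip a b E ` {..k}"
proof -
  have "strip a' b' E m \<in> strip a b E ` {..k}" if "tower h a' b' k' E" "m \<le> k'" for a' b' k' m
    using tower_unique[OF that(1) assms] that(2) by auto
  then show ?thesis using assms unfolding tower_set_def by blast
qed

lemma tower_set_empty_iff: "tower_set h E = {} \<longleftrightarrow> (\<forall>a b k. \<not> tower h a b k E)"
proof
  assume "tower_set h E = {}"
  then show "\<forall>a b k. \<not> tower h a b k E" using tower_set_eq by fastforce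
qed (simp add: tower_set_def)

lemma tower_set_nonempty:
  assumes "tower_set h E \<noteq> {}"
  obtains a b k where "tower h a b k E" "tower_set h E = strip a b E ` {..k}"
proof -
  obtain a b k where "tower h a b k E" using assms unfolding tower_set_empty_iff by blast
  then show thesis using that tower_set_eq by blast
qed

lemma card_tower_set: "tower h a b k E \<Longrightarrow> card (tower_set h E) = Suc k"
proof -
  assume t: "tower h a b k E"
  have "inj_on (strip a b E) {..k}"
    using tower_strip_eq[OF t] by (auto intro!: inj_onI)
  then show ?thesis by (simp add: tower_set_eq[OF t] card_image)
qed

lemma tower_set_subset: "tower_set h E \<subseteq> S"
proof
  fix U assume "U \<in> tower_set h E"
  then obtain a b k m where "tower h a b k E" "m \<le> k" "U = strip a b E m" unfolding tower_set_def by blast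
  then show "U \<in> S" using towerD(1) by simp
qed

lemma finite_tower_set [simp]: "finite (tower_set h E)"
  using tower_set_subset finite_S finite_subset by blast

lemma card_tower_set_le: "card (tower_set h E) \<le> card S"
  using tower_set_subset finite_S card_mono by blast

lemma tower_offstrip:
  assumes t: "tower h a b k E" and m: "m \<le> k" and V: "nbr c (strip a b E m) \<in> strip a b E ` {..k}"
  shows "(m < k \<and> c = alt a b m) \<or> (0 < m \<and> nbr c (strip a b E m) = strip a b E (m - 1))"
proof -
  obtain j where j: "j \<le> k" "nbr c (strip a b E m) = strip a b E j" using V by auto
  show ?thesis
  proof (cases "m < k \<and> c = alt a b m")
    case False
    then have "int j = int m - 1"
      using towerD(2)[OF t m, of c] tower_height[OF t m] tower_height[OF t j(1)] j(2) by simp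
    then have "0 < m" "j = m - 1" by linarith+
    then show ?thesis using j by simp
  qed simp
qed

text \<open>Every neighbour outside the tower is one lower than its tower element and becomes one
  higher, while differences inside the tower persist. For the negated heights the same triangles
  therefore form a tower read from the other end.\<close>

lemma lower_tower_heights:
  assumes h: "h \<in> heights" and t: "tower h a b k E"
  shows "lower 1 (tower_set h E) h \<in> heights"
    and "tower (scale (-1) (lower 1 (tower_set h E) h)) (alt a b (k + 1)) (alt a b k) k (strip a b E k)"
proof -
  define A where "A = strip a b E ` {..k}"
  define h' where "h' = lower 1 A h"
  have tA: "tower_set h E = A" unfolding A_def by (rule tower_set_eq[OF t])
  have h'_A: "h' (strip a b E m) = h (strip a b E m) - 2" if "m \<le> k" for m
    using that by (simp add: h'_def lower_def A_def)
  have dif: "h' (nbr c (strip a b E m)) = h' (strip a b E m) +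
       (if 0 < m \<and> c = alt a b (m - 1) then - 1 else 1)" if m: "m \<le> k" for m c
  proof (cases "0 < m \<and> c = alt a b (m - 1)")
    case True
    then have "nbr c (strip a b E m) = strip a b E (m - 1)"
      by (cases m) auto
    then show ?thesis
      using True m h'_A[of m] h'_A[of "m - 1"] tower_height[OF t, of m] tower_height[OF t, of "m - 1"]
      by simp
  next
    case False
    have nm: "\<not> (0 < m \<and> nbr c (strip a b E m) = strip a b E (m - 1))"
      using False nbr_eq_nbr[of c "strip a b E m" "alt a b (m - 1)"] by (cases m) auto
    show ?thesis
    proof (cases "m < k \<and> c = alt a b m")
      case True
      then have "nbr c (strip a b E m) = strip a b E (Suc m)" by simp
      then show ?thesis using True False h'_A[of m] h'_A[of "Suc m"]
          tower_height[OF t, of m] tower_height[OF t, of "Suc m"] by simp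
    next
      case no: False
      then have "nbr c (strip a b E m) \<notin> A"
        using tower_offstrip[OF t m, of c] nm unfolding A_def by blast
      then have "h' (nbr c (strip a b E m)) = h (nbr c (strip a b E m))"
        by (simp add: h'_def lower_def)
      then show ?thesis using no False towerD(2)[OF t m, of c] h'_A[OF m] by auto
    qed
  qed
  have off: "h' U = h U" if "U \<notin> A" for U using that by (simp add: h'_def lower_def)
  have "h' \<in> heights"
    unfolding heights_def
  proof (intro CollectI conjI allI impI ballI)
    fix T assume "T \<notin> S"
    moreover have "A \<subseteq> S" using tower_set_subset[of h E] tA by simp
    ultimately have "h' T = h T" using off by blast
    then show "h' T = 0" using heights_zero[OF h \<open>T \<notin> S\<close>] by simp
  next
    fix T c assume T: "T \<in> S"
    consider "T \<in> A" | "nbr c T \<in> A" | "T \<notin> A" "nbr c T \<notin> A" by blast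
    then show "\<bar>h' (nbr c T) - h' T\<bar> = 1"
    proof cases
      case 1
      then show ?thesis using dif by (auto simp: A_def)
    next
      case 2
      then obtain m where "m \<le> k" "nbr c T = strip a b E m" by (auto simp: A_def)
      then have "T = nbr c (strip a b E m)" using nbr_swap by blast
      then show ?thesis using dif[OF \<open>m \<le> k\<close>, of c] by simp
    next
      case 3
      then show ?thesis using off h T by (auto simp: heights_def)
    qed
  qed
  then show "lower 1 (tower_set h E) h \<in> heights" by (simp add: tA h'_def)
  have "tower (scale (-1) h') (alt a b (k + 1)) (alt a b k) k (strip a b E k)"
    unfolding tower_def
  proof (intro allI impI conjI)
    fix m c assume m: "m \<le> k"
    note sr = strip_reverse[OF m, of a b E]
    show "strip (alt a b (k + 1)) (alt a b k) (strip a b E k) m \<in> S"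
      using sr towerD(1)[OF t, of "k - m"] by simp
    have "alt (alt a b (k + 1)) (alt a b k) m = alt a b (k - m - 1)" if "m < k"
      using that by (auto simp: alt_def)
    then show "scale (-1) h' (nbr c (strip (alt a b (k + 1)) (alt a b k) (strip a b E k) m)) =
       scale (-1) h' (strip (alt a b (k + 1)) (alt a b k) (strip a b E k) m) +
        (if m < k \<and> c = alt (alt a b (k + 1)) (alt a b k) m then 1 else - 1)"
      unfolding sr using dif[of "k - m" c] m by (auto simp: scale_def)
  qed
  then show "tower (scale (-1) (lower 1 (tower_set h E) h)) (alt a b (k + 1)) (alt a b k) k (strip a b E k)"
    by (simp add: tA h'_def)
qed

end

section \<open>Two height functions that differ by one flip, and their towers\<close>

locale flip_pair = region +
  fixes x y :: "tri \<Rightarrow> int" and F :: tri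
  assumes x: "x \<in> heights" and y: "y \<in> heights" and F: "F \<in> S"
    and y_def: "y = x(F := x F + 2)"
begin

lemma y_off [simp]: "U \<noteq> F \<Longrightarrow> y U = x U" and y_F [simp]: "y F = x F + 2"
  by (simp_all add: y_def)

lemma x_nbr [simp]: "x (nbr c F) = x F + 1"
  using heights_step[OF x F, of c] heights_step[OF y F, of c] by auto

text \<open>Negation exchanges the two functions, so each result on lowering towers has a twin on
  raising them.\<close>

lemma flip_pair_neg: "flip_pair S (scale (-1) y) (scale (-1) x) F"
proof
  show "scale (-1) x = (scale (-1) y)(F := scale (-1) y F + 2)"
    by (auto simp: scale_def y_def)
qed (use x y F in \<open>auto simp: scale_heights\<close>)

text \<open>\<open>F\<close> is a local minimum of \<open>x\<close> with three higher neighbours,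
  whereas a tower element has at most one.\<close>

lemma x_tower_avoids:
  assumes t: "tower x a b k E" and m: "m \<le> k"
  shows "strip a b E m \<noteq> F"
proof
  assume *: "strip a b E m = F"
  obtain c where "c \<noteq> alt a b m" by (metis colour.distinct(1))
  then show False using towerD(2)[OF t m, of c] * by simp
qed

lemma x_tower_imp_y:
  assumes t: "tower x a b k E" and away: "\<And>m c. m \<le> k \<Longrightarrow> strip a b E m \<noteq> nbr c F"
  shows "tower y a b k E"
  unfolding tower_def
proof (intro allI impI conjI)
  fix m c assume m: "m \<le> k"
  show "strip a b E m \<in> S" using towerD(1)[OF t m] .
  have "nbr c (strip a b E m) \<noteq> F" using away[OF m, of c] nbr_swap by blast
  then show "y (nbr c (strip a b E m)) = y (strip a b E m) + (if m < k \<and> c = alt a b m then 1 else - 1)"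
    using towerD(2)[OF t m, of c] x_tower_avoids[OF t m] by simp
qed

lemma y_tower_top:
  assumes t: "tower y a b k E" and m: "m \<le> k" and "strip a b E m = F"
  shows "m = k"
proof (rule ccontr)
  assume "m \<noteq> k"
  then show False using towerD(2)[OF t m, of "alt a b m"] assms(3) m by simp
qed

text \<open>Once \<open>F\<close> is lowered, the element before it has no higher neighbour left and
  becomes the top.\<close>

lemma y_tower_shorten:
  assumes t: "tower y a b (Suc k) E" and top: "strip a b E (Suc k) = F"
  shows "tower x a b k E"
  unfolding tower_def
proof (intro allI impI conjI)
  fix m c assume m: "m \<le> k"
  then have m': "m \<le> Suc k" by simp
  show "strip a b E m \<in> S" using towerD(1)[OF t m'] .
  have mF: "strip a b E m \<noteq> F" using tower_strip_eq[OF t m', of "Suc k"] top m by auto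
  show "x (nbr c (strip a b E m)) = x (strip a b E m) + (if m < k \<and> c = alt a b m then 1 else - 1)"
  proof (cases "nbr c (strip a b E m) = F")
    case True
    have hF: "y F = y E + int (Suc k)" using tower_height[OF t, of "Suc k"] top by simp
    have hm: "y (strip a b E m) = y E + int m" using tower_height[OF t m'] .
    have mk: "m = k" using hF hm towerD(2)[OF t m', of c] True m by (auto split: if_splits)
    show ?thesis using True hF hm mF mk by simp
  next
    case False
    moreover have "m = k \<Longrightarrow> c \<noteq> alt a b m" using False top by auto
    ultimately show ?thesis using towerD(2)[OF t m', of c] mF m by auto
  qed
qed

text \<open>In \<open>y\<close> every neighbour of \<open>F\<close> is lower than \<open>F\<close>,
  so a tower through such a neighbour would have to continue to \<open>F\<close>.\<close>

lemma y_tower_avoiding: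
  assumes t: "tower y a b k E" and av: "\<And>m. m \<le> k \<Longrightarrow> strip a b E m \<noteq> F"
  shows "tower x a b k E" and "m \<le> k \<Longrightarrow> strip a b E m \<noteq> nbr c F"
proof -
  have nn: "strip a b E m \<noteq> nbr c F" if m: "m \<le> k" for m c
  proof
    assume eq: "strip a b E m = nbr c F"
    then have "m < k \<and> c = alt a b m"
      using towerD(2)[OF t m, of c] by (auto split: if_splits)
    then show False using av[of "Suc m"] eq by simp
  qed
  then show "m \<le> k \<Longrightarrow> strip a b E m \<noteq> nbr c F" .
  show "tower x a b k E" unfolding tower_def
  proof (intro allI impI conjI)
    fix m c assume m: "m \<le> k"
    show "strip a b E m \<in> S" using towerD(1)[OF t m] .
    have "nbr c (strip a b E m) \<noteq> F" using nn[OF m, of c] nbr_swap by blast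
    then show "x (nbr c (strip a b E m)) = x (strip a b E m) + (if m < k \<and> c = alt a b m then 1 else - 1)"
      using towerD(2)[OF t m, of c] av[OF m] by simp
  qed
qed

text \<open>Otherwise \<open>F\<close>, the last three tower elements before it, a neighbour \<open>W\<close> of the lowest of them and a
  neighbour of \<open>F\<close> would be the six triangles around a vertex. As \<open>W\<close> is three levels below the
  neighbour of \<open>F\<close>, this contradicts the Lipschitz property.\<close>

lemma no_wrong_turn:
  assumes t: "tower x a b k E" and m: "m \<le> k" and m2: "2 \<le> m" and eq: "strip a b E m = nbr c F"
  shows "c = alt a b m"
proof (rule ccontr)
  assume ne: "c \<noteq> alt a b m"
  obtain n where n: "m = Suc (Suc n)" using m2 by (metis add_2_eq_Suc le_Suc_ex)
  define d where "d = alt a b (Suc n)"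
  define e where "e = alt a b n"
  have em: "alt a b m = e" by (simp add: e_def n alt_def)
  define P2 where "P2 = strip a b E n"
  have P: "strip a b E (Suc n) = nbr e P2" by (simp add: P2_def e_def)
  have Fm: "nbr c F = nbr d (nbr e P2)" using eq n P by (simp add: d_def)
  have h: "x (nbr c F) = x P2 + 2"
    using tower_height[OF t m] tower_height[OF t, of n] m eq by (simp add: n P2_def)
  have cd: "c \<noteq> d"
    using Fm x_tower_avoids[OF t, of "Suc n"] m P n by (metis Suc_leD nbr_nbr)
  have de: "d \<noteq> e"
    using Fm h by auto
  have ce: "c \<noteq> e" using ne em by simp
  have "F = nbr c (nbr d (nbr e P2))" using Fm nbr_swap by metis
  then have "nbr e F = nbr e (nbr c (nbr d (nbr e P2)))" by simp
  also have "\<dots> = nbr d (nbr c P2)"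
    using hexagon[of e d c P2] cd de ce by (metis nbr_nbr)
  finally have W: "nbr e F = nbr d (nbr c P2)" .
  have "x (nbr c P2) = x P2 - 1"
    using towerD(2)[OF t, of n c] m n ce by (simp add: P2_def e_def)
  then show False
    using heights_lipschitz[OF x, of d "nbr c P2"] x_nbr[of e] h unfolding W by simp
qed

lemma x_tower_extend_aligned:
  assumes t: "tower x a b k E" and eq: "strip a b E k = nbr (alt a b k) F"
  shows "tower y a b (Suc k) E" and "strip a b E (Suc k) = F"
proof -
  show SF: "strip a b E (Suc k) = F" using eq by simp
  show "tower y a b (Suc k) E" unfolding tower_def
  proof (intro allI impI conjI)
    fix m c assume mS: "m \<le> Suc k"
    show "strip a b E m \<in> S" using towerD(1)[OF t, of m] SF F mS by (cases "m = Suc k") auto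
    show "y (nbr c (strip a b E m)) = y (strip a b E m) + (if m < Suc k \<and> c = alt a b m then 1 else - 1)"
    proof (cases "m = Suc k")
      case True
      then show ?thesis using SF by simp
    next
      case False
      then have m: "m \<le> k" using mS by simp
      have mF: "strip a b E m \<noteq> F" using x_tower_avoids[OF t m] .
      show ?thesis
      proof (cases "nbr c (strip a b E m) = F")
        case True
        then have Fc: "strip a b E m = nbr c F" using nbr_swap by blast
        then have "x (strip a b E m) = x (strip a b E k)" using eq by simp
        then have "m = k" using tower_height[OF t m] tower_height[OF t, of k] by simp
        then have "c = alt a b m" using Fc eq by simp
        then show ?thesis using True Fc m by simp
      next
        case False
        moreover have "m = k \<Longrightarrow> c \<noteq> alt a b m" using False SF by auto
        ultimately show ?thesis using towerD(2)[OF t m, of c] mF m by auto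
      qed
    qed
  qed
qed

lemma x_tower_extend:
  assumes t: "tower x a b k E" and eq: "strip a b E k = nbr c F"
  shows "tower_set y E = insert F (tower_set x E)" "F \<notin> tower_set x E"
proof -
  show "F \<notin> tower_set x E" using x_tower_avoids[OF t] tower_set_eq[OF t] by auto
  \<comment> \<open>The colours may have to be renamed so that the strip runs on to
    \<open>F\<close>: for one element both are free, for two elements the second is free, and for
    longer towers \<open>no_wrong_turn\<close> shows that the given ones fit.\<close>
  have "\<exists>a' b'. tower x a' b' k E \<and> strip a' b' E k = nbr c F \<and> c = alt a' b' k"
  proof -
    consider "k = 0" | "k = 1" | "2 \<le> k" by linarith
    then show ?thesis
    proof cases
      case 1
      then have "tower x c c k E" using t by (simp add: tower_def)
      then show ?thesis using 1 eq by (intro exI[of _ c]) (simp add: alt_def)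
    next
      case 2
      have "strip a c E m = strip a b E m" if "m \<le> 1" for m
        using that by (cases m) (auto simp: alt_def)
      moreover have "alt a c m = alt a b m" if "m < 1" for m using that by (simp add: alt_def)
      ultimately have "tower x a c k E" using t 2 by (auto simp: tower_def)
      then show ?thesis using 2 eq by (intro exI[of _ a] exI[of _ c]) (simp add: alt_def)
    next
      case 3
      then show ?thesis using no_wrong_turn[OF t _ 3 eq] t eq by blast
    qed
  qed
  then obtain a' b' where t': "tower x a' b' k E" "strip a' b' E k = nbr (alt a' b' k) F" by metis
  have "tower_set y E = strip a' b' E ` {..Suc k}"
    using x_tower_extend_aligned(1)[OF t'] by (rule tower_set_eq)
  also have "\<dots> = insert F (tower_set x E)"
    using x_tower_extend_aligned(2)[OF t'] tower_set_eq[OF t'(1)] by (simp add: atMost_Suc)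
  finally show "tower_set y E = insert F (tower_set x E)" .
qed

text \<open>In \<open>y\<close> the element beside \<open>F\<close> has two higher neighbours,
  \<open>F\<close> and its successor, so no tower can pass through it.\<close>

lemma x_tower_blocked:
  assumes t: "tower x a b k E" and m: "m < k" and eq: "strip a b E m = nbr c F"
  shows "tower_set y E = {}"
proof (rule ccontr)
  assume "tower_set y E \<noteq> {}"
  then obtain a' b' k' where t': "tower y a' b' k' E" by (metis tower_set_nonempty)
  show False
  proof (cases "\<exists>j\<le>k'. strip a' b' E j = F")
    case True
    then have top: "strip a' b' E k' = F" using y_tower_top[OF t'] by blast
    show False
    proof (cases k')
      case 0
      then show False using top x_tower_avoids[OF t, of 0] by simp
    next
      case (Suc k'')
      have tx: "tower x a' b' k'' E" using y_tower_shorten t' top Suc by blast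
      have kk: "k = k''" using tower_unique(1)[OF t tx] .
      have em: "strip a b E m = strip a' b' E m" and em': "strip a b E (Suc m) = strip a' b' E (Suc m)"
        using tower_unique(2)[OF t tx, of m] tower_unique(2)[OF t tx, of "Suc m"] m by linarith+
      have "c = alt a' b' m"
        using towerD(2)[OF t', of m c] m kk Suc unfolding em[symmetric] eq by (auto split: if_splits)
      then have "strip a' b' E (Suc m) = F" using em[symmetric] eq by simp
      then show False using em' x_tower_avoids[OF t, of "Suc m"] m by simp
    qed
  next
    case False
    then have tx: "tower x a' b' k' E" using y_tower_avoiding(1)[OF t'] by blast
    then show False
      using y_tower_avoiding(2)[OF t', of m c] False tower_unique[OF t tx] m eq by auto
  qed
qed

lemma tower_set_F: "tower_set x F = {}" "tower_set y F = {F}"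
proof -
  show "tower_set x F = {}" using x_tower_avoids[of _ _ _ F 0] by (auto simp: tower_set_empty_iff)
  have "tower y Red Red 0 F" using F by (simp add: tower_def)
  from tower_set_eq[OF this] show "tower_set y F = {F}" by simp
qed

text \<open>What matters is where the tower of \<open>x\<close> contains a neighbour of
  \<open>F\<close>: nowhere leaves it intact, at the top lets it grow by \<open>F\<close>, below the
  top destroys it.\<close>

lemma tower_set_cases:
  assumes E: "E \<noteq> F"
  obtains (same) "tower_set x E = tower_set y E"
  | (extended) "tower_set x E \<noteq> {}" "F \<notin> tower_set x E" "tower_set y E = insert F (tower_set x E)"
      "card (tower_set x E) = 1 \<Longrightarrow> \<exists>c. E = nbr c F \<and> (\<forall>d. x (nbr d E) = x E - 1)"
  | (blocked) c a b k m where "tower_set y E = {}" "2 \<le> card (tower_set x E)" "tower x a b k E" "m < k"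
      "strip a b E m = nbr c F"
proof (cases "tower_set x E = {}")
  case True
  have "tower_set y E = {}"
  proof (rule ccontr)
    assume "tower_set y E \<noteq> {}"
    then obtain a b k where t: "tower y a b k E" by (metis tower_set_nonempty)
    have "\<exists>j. tower x a b j E"
    proof (cases "\<exists>j\<le>k. strip a b E j = F")
      case True
      then have top: "strip a b E k = F" using y_tower_top[OF t] by blast
      then have "k \<noteq> 0" using E by (cases k) auto
      then show ?thesis using y_tower_shorten t top by (metis not0_implies_Suc)
    next
      case False
      then show ?thesis using y_tower_avoiding(1)[OF t] by blast
    qed
    then show False using True tower_set_empty_iff by blast
  qed
  then show thesis using True same by simp
next
  case False
  then obtain a b k where t: "tower x a b k E" and ts: "tower_set x E = strip a b E ` {..k}"
    by (metis tower_set_nonempty)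
  show thesis
  proof (cases "\<exists>m\<le>k. \<exists>c. strip a b E m = nbr c F")
    case True
    then obtain m c where m: "m \<le> k" "strip a b E m = nbr c F" by blast
    show thesis
    proof (cases "m = k")
      case True
      have "\<exists>c. E = nbr c F \<and> (\<forall>d. x (nbr d E) = x E - 1)" if "card (tower_set x E) = 1"
      proof -
        have "k = 0" using that card_tower_set[OF t] by simp
        then show ?thesis using True m towerD(2)[OF t, of 0] by auto
      qed
      then show thesis using extended[OF False] x_tower_extend[OF t, of c] True m by simp
    next
      case False
      then have "m < k" using m by simp
      moreover have "2 \<le> card (tower_set x E)" using card_tower_set[OF t] \<open>m < k\<close> by simp
      ultimately show thesis using blocked x_tower_blocked[OF t _ m(2)] t m(2) by blast
    qed
  next
    case False
    then have "tower y a b k E" using x_tower_imp_y[OF t] by blast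
    then show thesis using same ts tower_set_eq by metis
  qed
qed

end

lemma third_colour: "\<exists>c :: colour. c \<noteq> a \<and> c \<noteq> b"
  by (metis colour.distinct(1,3,5))

lemma colour_cases3:
  assumes "c \<noteq> d" "d \<noteq> e" "c \<noteq> (e :: colour)"
  shows "a = c \<or> a = d \<or> a = e"
  using assms by (cases a; cases c; cases d; cases e) auto

section \<open>Counting the towers around a flip that drive the two copies apart\<close>

context flip_pair
begin

text \<open>Only extensions from length 1 to 2 are collected: for longer towers the product of
  length and acceptance probability is constant, so their extension does not raise the expected
  distance.\<close>

definition ext :: "tri set" where
  "ext = {E \<in> S. E \<noteq> F \<and> card (tower_set x E) = 1 \<and> tower_set y E = insert F (tower_set x E)}"

definition blk :: "tri set" where
  "blk = {E \<in> S. tower_set y E = {} \<and> 2 \<le> card (tower_set x E)}"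

lemma F_notin_tower_set: "F \<notin> tower_set x E"
proof
  assume "F \<in> tower_set x E"
  then obtain a b k m where "tower x a b k E" "m \<le> k" "F = strip a b E m" unfolding tower_set_def by blast
  then show False using x_tower_avoids by metis
qed

lemma ext_nbr: "E \<in> ext \<Longrightarrow> \<exists>c. E = nbr c F \<and> (\<forall>d. x (nbr d E) = x F)"
proof -
  assume E: "E \<in> ext"
  then have EF: "E \<noteq> F" "card (tower_set x E) = 1" "tower_set y E = insert F (tower_set x E)" by (auto simp: ext_def)
  show ?thesis
  proof (cases rule: tower_set_cases[OF EF(1)])
    case 1
    then show ?thesis using EF F_notin_tower_set by blast
  next
    case 2
    then obtain c where "E = nbr c F" "\<And>d. x (nbr d E) = x E - 1" using EF by blast
    then show ?thesis by auto
  next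
    case (3 c a b k m)
    then show ?thesis using EF by simp
  qed
qed

text \<open>The local picture of a blocked tower: \<open>c\<close> leads from \<open>F\<close> to
  the tower element beside it, \<open>e\<close> from there to the next higher element, and
  \<open>d\<close> is the third direction. \<open>E\<close> is the element beside \<open>F\<close>
  or its predecessor in direction \<open>d\<close>. The last conjunct gives the element above at
  most one higher neighbour, as befits a tower.\<close>

definition blocked_at :: "colour \<Rightarrow> colour \<Rightarrow> colour \<Rightarrow> tri \<Rightarrow> bool" where
  "blocked_at c d e E \<longleftrightarrow> c \<noteq> d \<and> d \<noteq> e \<and> c \<noteq> e \<and>
     x (nbr e (nbr c F)) = x F + 2 \<and> x (nbr d (nbr c F)) = x F \<and>
     (E = nbr c F \<or> E = nbr d (nbr c F) \<and> (\<forall>c'. c' \<noteq> d \<longrightarrow> x (nbr c' E) = x F - 1)) \<and>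
     (\<exists>g. \<forall>c'. c' \<noteq> g \<longrightarrow> x (nbr c' (nbr e (nbr c F))) = x F + 1)"

lemma blk_blocked_at:
  assumes E: "E \<in> blk"
  shows "\<exists>c d e. blocked_at c d e E"
proof -
  have EF: "E \<noteq> F" using E tower_set_F by (auto simp: blk_def)
  show ?thesis
  proof (cases rule: tower_set_cases[OF EF])
    case 1
    then show ?thesis using E by (auto simp: blk_def)
  next
    case 2
    then show ?thesis using E by (simp add: blk_def)
  next
    case (3 c a b k m)
    note t = 3(3) and mk = 3(4) and eq = 3(5)
    define e where "e = alt a b m"
    have up: "x (nbr e (nbr c F)) = x F + 2"
      using towerD(2)[OF t, of m e] mk eq by (simp add: e_def)
    have ce: "c \<noteq> e" using up by auto
    obtain d where d: "d \<noteq> c" "d \<noteq> e" using third_colour by blast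
    have down: "x (nbr d (nbr c F)) = x F"
      using towerD(2)[OF t, of m d] mk eq d by (simp add: e_def)
    have "strip a b E (Suc m) = nbr e (nbr c F)" using eq by (simp add: e_def)
    then have "\<forall>c'. c' \<noteq> alt a b (Suc m) \<longrightarrow> x (nbr c' (nbr e (nbr c F))) = x F + 1"
      using towerD(2)[OF t, of "Suc m"] mk up by auto
    then have P: "\<exists>g. \<forall>c'. c' \<noteq> g \<longrightarrow> x (nbr c' (nbr e (nbr c F))) = x F + 1" by blast
    \<comment> \<open>From position 2 on, \<open>no_wrong_turn\<close> would make \<open>F\<close>
      the next triangle of the tower, but \<open>F\<close> is lower in \<open>x\<close>.\<close>
    have "m < 2"
    proof (rule ccontr)
      assume "\<not> m < 2"
      then show False using no_wrong_turn[OF t _ _ eq] mk ce by (simp add: e_def)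
    qed
    then consider "m = 0" | "m = 1" by linarith
    then have "E = nbr c F \<or> E = nbr d (nbr c F) \<and> (\<forall>c'. c' \<noteq> d \<longrightarrow> x (nbr c' E) = x F - 1)"
    proof cases
      case 1
      then show ?thesis using eq by simp
    next
      case 2
      have aE: "nbr a E = nbr c F" using eq 2 by (simp add: alt_def)
      then have Ea: "E = nbr a (nbr c F)" using nbr_swap by blast
      have "a \<noteq> c" using Ea EF by auto
      moreover have "a \<noteq> e"
        using up Ea tower_height[OF t, of 1] 2 mk aE eq by auto
      ultimately have "a = d" using d ce colour_cases3 by metis
      moreover have "x (nbr c' E) = x F - 1" if "c' \<noteq> a" for c'
        using towerD(2)[OF t, of 0 c'] that tower_height[OF t, of 1] 2 mk eq by (simp add: alt_def)
      ultimately show ?thesis using Ea by auto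
    qed
    then show ?thesis unfolding blocked_at_def using ce d up down P by metis
  qed
qed

lemma finite_ext [simp]: "finite ext" and finite_blk [simp]: "finite blk"
  by (rule finite_subset[OF _ finite_S], force simp: ext_def)
    (rule finite_subset[OF _ finite_S], force simp: blk_def)

end

text \<open>The weights 2 and 1 are the expected increases 1/3 and 1/6 in units of 1/6. Both signs
  are treated together because they compete for the same heights around \<open>nbr c F\<close>: an
  extension excludes every other cost on this side of \<open>F\<close>. Blocked towers of one sign
  have at most two possible last elements, and if both signs occur, each has only
  \<open>nbr c F\<close>.\<close>

lemma (in flip_pair) cost_per_colour:
  fixes c
  defines "F' \<equiv> nbr c F"
  defines "xe \<equiv> {E \<in> ext. E = F'}" and "xb \<equiv> {E \<in> blk. \<exists>d e. blocked_at c d e E}"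
    and "ye \<equiv> {E \<in> flip_pair.ext S (scale (-1) y) (scale (-1) x) F. E = F'}"
    and "yb \<equiv> {E \<in> flip_pair.blk S (scale (-1) y) (scale (-1) x). \<exists>d e. flip_pair.blocked_at (scale (-1) y) F c d e E}"
  shows "2 * card xe + card xb + 2 * card ye + card yb \<le> 2"
proof -
  interpret neg: flip_pair S "scale (-1) y" "scale (-1) x" F by (rule flip_pair_neg)
  have nF: "nbr d (nbr c F) \<noteq> F" if "d \<noteq> c" for d
    using that nbr_eq_nbr nbr_nbr by metis
  have nF2: "nbr g (nbr d (nbr c F)) \<noteq> F" for g d
    by (metis upward_nbr)
  have xeD: "x (nbr d F') = x F" if "xe \<noteq> {}" for d
  proof -
    have "F' \<in> ext" using that by (auto simp: xe_def)
    then show ?thesis using ext_nbr by blast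
  qed
  have yeD: "x (nbr d F') = x F + 2" if "ye \<noteq> {}" "d \<noteq> c" for d
  proof -
    have "F' \<in> neg.ext" using that(1) by (auto simp: ye_def)
    then have "scale (-1) y (nbr d F') = scale (-1) y F" using neg.ext_nbr by blast
    then show ?thesis using nF[OF that(2)] by (simp add: scale_def F'_def)
  qed
  have xbD: "\<exists>d e. blocked_at c d e E" if "E \<in> xb" for E using that by (simp add: xb_def)
  have ybD: "\<exists>d e. d \<noteq> c \<and> d \<noteq> e \<and> c \<noteq> e \<and> x (nbr e F') = x F \<and> x (nbr d F') = x F + 2 \<and>
      (E = F' \<or> E = nbr d F' \<and> (\<forall>c'. c' \<noteq> d \<longrightarrow> x (nbr c' E) = x F + 3)) \<and>
      (\<exists>g. \<forall>c'. c' \<noteq> g \<longrightarrow> x (nbr c' (nbr e F')) = x F + 1)" if Eyb: "E \<in> yb" for E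
  proof -
    obtain d e where b: "neg.blocked_at c d e E" using Eyb unfolding yb_def by blast
    then have ne: "c \<noteq> d" "d \<noteq> e" "c \<noteq> e" by (auto simp: neg.blocked_at_def)
    have neg_y: "scale (-1) y U = - x U" if "U \<noteq> F" for U using that by (simp add: scale_def)
    have neg_F: "scale (-1) y F = - x F - 2" by (simp add: scale_def)
    have de: "d \<noteq> c" "e \<noteq> c" using ne by auto
    have up: "x (nbr e F') = x F" and dn: "x (nbr d F') = x F + 2"
      using b nF[OF de(1)] nF[OF de(2)] unfolding neg.blocked_at_def F'_def by (simp_all add: neg_y neg_F)
    have "- x (nbr c' (nbr d F')) = - x F - 3 \<longleftrightarrow> x (nbr c' (nbr d F')) = x F + 3" for c' by linarith
    then have at: "E = F' \<or> E = nbr d F' \<and> (\<forall>c'. c' \<noteq> d \<longrightarrow> x (nbr c' E) = x F + 3)"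
      using b nF2[of _ d] unfolding neg.blocked_at_def F'_def by (auto simp: neg_y neg_F)
    obtain g where "\<And>c'. c' \<noteq> g \<Longrightarrow> scale (-1) y (nbr c' (nbr e F')) = scale (-1) y F + 1"
      using b unfolding neg.blocked_at_def F'_def by blast
    then have "\<forall>c'. c' \<noteq> g \<longrightarrow> x (nbr c' (nbr e F')) = x F + 1"
      using nF2[of _ e] by (fastforce simp: neg_y neg_F F'_def)
    then show ?thesis using ne de up dn at by blast
  qed
  have xe1: "card xe \<le> 1" and ye1: "card ye \<le> 1"
    unfolding xe_def ye_def by (auto intro!: card_le_Suc0_iff_eq[THEN iffD2])
  have fin: "finite xb" "finite yb" by (simp_all add: xb_def yb_def)
  have two: "card A \<le> 2" if A: "A = {} \<or> (\<exists>d. A \<subseteq> {F', nbr d F'})" for A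
  proof (cases "A = {}")
    case False
    then obtain d where "A \<subseteq> {F', nbr d F'}" using A by blast
    then have "card A \<le> card {F', nbr d F'}" by (intro card_mono) auto
    then show ?thesis by (simp add: card_insert_if split: if_splits)
  qed simp
  show ?thesis
  proof (cases "xe = {} \<and> ye = {}")
    case False
    obtain d where d: "d \<noteq> c" by (metis third_colour)
    have "xb = {}"
    proof (rule ccontr)
      assume "xb \<noteq> {}"
      then obtain E d e where b: "blocked_at c d e E" using xbD by blast
      then have "x (nbr e F') = x F + 2" "x (nbr d F') = x F" "e \<noteq> c" "d \<noteq> c"
        by (auto simp: blocked_at_def F'_def)
      then show False using False xeD[of e] yeD[of d] by auto
    qed
    moreover have "yb = {}"
    proof (rule ccontr)
      assume "yb \<noteq> {}"
      then obtain d e where "x (nbr e F') = x F" "x (nbr d F') = x F + 2" "e \<noteq> c" "d \<noteq> c"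
        using ybD by (metis ex_in_conv)
      then show False using False xeD[of d] yeD[of e] by auto
    qed
    moreover have "xe = {} \<or> ye = {}" 
    proof (rule ccontr)
      assume "\<not> (xe = {} \<or> ye = {})"
      then show False using xeD[of d] yeD[of d] d by simp
    qed
    ultimately show ?thesis using xe1 ye1 by auto
  next
    case no: True
    consider "xb = {}" | "yb = {}" | E E' where "E \<in> xb" "E' \<in> yb" by blast
    then have "card xb + card yb \<le> 2"
    proof cases
      case 1
      have "yb = {} \<or> (\<exists>d. yb \<subseteq> {F', nbr d F'})"
      proof (cases "yb = {}")
        case False
        then obtain E where "E \<in> yb" by blast
        then obtain d e where de: "d \<noteq> c" "d \<noteq> e" "c \<noteq> e" "x (nbr e F') = x F" "x (nbr d F') = x F + 2"
          using ybD by metis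
        have "E2 \<in> {F', nbr d F'}" if E2: "E2 \<in> yb" for E2
        proof -
          obtain d' where d': "x (nbr d' F') = x F + 2" "d' \<noteq> c" "E2 = F' \<or> E2 = nbr d' F'"
            using ybD[OF E2] by metis
          have "d' = d" using d' de colour_cases3[of c d e d'] by auto
          then show ?thesis using d' by auto
        qed
        then show ?thesis by blast
      qed simp
      then have "card yb \<le> 2" using two by blast
      then show ?thesis using 1 by simp
    next
      case 2
      have "xb = {} \<or> (\<exists>d. xb \<subseteq> {F', nbr d F'})"
      proof (cases "xb = {}")
        case False
        then obtain E where "E \<in> xb" by blast
        then obtain d e where de: "blocked_at c d e E"
          using xbD by metis
        have "E2 \<in> {F', nbr d F'}" if E2: "E2 \<in> xb" for E2
        proof -
          obtain d' e' where d': "blocked_at c d' e' E2"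
            using xbD[OF E2] by metis
          have "d' = d" using d' de colour_cases3[of c d e d'] unfolding blocked_at_def by auto
          then show ?thesis using d' unfolding blocked_at_def F'_def by auto
        qed
        then show ?thesis by blast
      qed simp
      then have "card xb \<le> 2" using two by blast
      then show ?thesis using 2 by simp
    next
      case 3
      \<comment> \<open>The directions \<open>d\<close> and \<open>e\<close> of the two signs are
        exchanged, so the triangle below in one picture is the triangle above in the other. The
        pictures prescribe different heights for its neighbours, each with one exceptional
        direction, and some colour avoids both exceptions.\<close>
      have xbF: "E2 = F'" if E2: "E2 \<in> xb" for E2
      proof (rule ccontr)
        assume ne: "E2 \<noteq> F'"
        obtain d e where de: "blocked_at c d e E2" using xbD[OF E2] by blast
        then have low: "\<And>c'. c' \<noteq> d \<Longrightarrow> x (nbr c' (nbr d F')) = x F - 1"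
          using ne unfolding blocked_at_def F'_def by blast
        obtain d' e' g where y': "x (nbr e' F') = x F" "x (nbr d' F') = x F + 2" "d' \<noteq> c" "d' \<noteq> e'" "c \<noteq> e'"
          "\<And>c'. c' \<noteq> g \<Longrightarrow> x (nbr c' (nbr e' F')) = x F + 1"
          using ybD[OF 3(2)] by metis
        have "e' = d" using y' de colour_cases3[of c d e e'] unfolding blocked_at_def F'_def by auto
        moreover obtain c' where "c' \<noteq> d" "c' \<noteq> g" using third_colour by blast
        ultimately show False using low[of c'] y'(6)[of c'] by simp
      qed
      have ybF: "E2 = F'" if E2: "E2 \<in> yb" for E2
      proof (rule ccontr)
        assume ne: "E2 \<noteq> F'"
        obtain d' e' where y': "x (nbr e' F') = x F" "x (nbr d' F') = x F + 2" "d' \<noteq> c" "d' \<noteq> e'" "c \<noteq> e'"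
          "\<forall>c'. c' \<noteq> d' \<longrightarrow> x (nbr c' (nbr d' F')) = x F + 3"
          using ybD[OF E2] ne by metis
        obtain d e where de: "blocked_at c d e E" using xbD[OF 3(1)] by blast
        then obtain g where g: "\<And>c'. c' \<noteq> g \<Longrightarrow> x (nbr c' (nbr e F')) = x F + 1"
          unfolding blocked_at_def F'_def by blast
        have "d' = e" using y' de colour_cases3[of c d e d'] unfolding blocked_at_def F'_def by auto
        moreover obtain c' where "c' \<noteq> d'" "c' \<noteq> g" using third_colour by blast
        ultimately show False using y'(6) g[of c'] by fastforce
      qed
      have "card xb \<le> 1" "card yb \<le> 1"
        using card_mono[of "{F'}" xb] card_mono[of "{F'}" yb] xbF ybF by (simp_all add: subset_iff)
      then show ?thesis by simp
    qed
    then show ?thesis using no by simp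
  qed
qed

text \<open>Three sides of \<open>F\<close> at cost 2 each. The total 6, in units of 1/6, is exactly
  what coalescence at \<open>F\<close> with probability 1/2 in each of the two signs pays
  for.\<close>

lemma (in flip_pair) total_cost:
  "2 * card ext + card blk + 2 * card (flip_pair.ext S (scale (-1) y) (scale (-1) x) F)
     + card (flip_pair.blk S (scale (-1) y) (scale (-1) x)) \<le> 6"
proof -
  interpret neg: flip_pair S "scale (-1) y" "scale (-1) x" F by (rule flip_pair_neg)
  have split: "card A \<le> (\<Sum>c\<in>UNIV. card {E \<in> A. Q c E})"
    if "\<And>E. E \<in> A \<Longrightarrow> \<exists>c. Q c E" for A :: "tri set" and Q :: "colour \<Rightarrow> tri \<Rightarrow> bool"
  proof -
    have "A = (\<Union>c\<in>UNIV. {E \<in> A. Q c E})" using that by auto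
    then have "card A = card (\<Union>c\<in>UNIV. {E \<in> A. Q c E})" by (rule arg_cong)
    also have "\<dots> \<le> (\<Sum>c\<in>UNIV. card {E \<in> A. Q c E})" by (rule card_UN_le) simp
    finally show ?thesis .
  qed
  have 1: "card ext \<le> (\<Sum>c\<in>UNIV. card {E \<in> ext. E = nbr c F})"
    using ext_nbr by (intro split) blast
  have 2: "card neg.ext \<le> (\<Sum>c\<in>UNIV. card {E \<in> neg.ext. E = nbr c F})"
    using neg.ext_nbr by (intro split) blast
  have 3: "card blk \<le> (\<Sum>c\<in>UNIV. card {E \<in> blk. \<exists>d e. blocked_at c d e E})"
    using blk_blocked_at by (intro split) blast
  have 4: "card neg.blk \<le> (\<Sum>c\<in>UNIV. card {E \<in> neg.blk. \<exists>d e. neg.blocked_at c d e E})"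
    using neg.blk_blocked_at by (intro split) blast
  have "(\<Sum>c\<in>UNIV. 2 * card {E \<in> ext. E = nbr c F} + card {E \<in> blk. \<exists>d e. blocked_at c d e E}
      + 2 * card {E \<in> neg.ext. E = nbr c F} + card {E \<in> neg.blk. \<exists>d e. neg.blocked_at c d e E})
      \<le> (\<Sum>c\<in>(UNIV :: colour set). 2)"
    by (intro sum_mono cost_per_colour)
  also have "\<dots> = 6" by (simp add: UNIV_colour)
  finally show ?thesis
    using 1 2 3 4 by (simp add: sum.distrib sum_distrib_left[symmetric])
qed

section \<open>The coupling of the tower chain\<close>

context region
begin

text \<open>With each triangle such a set would contain the rest of its row to the right, which is
  impossible in a finite region. This is how facts known outside \<open>S\<close> are carried into
  it.\<close>

lemma escape:
  assumes sub: "B \<subseteq> S" and closed: "\<And>T c. T \<in> B \<Longrightarrow> nbr c T \<in> B"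
  shows "B = {}"
proof (rule ccontr)
  assume ne: "B \<noteq> {}"
  define pos :: "tri \<Rightarrow> int" where "pos T = 2 * tcol T + (if upward T then 0 else 1)" for T
  have fin: "finite (pos ` B)" using sub finite_S finite_subset by blast
  have "Max (pos ` B) \<in> pos ` B" using fin ne by (intro Max_in) auto
  then obtain T where T: "T \<in> B" "pos T = Max (pos ` B)" by (metis imageE)
  define c where "c = (if upward T then Red else Green)"
  have "pos (nbr c T) = pos T + 1" by (cases T) (auto simp: pos_def c_def)
  moreover have "pos (nbr c T) \<le> Max (pos ` B)" using closed[OF T(1)] fin by simp
  ultimately show False using T by simp
qed

lemma heights_parity:
  assumes x: "x \<in> heights" and y: "y \<in> heights"
  shows "even (x T - y T)"
proof -
  have "{T. odd (x T - y T)} = {}"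
  proof (rule escape)
    show "{T. odd (x T - y T)} \<subseteq> S"
    proof
      fix T assume "T \<in> {T. odd (x T - y T)}"
      then show "T \<in> S" using heights_zero[OF x, of T] heights_zero[OF y, of T] by (cases "T \<in> S") auto
    qed
    then have sub: "\<And>T. odd (x T - y T) \<Longrightarrow> T \<in> S" by blast
    fix T c assume "T \<in> {T. odd (x T - y T)}"
    then have "odd (x T - y T)" "T \<in> S" using sub by auto
    then show "nbr c T \<in> {T. odd (x T - y T)}"
      using heights_step[OF x, of T c] heights_step[OF y, of T c] by auto
  qed
  then show ?thesis by blast
qed

lemma flip_heights:
  assumes h: "h \<in> heights" and T: "T \<in> S" and s: "s \<in> {1, -1}" and ext: "\<And>c. h (nbr c T) = h T - s"
  shows "h(T := h T - 2 * s) \<in> heights"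
  unfolding heights_def
proof (intro CollectI conjI allI impI ballI)
  fix U assume "U \<notin> S"
  then show "(h(T := h T - 2 * s)) U = 0" using T heights_zero[OF h] by auto
next
  fix U c assume U: "U \<in> S"
  show "\<bar>(h(T := h T - 2 * s)) (nbr c U) - (h(T := h T - 2 * s)) U\<bar> = 1"
  proof (cases "U = T \<or> nbr c U = T")
    case True
    then consider "U = T" | "U = nbr c T" "U \<noteq> T" using nbr_swap by blast
    then show ?thesis using ext[of c] s by cases auto
  next
    case False
    then show ?thesis using heights_step[OF h U, of c] by auto
  qed
qed

text \<open>One flip changes a height by 2, so half the sum counts the single flips between the two
  functions; by \<open>heights_parity\<close> it is a whole number on
  \<open>heights\<close>.\<close>

definition dst :: "(tri \<Rightarrow> int) \<Rightarrow> (tri \<Rightarrow> int) \<Rightarrow> real" where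
  "dst x y = (\<Sum>U\<in>S. \<bar>real_of_int (x U - y U)\<bar>) / 2"

lemma dst_commute: "dst x y = dst y x"
  unfolding dst_def by (simp add: abs_minus_commute)

lemma dst_triangle: "dst x z \<le> dst x y + dst y z"
proof -
  have "(\<Sum>U\<in>S. \<bar>real_of_int (x U - z U)\<bar>) \<le> (\<Sum>U\<in>S. \<bar>real_of_int (x U - y U)\<bar> + \<bar>real_of_int (y U - z U)\<bar>)"
    by (intro sum_mono) auto
  then show ?thesis by (simp add: dst_def sum.distrib)
qed

lemma dst_self [simp]: "dst x x = 0"
  by (simp add: dst_def)

lemma dst_scale: "s \<in> {1, -1} \<Longrightarrow> dst (scale s x) (scale s y) = dst x y"
  unfolding dst_def scale_def by (auto simp: abs_minus_commute)

lemma dst_lower: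
  assumes "A \<subseteq> S"
  shows "dst (lower 1 A x) x = card A"
proof -
  have "dst (lower 1 A x) x = (\<Sum>U\<in>S. if U \<in> A then 2 else 0) / 2"
    unfolding dst_def lower_def by (intro arg_cong2[where f = "(/)"] sum.cong refl) auto
  also have "\<dots> = card A"
    using finite_S assms by (simp add: sum.If_cases Int_absorb1)
  finally show ?thesis .
qed

lemma dst_lower_lower: "dst (lower s A x) (lower s A y) = dst x y"
  unfolding dst_def lower_def by (intro arg_cong2[where f = "(/)"] sum.cong refl) auto

lemma dst_upd:
  assumes "F \<in> S"
  shows "dst (x(F := v)) y = dst x y + (\<bar>real_of_int (v - y F)\<bar> - \<bar>real_of_int (x F - y F)\<bar>) / 2"
  using finite_S assms by (simp add: dst_def sum.remove[of S F] field_simps)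

lemma dst_ge_one:
  assumes x: "x \<in> heights" and y: "y \<in> heights" and "x \<noteq> y"
  shows "1 \<le> dst x y"
proof -
  obtain U where U: "x U \<noteq> y U" using assms(3) by blast
  then have US: "U \<in> S" using heights_zero[OF x] heights_zero[OF y] by metis
  have "even (x U - y U)" using heights_parity[OF x y] .
  then have "2 \<le> \<bar>x U - y U\<bar>" using U by presburger
  then have "2 \<le> \<bar>real_of_int (x U - y U)\<bar>" by linarith
  also have "\<dots> \<le> (\<Sum>U\<in>S. \<bar>real_of_int (x U - y U)\<bar>)"
    using US finite_S by (intro member_le_sum) auto
  finally show ?thesis by (simp add: dst_def)
qed

text \<open>A triangle of least \<open>x\<close>-height among those where \<open>x\<close> is below
  \<open>y\<close> is a local minimum of \<open>x\<close>, since a lower neighbour would belong to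
  the same set.\<close>

lemma approach_up:
  assumes x: "x \<in> heights" and y: "y \<in> heights" and T0: "x T0 < y T0"
  shows "\<exists>F z. flip_pair S x z F \<and> dst z y = dst x y - 1"
proof -
  define B where "B = {T. x T < y T}"
  have BS: "B \<subseteq> S"
  proof
    fix T assume "T \<in> B"
    then show "T \<in> S" using heights_zero[OF x, of T] heights_zero[OF y, of T] by (cases "T \<in> S") (auto simp: B_def)
  qed
  then have finB: "finite (x ` B)" using finite_S finite_subset by blast
  have "B \<noteq> {}" using T0 by (auto simp: B_def)
  then have "Min (x ` B) \<in> x ` B" using finB by (intro Min_in) auto
  then obtain F where F: "F \<in> B" "x F = Min (x ` B)" by (metis imageE)
  have FS: "F \<in> S" using F BS by blast
  have lt: "x F < y F" using F by (simp add: B_def)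
  have "even (y F - x F)" using heights_parity[OF y x] .
  then have F2: "x F + 2 \<le> y F" using lt by presburger
  have up: "x (nbr c F) = x F + 1" for c
  proof (rule ccontr)
    assume "x (nbr c F) \<noteq> x F + 1"
    then have down: "x (nbr c F) = x F - 1" using heights_step[OF x FS] by blast
    then have "nbr c F \<in> B" using heights_step[OF y FS, of c] F2 by (auto simp: B_def)
    then have "x F \<le> x (nbr c F)" using F(2) finB by simp
    then show False using down by simp
  qed
  define z where "z = x(F := x F + 2)"
  have z: "z \<in> heights"
    using flip_heights[OF x FS, of "-1"] up by (simp add: z_def)
  then have "flip_pair S x z F"
    using x FS by unfold_locales (auto simp: z_def)
  moreover have "dst z y = dst x y - 1"
    using F2 by (simp add: z_def dst_upd[OF FS])
  ultimately show ?thesis by blast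
qed

lemma approach:
  assumes x: "x \<in> heights" and y: "y \<in> heights" and ne: "x \<noteq> y"
  shows "\<exists>F z. (flip_pair S x z F \<or> flip_pair S z x F) \<and> z \<in> heights \<and> dst z y = dst x y - 1"
proof -
  obtain T where "x T \<noteq> y T" using ne by blast
  then consider "x T < y T" | "x T > y T" by linarith
  then show ?thesis
  proof cases
    case 1
    then show ?thesis using approach_up[OF x y 1] flip_pair.y by blast
  next
    case 2
    have s: "(-1::int) \<in> {1, -1}" by simp
    have "scale (-1) x T < scale (-1) y T" using 2 by (simp add: scale_def)
    then obtain F z where fp: "flip_pair S (scale (-1) x) z F"
      and d: "dst z (scale (-1) y) = dst (scale (-1) x) (scale (-1) y) - 1"
      using approach_up[OF scale_heights[OF x s] scale_heights[OF y s]] by blast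
    have "flip_pair S (scale (-1) z) x F"
      using flip_pair.flip_pair_neg[OF fp] by (simp add: scale_scale)
    moreover have "dst (scale (-1) z) y = dst x y - 1"
      using d dst_scale[OF s, of x y] dst_scale[OF s, of z "scale (-1) y"] by (simp add: scale_scale)
    moreover have "scale (-1) z \<in> heights" using scale_heights[OF flip_pair.y[OF fp] s] .
    ultimately show ?thesis by blast
  qed
qed

section \<open>Tower moves and the drift of the distance\<close>

definition N :: nat where "N = 12 * fact (card S + 1)"

definition threshold :: "nat \<Rightarrow> nat" where
  "threshold k = (if k = 0 then 0 else if k = 1 then N div 2 else N div (6 * k))"

lemma N_pos: "0 < N" by (simp add: N_def)

lemma threshold_one: "2 * real (threshold 1) = real N"
proof -
  have "2 * (N div 2) = N" by (rule dvd_mult_div_cancel) (simp add: N_def)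
  then show ?thesis by (simp add: threshold_def del: dvd_mult_div_cancel flip: of_nat_mult)
qed

lemma threshold_big: "2 \<le> k \<Longrightarrow> k \<le> card S + 1 \<Longrightarrow> 6 * (real k * real (threshold k)) = real N"
proof -
  assume k: "2 \<le> k" "k \<le> card S + 1"
  have "k dvd fact (card S + 1)" using k by (intro dvd_fact) auto
  then have "6 * k dvd 12 * fact (card S + 1)" by (intro mult_dvd_mono) auto
  then have "(6 * k) * (N div (6 * k)) = N" unfolding N_def by (rule dvd_mult_div_cancel)
  then have "6 * (k * threshold k) = N" using k by (simp add: threshold_def)
  then show ?thesis by (metis of_nat_mult of_nat_numeral)
qed

lemma threshold_le_N: "threshold k \<le> N"
  by (simp add: threshold_def)

lemma threshold_antimono: "1 \<le> k \<Longrightarrow> threshold (Suc k) \<le> threshold k"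
  by (auto simp: threshold_def intro!: div_le_mono2)

lemma threshold_two: "2 \<le> k \<Longrightarrow> 12 * threshold k \<le> N"
proof -
  assume "2 \<le> k"
  then have "threshold k \<le> N div 12" by (auto simp: threshold_def intro!: div_le_mono2)
  then show ?thesis by linarith
qed

lemma sum_below: "t \<le> N \<Longrightarrow> (\<Sum>b<N. of_bool (b < t)) = (real t)"
proof -
  assume "t \<le> N"
  then have "{..<N} \<inter> {b. b < t} = {..<t}" by auto
  then show ?thesis by (simp add: sum.If_cases of_bool_def)
qed

text \<open>One random step of the tower chain uses a uniform last element, sign and threshold \<open>b < N\<close>.
  A tower of length 1 is accepted with probability 1/2 and one of length \<open>k \<ge> 2\<close> with probability
  \<open>1/(6k)\<close>; these are the values for which the matched towers cancel and the unmatched ones cost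
  at most as much as the coalescence at the flipped triangle gains. The factor \<open>fact\<close> in \<open>N\<close> makes
  all these probabilities exact multiples of \<open>1/N\<close>.\<close>

definition tower_move :: "tri \<Rightarrow> int \<Rightarrow> nat \<Rightarrow> (tri \<Rightarrow> int) \<Rightarrow> tri \<Rightarrow> int" where
  "tower_move E s b h =
     (let A = tower_set (scale s h) E in if b < threshold (card A) then lower s A h else h)"

lemma scale_one [simp]: "scale 1 h = h"
  by (simp add: scale_def)

lemma lower_scale: "s \<in> {1, -1} \<Longrightarrow> lower s A h = scale s (lower 1 A (scale s h))"
  by (auto simp: lower_def scale_def)

lemma tower_move_scale: "s \<in> {1, -1} \<Longrightarrow> tower_move E s b h = scale s (tower_move E 1 b (scale s h))"
  unfolding tower_move_def Let_def scale_one
  by (subst lower_scale, assumption) (simp add: scale_scale)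

lemma lower_tower_set_heights:
  assumes "h \<in> heights" "s \<in> {1, -1}"
  shows "lower s (tower_set (scale s h) E) h \<in> heights"
proof (cases "tower_set (scale s h) E = {}")
  case True
  then show ?thesis using assms by simp
next
  case False
  then obtain a b k where "tower (scale s h) a b k E" by (metis tower_set_nonempty)
  then show ?thesis
    using lower_tower_heights(1)[OF scale_heights[OF assms]] assms(2)
    by (subst lower_scale) (auto intro: scale_heights)
qed

lemma tower_move_heights: "h \<in> heights \<Longrightarrow> s \<in> {1, -1} \<Longrightarrow> tower_move E s b h \<in> heights"
  using lower_tower_set_heights by (simp add: tower_move_def Let_def)

end

context flip_pair
begin

lemma dst_xy: "dst x y = 1"
  unfolding y_def dst_commute[of x] by (simp add: dst_upd[OF F])

text \<open>Both copies use the same threshold \<open>b\<close>. At \<open>F\<close> they merge with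
  probability 1/2; a blocked tower of length k moves \<open>x\<close> alone, at expected cost at
  most k / (6 k) = 1/6.\<close>

lemma drift_down_single:
  assumes E: "E \<in> S"
  shows "(\<Sum>b<N. dst (tower_move E 1 b x) (tower_move E 1 b y)) \<le>
     real N + real N * (of_bool (E \<in> ext) / 3 + of_bool (E \<in> blk) / 6 - of_bool (E = F) / 2)"
proof (cases "E = F")
  case True
  have ne: "E \<notin> ext" "E \<notin> blk" using True tower_set_F by (auto simp: ext_def blk_def)
  have low: "lower 1 {F} y = x" by (auto simp: lower_def)
  have "dst (tower_move E 1 b x) (tower_move E 1 b y) = 1 - of_bool (b < threshold 1)" for b
    using True tower_set_F low dst_xy by (auto simp: tower_move_def Let_def scale_def)
  then have "(\<Sum>b<N. dst (tower_move E 1 b x) (tower_move E 1 b y)) = real N - real (threshold 1)"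
    by (simp add: sum_subtractf sum_below[OF threshold_le_N])
  then show ?thesis using True ne threshold_one by simp
next
  case False
  have s1: "scale 1 h = h" for h by (simp add: scale_def)
  let ?k = "card (tower_set x E)"
  show ?thesis
  proof (cases rule: tower_set_cases[OF False])
    case 1
    have "tower_set y E \<noteq> insert F (tower_set x E)" using 1 F_notin_tower_set[of E] by blast
    then have ne: "E \<notin> ext" "E \<notin> blk" using 1 unfolding ext_def blk_def by (blast, force)
    have "dst (tower_move E 1 b x) (tower_move E 1 b y) = 1" for b
      using 1 dst_xy by (simp add: tower_move_def Let_def s1 dst_lower_lower)
    then show ?thesis using ne False by simp
  next
    case 2
    have blk: "E \<notin> blk" using 2 by (simp add: blk_def)
    have k1: "1 \<le> ?k" using 2 by (simp add: Suc_le_eq card_gt_0_iff)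
    have card_y: "card (tower_set y E) = Suc ?k" using 2 by simp
    have kS: "Suc ?k \<le> card S" using card_tower_set_le[of y E] card_y by simp
    have both: "lower 1 (insert F (tower_set x E)) y = lower 1 (tower_set x E) x"
      using 2(2) by (auto simp: lower_def)
    have one: "dst (lower 1 (tower_set x E) x) y \<le> real ?k + 1"
      using dst_triangle[of "lower 1 (tower_set x E) x" y x] dst_lower[OF tower_set_subset] dst_xy by simp
    \<comment> \<open>If both towers are accepted the copies merge. As thresholds decrease with
      length, acceptance in \<open>y\<close> implies acceptance in \<open>x\<close>, so
      \<open>y\<close> never moves alone.\<close>
    have "dst (tower_move E 1 b x) (tower_move E 1 b y) \<le>
        1 + (real ?k * of_bool (b < threshold ?k) - real (Suc ?k) * of_bool (b < threshold (Suc ?k)))" for b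
      using both one threshold_antimono[OF k1] dst_xy 2(3) card_y by (auto simp: tower_move_def Let_def s1)
    then have "(\<Sum>b<N. dst (tower_move E 1 b x) (tower_move E 1 b y)) \<le>
        (\<Sum>b<N. 1 + (real ?k * of_bool (b < threshold ?k) - real (Suc ?k) * of_bool (b < threshold (Suc ?k))))"
      by (intro sum_mono)
    also have "\<dots> = real N + (real ?k * real (threshold ?k) - real (Suc ?k) * real (threshold (Suc ?k)))"
      by (simp only: sum.distrib sum_subtractf sum_distrib_left[symmetric] sum_below[OF threshold_le_N]) simp
    \<comment> \<open>For length 1 the difference is 1/2 - 2/12 = 1/3 of \<open>N\<close>; for
      longer towers the two products coincide.\<close>
    also have "\<dots> \<le> real N + real N * (of_bool (E \<in> ext) / 3)"
    proof (cases "?k = 1")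
      case True
      have "E \<in> ext" using True E False 2 by (simp add: ext_def)
      then show ?thesis using True threshold_one threshold_big[of "Suc ?k"] kS by simp
    next
      case False
      then show ?thesis using k1 threshold_big[of ?k] threshold_big[of "Suc ?k"] kS by simp
    qed
    finally show ?thesis using blk False by simp
  next
    case (3 c a b k m)
    have ext: "E \<notin> ext" using 3 by (auto simp: ext_def)
    have blk: "E \<in> blk" using 3 E by (simp add: blk_def)
    have one: "dst (lower 1 (tower_set x E) x) y \<le> real ?k + 1"
      using dst_triangle[of "lower 1 (tower_set x E) x" y x] dst_lower[OF tower_set_subset] dst_xy by simp
    have "dst (tower_move E 1 b x) (tower_move E 1 b y) \<le> 1 + real ?k * of_bool (b < threshold ?k)" for b
      using one dst_xy 3(1) by (auto simp: tower_move_def Let_def s1)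
    then have "(\<Sum>b<N. dst (tower_move E 1 b x) (tower_move E 1 b y)) \<le> (\<Sum>b<N. 1 + real ?k * of_bool (b < threshold ?k))"
      by (intro sum_mono)
    also have "\<dots> = real N + real ?k * real (threshold ?k)"
      by (simp only: sum.distrib sum_distrib_left[symmetric] sum_below[OF threshold_le_N]) simp
    also have "\<dots> = real N + real N * (1 / 6)"
      using threshold_big[OF 3(2)] card_tower_set_le[of x E] by simp
    finally show ?thesis using blk ext False by simp
  qed
qed

lemma drift_down:
  "(\<Sum>E\<in>S. \<Sum>b<N. dst (tower_move E 1 b x) (tower_move E 1 b y)) \<le>
     real N * card S + real N * (card ext / 3 + card blk / 6 - 1 / 2)"
proof -
  have c: "(\<Sum>E\<in>S. of_bool (E \<in> A)) = real (card A)" if "A \<subseteq> S" for A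
    using that finite_S by (simp add: of_bool_def sum.If_cases Int_absorb1)
  have sub: "ext \<subseteq> S" "blk \<subseteq> S" by (auto simp: ext_def blk_def)
  have "(\<Sum>E\<in>S. \<Sum>b<N. dst (tower_move E 1 b x) (tower_move E 1 b y)) \<le>
     (\<Sum>E\<in>S. real N + real N * (of_bool (E \<in> ext) / 3 + of_bool (E \<in> blk) / 6 - of_bool (E = F) / 2))"
    by (intro sum_mono drift_down_single)
  also have "\<dots> = real N * card S + real N * ((\<Sum>E\<in>S. of_bool (E \<in> ext)) / 3 +
      (\<Sum>E\<in>S. of_bool (E \<in> blk)) / 6 - (\<Sum>E\<in>S. of_bool (E \<in> {F})) / 2)"
    by (simp add: sum.distrib sum_subtractf sum_distrib_left[symmetric] sum_divide_distrib[symmetric])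
  also have "\<dots> = real N * card S + real N * (card ext / 3 + card blk / 6 - 1 / 2)"
    using c[OF sub(1)] c[OF sub(2)] c[of "{F}"] F by simp
  finally show ?thesis .
qed

lemma drift_pair:
  "(\<Sum>s\<in>{1,-1}. \<Sum>E\<in>S. \<Sum>b<N. dst (tower_move E s b x) (tower_move E s b y)) \<le> 2 * real N * card S"
proof -
  interpret neg: flip_pair S "scale (-1) y" "scale (-1) x" F by (rule flip_pair_neg)
  have m1: "(-1::int) \<in> {1, -1}" by simp
  have "dst (tower_move E (-1) b x) (tower_move E (-1) b y) =
      dst (tower_move E 1 b (scale (-1) y)) (tower_move E 1 b (scale (-1) x))" for E b
    using tower_move_scale[OF m1] dst_scale[OF m1] dst_commute by metis
  then have "(\<Sum>s\<in>{1,-1}. \<Sum>E\<in>S. \<Sum>b<N. dst (tower_move E s b x) (tower_move E s b y)) =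
      (\<Sum>E\<in>S. \<Sum>b<N. dst (tower_move E 1 b x) (tower_move E 1 b y)) +
      (\<Sum>E\<in>S. \<Sum>b<N. dst (tower_move E 1 b (scale (-1) y)) (tower_move E 1 b (scale (-1) x)))"
    by simp
  also have "\<dots> \<le> 2 * real N * card S + real N *
      ((2 * card ext + card blk + 2 * card neg.ext + card neg.blk) / 6 - 1)"
    using drift_down neg.drift_down by (simp add: field_simps)
  also have "\<dots> \<le> 2 * real N * card S + real N * 0"
  proof -
    have "real (2 * card ext + card blk + 2 * card neg.ext + card neg.blk) \<le> 6"
      using total_cost by linarith
    then show ?thesis by (intro add_left_mono mult_left_mono) auto
  qed
  finally show ?thesis by simp
qed

end

text \<open>Path coupling: the moves are deterministic in \<open>E\<close>, \<open>s\<close> and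
  \<open>b\<close>, so the triangle inequality adds up the bounds for single flips along a shortest
  path from \<open>x\<close> to \<open>y\<close>.\<close>

lemma (in region) drift:
  assumes "x \<in> heights" "y \<in> heights"
  shows "(\<Sum>s\<in>{1,-1}. \<Sum>E\<in>S. \<Sum>b<N. dst (tower_move E s b x) (tower_move E s b y)) \<le> 2 * real N * card S * dst x y"
  using assms
proof (induction "nat \<lceil>dst x y\<rceil>" arbitrary: x rule: less_induct)
  case less
  let ?d = "\<lambda>x y. \<Sum>s\<in>{1,-1}. \<Sum>E\<in>S. \<Sum>b<N. dst (tower_move E s b x) (tower_move E s b y)"
  show ?case
  proof (cases "x = y")
    case True
    then show ?thesis by simp
  next
    case False
    obtain F z where z: "flip_pair S x z F \<or> flip_pair S z x F" "z \<in> heights" "dst z y = dst x y - 1"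
      using approach[OF less.prems False] by blast
    have "1 \<le> dst x y" using dst_ge_one[OF less.prems False] .
    then have "nat \<lceil>dst z y\<rceil> < nat \<lceil>dst x y\<rceil>" using z(3) by linarith
    then have IH: "?d z y \<le> 2 * real N * card S * dst z y"
      using less.hyps z(2) less.prems(2) by blast
    have xz: "?d x z \<le> 2 * real N * card S"
      using z(1)
    proof
      assume "flip_pair S z x F"
      from flip_pair.drift_pair[OF this] show ?thesis by (simp add: dst_commute)
    qed (rule flip_pair.drift_pair)
    have "?d x y \<le> (\<Sum>s\<in>{1,-1}. \<Sum>E\<in>S. \<Sum>b<N. dst (tower_move E s b x) (tower_move E s b z) + dst (tower_move E s b z) (tower_move E s b y))"
      by (intro sum_mono dst_triangle)
    also have "\<dots> = ?d x z + ?d z y" by (simp only: sum.distrib)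
    also have "\<dots> \<le> 2 * real N * card S + 2 * real N * card S * (dst x y - 1)"
      using xz IH z(3) by simp
    finally show ?thesis by (simp add: algebra_simps)
  qed
qed

section \<open>Fluctuation of the distance and contraction of a concave function of it\<close>

context region
begin

lemma tower_set_self: "tower_set h E \<noteq> {} \<Longrightarrow> E \<in> tower_set h E"
proof -
  assume "tower_set h E \<noteq> {}"
  then obtain a b k where "tower_set h E = strip a b E ` {..k}" by (metis tower_set_nonempty)
  then show ?thesis by (metis atMost_iff image_eqI le0 strip.simps(1))
qed

lemma tower_set_card_1: "card (tower_set h E) = 1 \<Longrightarrow> tower_set h E = {E}"
  using tower_set_self[of h E] by (metis card_1_singletonE empty_not_insert singletonD)

lemma tower_set_local_max:
  assumes "E \<in> S" "\<And>c. h (nbr c E) = h E - 1"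
  shows "tower_set h E = {E}"
proof -
  have "tower h Red Red 0 E" using assms by (simp add: tower_def)
  from tower_set_eq[OF this] show ?thesis by simp
qed

definition indep :: "(tri \<Rightarrow> int) \<Rightarrow> (tri \<Rightarrow> int) \<Rightarrow> tri \<Rightarrow> int \<Rightarrow> bool" where
  "indep x y E s \<longleftrightarrow> x E \<noteq> y E \<and> tower_set (scale s x) E = {E} \<and> tower_set (scale s y) E = {E}"

text \<open>The coupling uses a common threshold, except that two single flips at a triangle where the
  heights differ are decided independently. This does not change the expected distance but
  guarantees that the distance fluctuates.\<close>

definition coupled_dst :: "(tri \<Rightarrow> int) \<Rightarrow> (tri \<Rightarrow> int) \<Rightarrow> tri \<Rightarrow> int \<Rightarrow> nat \<Rightarrow> nat \<Rightarrow> real" where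
  "coupled_dst x y E s b b' = dst (tower_move E s b x) (tower_move E s (if indep x y E s then b' else b) y)"

lemma lower_single: "lower s {E} x = x(E := x E - 2 * s)"
  by (auto simp: lower_def)

text \<open>By parity the heights at \<open>E\<close> differ by at least 2, so shifting one of them
  by 2 cannot overshoot: the distance changes by exactly 1, with opposite signs for the two
  copies.\<close>

lemma dst_single_flip:
  assumes E: "E \<in> S" and s: "s \<in> {1, -1}" and xy: "x \<in> heights" "y \<in> heights" "x E \<noteq> y E"
  obtains \<sigma> :: real where "\<sigma>\<^sup>2 = 1" "dst (lower s {E} x) y = dst x y + \<sigma>"
    "dst x (lower s {E} y) = dst x y - \<sigma>"
proof -
  define a where "a = x E - y E"
  have "even a" "a \<noteq> 0" using heights_parity[OF xy(1,2), of E] xy(3) by (auto simp: a_def)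
  then have a: "a \<le> -2 \<or> 2 \<le> a" by presburger
  define \<sigma> :: real where "\<sigma> = (\<bar>real_of_int (a - 2 * s)\<bar> - \<bar>real_of_int a\<bar>) / 2"
  have 1: "dst (lower s {E} x) y = dst x y + \<sigma>"
    unfolding lower_single dst_upd[OF E] \<sigma>_def a_def by (simp add: algebra_simps)
  have "dst x (lower s {E} y) = dst x y + (\<bar>real_of_int (a + 2 * s)\<bar> - \<bar>real_of_int a\<bar>) / 2"
    unfolding lower_single dst_commute[of x] dst_upd[OF E] a_def by (simp add: algebra_simps abs_minus_commute)
  moreover have "(\<bar>real_of_int (a + 2 * s)\<bar> - \<bar>real_of_int a\<bar>) / 2 = - \<sigma>" and "\<sigma>\<^sup>2 = 1"
    using a s by (auto simp: \<sigma>_def)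
  ultimately show thesis using that 1 by simp
qed

lemma coupled_dst_indep:
  assumes i: "indep x y E s" and E: "E \<in> S" and s: "s \<in> {1, -1}" and xy: "x \<in> heights" "y \<in> heights"
  obtains \<sigma> :: real where "\<sigma>\<^sup>2 = 1"
    "\<And>b b'. coupled_dst x y E s b b' = dst x y + \<sigma> * (of_bool (b < threshold 1) - of_bool (b' < threshold 1))"
proof -
  have ne: "x E \<noteq> y E" and t: "tower_set (scale s x) E = {E}" "tower_set (scale s y) E = {E}"
    using i by (auto simp: indep_def)
  obtain \<sigma> :: real where sg: "\<sigma>\<^sup>2 = 1" "dst (lower s {E} x) y = dst x y + \<sigma>"
    "dst x (lower s {E} y) = dst x y - \<sigma>"
    by (rule dst_single_flip[OF E s xy ne])
  have "coupled_dst x y E s b b' = dst x y + \<sigma> * (of_bool (b < threshold 1) - of_bool (b' < threshold 1))" for b b'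
    using i t sg dst_lower_lower[of s "{E}" x y] by (auto simp: coupled_dst_def tower_move_def Let_def)
  then show thesis using that sg(1) by blast
qed

text \<open>Mean and variance of the difference of two independent fair coins, as
  \<open>threshold 1\<close> is half of \<open>N\<close>.\<close>

lemma sum_of_bool_diff:
  fixes \<sigma> :: real
  shows "(\<Sum>b<N. \<Sum>b'<N. \<sigma> * (of_bool (b < threshold 1) - of_bool (b' < threshold 1))) = 0"
    and "(\<Sum>b<N. \<Sum>b'<N. (of_bool (b < threshold 1) - of_bool (b' < threshold 1))\<^sup>2) = (real N)\<^sup>2 / 2"
proof -
  note sb = sum_below[OF threshold_le_N, of 1]
  show "(\<Sum>b<N. \<Sum>b'<N. \<sigma> * (of_bool (b < threshold 1) - of_bool (b' < threshold 1))) = 0"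
    by (simp add: sum_distrib_left[symmetric] sum_subtractf sb)
  have sq: "(of_bool p - of_bool q)\<^sup>2 = (of_bool p + of_bool q - 2 * (of_bool p * of_bool q) :: real)" for p q
    by (cases p; cases q) auto
  have "(\<Sum>b<N. \<Sum>b'<N. (of_bool (b < threshold 1) - of_bool (b' < threshold 1))\<^sup>2) =
     (\<Sum>b<N. \<Sum>b'<N. of_bool (b < threshold 1) + of_bool (b' < threshold 1) - 2 * (of_bool (b < threshold 1) * of_bool (b' < threshold 1)) :: real)"
    by (simp only: sq)
  also have "\<dots> = (\<Sum>b<N. real N * of_bool (b < threshold 1) + real (threshold 1) - 2 * (of_bool (b < threshold 1) * real (threshold 1)))"
    by (simp only: sum.distrib sum_subtractf sum_distrib_left[symmetric] sb sum_constant card_lessThan)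
  also have "\<dots> = real N * threshold 1 + real N * threshold 1 - 2 * (real (threshold 1) * threshold 1)"
    by (simp only: sum.distrib sum_subtractf sum_distrib_left[symmetric] sum_distrib_right[symmetric] sb sum_constant card_lessThan)
  also have "\<dots> = (real N)\<^sup>2 / 2"
    using threshold_one by (simp add: power2_eq_square flip: threshold_one)
  finally show "(\<Sum>b<N. \<Sum>b'<N. (of_bool (b < threshold 1) - of_bool (b' < threshold 1))\<^sup>2) = (real N)\<^sup>2 / 2" .
qed

lemma coupled_dst_mean:
  assumes xy: "x \<in> heights" "y \<in> heights"
  shows "(\<Sum>s\<in>{1,-1}. \<Sum>E\<in>S. \<Sum>b<N. \<Sum>b'<N. coupled_dst x y E s b b' - dst x y) \<le> 0"
proof -
  have eq: "(\<Sum>b<N. \<Sum>b'<N. coupled_dst x y E s b b' - dst x y) = N * (\<Sum>b<N. dst (tower_move E s b x) (tower_move E s b y) - dst x y)"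
    if s: "s \<in> {1, -1}" and E: "E \<in> S" for E s
  proof (cases "indep x y E s")
    case True
    then obtain \<sigma> :: real where c: "\<And>b b'. coupled_dst x y E s b b' = dst x y + \<sigma> * (of_bool (b < threshold 1) - of_bool (b' < threshold 1))"
      using coupled_dst_indep[OF True E s xy] by blast
    have t: "tower_set (scale s x) E = {E}" "tower_set (scale s y) E = {E}" using True by (auto simp: indep_def)
    have "dst (tower_move E s b x) (tower_move E s b y) = dst x y" for b
      using t dst_lower_lower[of s "{E}" x y] by (simp add: tower_move_def Let_def)
    then show ?thesis using sum_of_bool_diff(1)[of \<sigma>] by (simp add: c)
  next
    case False
    then show ?thesis by (simp add: coupled_dst_def sum_distrib_left)
  qed
  have "(\<Sum>s\<in>{1,-1}. \<Sum>E\<in>S. \<Sum>b<N. \<Sum>b'<N. coupled_dst x y E s b b' - dst x y)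
      = (\<Sum>s\<in>{1,-1}. \<Sum>E\<in>S. N * (\<Sum>b<N. dst (tower_move E s b x) (tower_move E s b y) - dst x y))"
    by (intro sum.cong refl eq)
  also have "\<dots> = N * ((\<Sum>s\<in>{1,-1}. \<Sum>E\<in>S. \<Sum>b<N. dst (tower_move E s b x) (tower_move E s b y)) - 2 * real N * card S * dst x y)"
    by (simp add: sum_distrib_left[symmetric] sum_subtractf algebra_simps)
  also have "\<dots> \<le> 0" using drift[OF xy] by (simp add: mult_nonneg_nonpos)
  finally show ?thesis .
qed

text \<open>If both copies can flip \<open>E\<close> alone, their independent decisions give second
  moment 1/2. Otherwise the other copy accepts its tower, if any, only for b < N / 12, so for the
  5/12 of all thresholds between N / 12 and N / 2 only the single flip happens and the distance
  changes by 1.\<close>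

lemma coupled_dst_second_moment:
  assumes xy: "x \<in> heights" "y \<in> heights" and E: "E \<in> S" and s: "s \<in> {1, -1}" and ne: "x E \<noteq> y E"
    and single: "tower_set (scale s x) E = {E} \<or> tower_set (scale s y) E = {E}"
  shows "(real N)\<^sup>2 / 4 \<le> (\<Sum>b<N. \<Sum>b'<N. (coupled_dst x y E s b b' - dst x y)\<^sup>2)"
proof (cases "indep x y E s")
  case True
  then obtain \<sigma> :: real where sg: "\<sigma>\<^sup>2 = 1"
    and c: "\<And>b b'. coupled_dst x y E s b b' = dst x y + \<sigma> * (of_bool (b < threshold 1) - of_bool (b' < threshold 1))"
    using coupled_dst_indep[OF True E s xy] by blast
  have "(\<Sum>b<N. \<Sum>b'<N. (coupled_dst x y E s b b' - dst x y)\<^sup>2) = (real N)\<^sup>2 / 2"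
    using sum_of_bool_diff(2) by (simp add: c power_mult_distrib sg)
  then show ?thesis using zero_le_power2[of "real N"] by linarith
next
  case False
  have big: "12 * threshold (card (tower_set h E)) \<le> N" if "tower_set h E \<noteq> {E}" for h
  proof -
    consider "card (tower_set h E) = 0" | "card (tower_set h E) = 1" | "2 \<le> card (tower_set h E)" by linarith
    then show ?thesis
    proof cases
      case 1
      then show ?thesis by (simp add: threshold_def)
    next
      case 2
      then show ?thesis using tower_set_card_1 that by blast
    next
      case 3
      then show ?thesis by (rule threshold_two)
    qed
  qed
  obtain \<sigma> :: real where sg: "\<sigma>\<^sup>2 = 1" "dst (lower s {E} x) y = dst x y + \<sigma>"
    "dst x (lower s {E} y) = dst x y - \<sigma>"
    by (rule dst_single_flip[OF E s xy ne])
  have half: "2 * threshold 1 = N" using threshold_one by (simp flip: of_nat_mult of_nat_eq_iff)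
  have one: "(coupled_dst x y E s b b' - dst x y)\<^sup>2 = 1" if b: "N \<le> 12 * b" "b < threshold 1" for b b'
    using single
  proof
    assume tx: "tower_set (scale s x) E = {E}"
    then have "tower_set (scale s y) E \<noteq> {E}" using False ne by (auto simp: indep_def)
    then have "\<not> b < threshold (card (tower_set (scale s y) E))" using big[of "scale s y"] b by linarith
    then have "coupled_dst x y E s b b' = dst (lower s {E} x) y" using False b tx by (simp add: coupled_dst_def tower_move_def Let_def)
    then show ?thesis using sg by simp
  next
    assume ty: "tower_set (scale s y) E = {E}"
    then have "tower_set (scale s x) E \<noteq> {E}" using False ne by (auto simp: indep_def)
    then have "\<not> b < threshold (card (tower_set (scale s x) E))" using big[of "scale s x"] b by linarith
    then have "coupled_dst x y E s b b' = dst x (lower s {E} y)" using False b ty by (simp add: coupled_dst_def tower_move_def Let_def)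
    then show ?thesis using sg by simp
  qed
  have "12 dvd N" by (simp add: N_def)
  then obtain n where n: "N = 12 * n" by auto
  have "real N * (real (threshold 1) - real n) = (\<Sum>b\<in>{n..<threshold 1}. \<Sum>b'<N. (1::real))"
    using half n by (simp add: of_nat_diff)
  also have "\<dots> = (\<Sum>b\<in>{n..<threshold 1}. \<Sum>b'<N. (coupled_dst x y E s b b' - dst x y)\<^sup>2)"
    using n by (intro sum.cong refl one[symmetric]) auto
  also have "\<dots> \<le> (\<Sum>b<N. \<Sum>b'<N. (coupled_dst x y E s b b' - dst x y)\<^sup>2)"
    using threshold_le_N[of 1] by (intro sum_mono2) (auto intro!: sum_nonneg)
  finally have "real N * (real (threshold 1) - real n) \<le> \<dots>" .
  moreover have "(real N)\<^sup>2 / 4 \<le> real N * (real (threshold 1) - real n)"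
  proof -
    have "real (threshold 1) = 6 * real n" using half n by simp
    then show ?thesis using n by (simp add: power2_eq_square)
  qed
  ultimately show ?thesis by linarith
qed

text \<open>Among the triangles with the largest excess of \<open>y\<close> over \<open>x\<close>,
  one with \<open>y\<close> maximal works: a neighbour with larger \<open>y\<close> would have at
  least the same excess, since \<open>x\<close> rises by at most 1.\<close>

lemma exists_local_max:
  assumes x: "x \<in> heights" and y: "y \<in> heights" and T0: "x T0 < y T0"
  shows "\<exists>E\<in>S. x E < y E \<and> (\<forall>c. y (nbr c E) = y E - 1)"
proof -
  have inS: "T \<in> S" if "x T \<noteq> y T" for T
    using that heights_zero[OF x, of T] heights_zero[OF y, of T] by metis
  define M where "M = Max ((\<lambda>T. y T - x T) ` S)"
  have T0S: "T0 \<in> S" using T0 inS[of T0] by simp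
  have le: "y T - x T \<le> M" if "T \<in> S" for T using that finite_S by (simp add: M_def)
  have Mpos: "0 < M" using le[OF T0S] T0 by simp
  define B where "B = {T \<in> S. y T - x T = M}"
  have "M \<in> (\<lambda>T. y T - x T) ` S" unfolding M_def using finite_S T0S by (intro Max_in) auto
  then have Bne: "B \<noteq> {}" by (auto simp: B_def)
  have Bfin: "finite B" using finite_S by (simp add: B_def)
  have "Max (y ` B) \<in> y ` B" using Bfin Bne by (intro Max_in) auto
  then obtain E where E: "E \<in> B" "y E = Max (y ` B)" by (metis imageE)
  have ES: "E \<in> S" and EM: "y E - x E = M" using E by (auto simp: B_def)
  have "y (nbr c E) = y E - 1" for c
  proof (rule ccontr)
    assume "y (nbr c E) \<noteq> y E - 1"
    then have up: "y (nbr c E) = y E + 1" using heights_step[OF y ES] by blast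
    have dif: "y (nbr c E) - x (nbr c E) \<ge> M" using up heights_step[OF x ES, of c] EM by auto
    then have nS: "nbr c E \<in> S" using inS[of "nbr c E"] Mpos by auto
    then have "nbr c E \<in> B" using dif le[OF nS] by (simp add: B_def)
    then have "y (nbr c E) \<le> y E" using E(2) Bfin by simp
    then show False using up by simp
  qed
  then show ?thesis using ES EM Mpos by (intro bexI[of _ E]) auto
qed

lemma coupled_dst_fluctuates:
  assumes xy: "x \<in> heights" "y \<in> heights" and ne: "x \<noteq> y"
  shows "(real N)\<^sup>2 / 4 \<le> (\<Sum>s\<in>{1,-1}. \<Sum>E\<in>S. \<Sum>b<N. \<Sum>b'<N. (coupled_dst x y E s b b' - dst x y)\<^sup>2)"
proof -
  obtain T where "x T \<noteq> y T" using ne by blast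
  then have "\<exists>E\<in>S. x E \<noteq> y E \<and> ((\<forall>c. x (nbr c E) = x E - 1) \<or> (\<forall>c. y (nbr c E) = y E - 1))"
  proof (cases "x T < y T")
    case True
    then show ?thesis using exists_local_max[OF xy True] by (metis less_irrefl)
  next
    case False
    then have "y T < x T" using \<open>x T \<noteq> y T\<close> by simp
    then show ?thesis using exists_local_max[OF xy(2,1)] by (metis less_irrefl)
  qed
  then obtain E where E: "E \<in> S" "x E \<noteq> y E" "tower_set x E = {E} \<or> tower_set y E = {E}"
    using tower_set_local_max by metis
  have "(real N)\<^sup>2 / 4 \<le> (\<Sum>b<N. \<Sum>b'<N. (coupled_dst x y E 1 b b' - dst x y)\<^sup>2)"
    using E by (intro coupled_dst_second_moment xy) auto
  also have "\<dots> \<le> (\<Sum>E\<in>S. \<Sum>b<N. \<Sum>b'<N. (coupled_dst x y E 1 b b' - dst x y)\<^sup>2)"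
    using finite_S E(1) by (intro member_le_sum[of E S]) (auto intro!: sum_nonneg)
  also have "\<dots> \<le> (\<Sum>s\<in>{1,-1}. \<Sum>E\<in>S. \<Sum>b<N. \<Sum>b'<N. (coupled_dst x y E s b b' - dst x y)\<^sup>2)"
    by (simp add: sum_nonneg)
  finally show ?thesis .
qed

definition tower_avg :: "((tri \<Rightarrow> int) \<Rightarrow> real) \<Rightarrow> (tri \<Rightarrow> int) \<Rightarrow> real" where
  "tower_avg g h = (\<Sum>s\<in>{1,-1}. \<Sum>E\<in>S. \<Sum>b<N. g (tower_move E s b h)) / (2 * card S * N)"

text \<open>The second threshold \<open>b'\<close> is as uniform as \<open>b\<close>, so the
  coupling has the right marginals; summing over both accounts for the additional factor
  \<open>N\<close>.\<close>

lemma tower_avg_diff: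
  "N * (2 * card S * N) * (tower_avg g x - tower_avg g y) = (\<Sum>s\<in>{1,-1}. \<Sum>E\<in>S. \<Sum>b<N. \<Sum>b'<N.
     g (tower_move E s b x) - g (tower_move E s (if indep x y E s then b' else b) y))"
proof (cases "S = {}")
  case True
  then show ?thesis by simp
next
  case False
  then have c: "real (card S) > 0" using finite_S by (simp add: card_gt_0_iff)
  define X where "X = (\<Sum>s\<in>{1,-1}. \<Sum>E\<in>S. \<Sum>b<N. g (tower_move E s b x))"
  define Y where "Y = (\<Sum>s\<in>{1,-1}. \<Sum>E\<in>S. \<Sum>b<N. g (tower_move E s b y))"
  have "(\<Sum>b<N. \<Sum>b'<N. g (tower_move E s b x) - g (tower_move E s (if indep x y E s then b' else b) y))
      = N * (\<Sum>b<N. g (tower_move E s b x)) - N * (\<Sum>b<N. g (tower_move E s b y))" for E s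
    by (cases "indep x y E s") (simp_all add: sum_subtractf sum_distrib_left right_diff_distrib)
  then have eq: "(\<Sum>s\<in>{1,-1}. \<Sum>E\<in>S. \<Sum>b<N. \<Sum>b'<N.
     g (tower_move E s b x) - g (tower_move E s (if indep x y E s then b' else b) y)) = N * X - N * Y"
    unfolding X_def Y_def by (simp only: sum_subtractf sum_distrib_left)
  have "X = 2 * card S * N * tower_avg g x" "Y = 2 * card S * N * tower_avg g y"
    using c N_pos by (simp_all add: tower_avg_def X_def Y_def)
  then have "N * (2 * card S * N) * (tower_avg g x - tower_avg g y) = N * X - N * Y"
    by (simp only: of_nat_mult of_nat_numeral right_diff_distrib mult.assoc)
  then show ?thesis using eq by simp
qed

text \<open>The function \<psi>(z) = z (2 D - z) equals its second-order expansion at d. The linear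
  term has nonpositive mean, because its slope is nonnegative for d \<le> D. The quadratic term
  takes away at least 1 / (8 card S), which is at least \<psi>(d) / (8 card S D^2) since \<psi>
  \<le> D^2. Stated for differences of function values, the contraction passes through the iterates
  of \<open>tower_avg\<close>.\<close>

lemma tower_avg_decay:
  fixes D :: real
  assumes D: "\<And>x y. x \<in> heights \<Longrightarrow> y \<in> heights \<Longrightarrow> dst x y \<le> D" and Dpos: "0 < D" and S: "S \<noteq> {}"
    and K: "\<And>x y. x \<in> heights \<Longrightarrow> y \<in> heights \<Longrightarrow> \<bar>g x - g y\<bar> \<le> K * (dst x y * (2 * D - dst x y))" "0 \<le> K"
    and rho: "\<rho> = 1 - 1 / (8 * card S * D\<^sup>2)" "0 \<le> \<rho>"
    and xy: "x \<in> heights" "y \<in> heights"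
  shows "\<bar>(tower_avg ^^ t) g x - (tower_avg ^^ t) g y\<bar> \<le> K * \<rho> ^ t * (dst x y * (2 * D - dst x y))"
  using xy
proof (induction t arbitrary: x y)
  case 0
  then show ?case using K(1) by simp
next
  case (Suc t)
  define G where "G = (tower_avg ^^ t) g"
  define d where "d = dst x y"
  define \<psi> where "\<psi> z = z * (2 * D - z)" for z :: real
  define \<Sigma> :: "(int \<Rightarrow> tri \<Rightarrow> nat \<Rightarrow> nat \<Rightarrow> real) \<Rightarrow> real" where
    "\<Sigma> F = (\<Sum>s\<in>{1,-1}. \<Sum>E\<in>S. \<Sum>b<N. \<Sum>b'<N. F s E b b')" for F
  define W where "W = N * (2 * card S * N)"
  have c: "real (card S) > 0" using S finite_S by (simp add: card_gt_0_iff)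
  then have Wpos: "0 < real W" using N_pos by (simp add: W_def)
  have IH: "\<bar>G u - G v\<bar> \<le> K * \<rho> ^ t * \<psi> (dst u v)" if "u \<in> heights" "v \<in> heights" for u v
    using Suc.IH[OF that] by (simp add: G_def \<psi>_def)
  have "real W * \<bar>tower_avg G x - tower_avg G y\<bar> = \<bar>real W * (tower_avg G x - tower_avg G y)\<bar>"
    using Wpos by (simp add: abs_mult)
  also have "\<dots> = \<bar>\<Sigma> (\<lambda>s E b b'. G (tower_move E s b x) - G (tower_move E s (if indep x y E s then b' else b) y))\<bar>"
    using tower_avg_diff[of G x y] by (simp add: W_def \<Sigma>_def)
  also have "\<dots> \<le> \<Sigma> (\<lambda>s E b b'. \<bar>G (tower_move E s b x) - G (tower_move E s (if indep x y E s then b' else b) y)\<bar>)"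
    unfolding \<Sigma>_def by (intro order_trans[OF sum_abs] sum_mono order_refl)
  also have "\<dots> \<le> \<Sigma> (\<lambda>s E b b'. K * \<rho> ^ t * \<psi> (coupled_dst x y E s b b'))"
    unfolding \<Sigma>_def coupled_dst_def using Suc.prems by (intro sum_mono IH tower_move_heights) auto
  also have "\<dots> = K * \<rho> ^ t * \<Sigma> (\<lambda>s E b b'. \<psi> (coupled_dst x y E s b b'))"
    unfolding \<Sigma>_def by (simp only: sum_distrib_left)
  also have "\<dots> \<le> K * \<rho> ^ t * (real W * (\<rho> * \<psi> d))"
  proof (rule mult_left_mono)
    have lin: "\<psi> z = \<psi> d + (2 * D - 2 * d) * (z - d) - (z - d)\<^sup>2" for z
      by (simp add: \<psi>_def power2_eq_square algebra_simps)
    have Wsum: "\<Sigma> (\<lambda>s E b b'. \<psi> d) = real W * \<psi> d" by (simp add: \<Sigma>_def W_def)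
    define \<delta> where "\<delta> s E b b' = coupled_dst x y E s b b' - d" for s E b b'
    define \<alpha> where "\<alpha> = 2 * D - 2 * d"
    have "\<Sigma> (\<lambda>s E b b'. \<psi> (coupled_dst x y E s b b')) = \<Sigma> (\<lambda>s E b b'. \<psi> d + \<alpha> * \<delta> s E b b' - (\<delta> s E b b')\<^sup>2)"
      unfolding \<Sigma>_def \<delta>_def \<alpha>_def by (intro sum.cong refl lin)
    also have "\<dots> = \<Sigma> (\<lambda>s E b b'. \<psi> d) + \<alpha> * \<Sigma> \<delta> - \<Sigma> (\<lambda>s E b b'. (\<delta> s E b b')\<^sup>2)"
      unfolding \<Sigma>_def by (simp only: sum.distrib sum_subtractf sum_distrib_left)
    finally have eq: "\<Sigma> (\<lambda>s E b b'. \<psi> (coupled_dst x y E s b b')) = real W * \<psi> d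
        + (2 * D - 2 * d) * \<Sigma> (\<lambda>s E b b'. coupled_dst x y E s b b' - d) - \<Sigma> (\<lambda>s E b b'. (coupled_dst x y E s b b' - d)\<^sup>2)"
      unfolding \<delta>_def \<alpha>_def Wsum .
    have mean: "(2 * D - 2 * d) * \<Sigma> (\<lambda>s E b b'. coupled_dst x y E s b b' - d) \<le> 0"
      using coupled_dst_mean[OF Suc.prems] D[OF Suc.prems] unfolding \<Sigma>_def d_def by (intro mult_nonneg_nonpos) auto
    show "\<Sigma> (\<lambda>s E b b'. \<psi> (coupled_dst x y E s b b')) \<le> real W * (\<rho> * \<psi> d)"
    proof (cases "x = y")
      case True
      then have d0: "d = 0" by (simp add: d_def)
      have "0 \<le> \<Sigma> (\<lambda>s E b b'. (coupled_dst x y E s b b' - d)\<^sup>2)" unfolding \<Sigma>_def by (intro sum_nonneg) auto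
      then show ?thesis using eq mean d0 by (simp add: \<psi>_def)
    next
      case False
      have flip_at: "(real N)\<^sup>2 / 4 \<le> \<Sigma> (\<lambda>s E b b'. (coupled_dst x y E s b b' - d)\<^sup>2)"
        using coupled_dst_fluctuates[OF Suc.prems False] by (simp add: \<Sigma>_def d_def)
      have "\<psi> d \<le> D\<^sup>2"
        using zero_le_power2[of "D - d"] by (simp add: \<psi>_def power2_eq_square algebra_simps)
      then have "real W * (1 / (8 * card S * D\<^sup>2) * \<psi> d) \<le> real W * (1 / (8 * card S * D\<^sup>2) * D\<^sup>2)"
        using Wpos by (intro mult_left_mono) auto
      also have "\<dots> = (real N)\<^sup>2 / 4"
        using Dpos c by (simp add: W_def power2_eq_square)
      finally have "real W * (1 / (8 * card S * D\<^sup>2) * \<psi> d) \<le> (real N)\<^sup>2 / 4" .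
      moreover have "real W * (\<rho> * \<psi> d) = real W * \<psi> d - real W * (1 / (8 * card S * D\<^sup>2) * \<psi> d)"
        unfolding rho(1) by (simp only: left_diff_distrib right_diff_distrib mult_1)
      ultimately show ?thesis using eq mean flip_at by linarith
    qed
    show "0 \<le> K * \<rho> ^ t" using K(2) rho(2) by simp
  qed
  also have "\<dots> = real W * (K * \<rho> ^ Suc t * \<psi> d)" by simp
  finally have "\<bar>tower_avg G x - tower_avg G y\<bar> \<le> K * \<rho> ^ Suc t * \<psi> d"
    using Wpos by (simp only: mult_le_cancel_left_pos)
  then show ?case by (simp add: G_def \<psi>_def d_def)
qed

end

section \<open>The spectral gap of the tower chain\<close>

fun shift :: "int \<Rightarrow> int \<Rightarrow> tri \<Rightarrow> tri" where
  "shift p q (Tri i j u) = Tri (i + p) (j + q) u"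

section \<open>Bounds on heights and distances\<close>

context region
begin

lemma heights_shift:
  assumes h: "h \<in> heights"
  shows "\<bar>h T\<bar> - 2 * (int p + int q) \<le> \<bar>h (shift (int p) (int q) T)\<bar>"
proof -
  obtain i j u where T: "T = Tri i j u" by (cases T)
  note lip = heights_lipschitz[OF h]
  have right: "\<bar>h (Tri i j u)\<bar> - 2 \<le> \<bar>h (Tri (i + 1) j u)\<bar>" for i j u
  proof (cases u)
    case True
    then show ?thesis using lip[of Red "Tri i j True"] lip[of Green "Tri i j False"] by simp
  next
    case False
    then show ?thesis using lip[of Green "Tri i j False"] lip[of Red "Tri (i + 1) j True"] by simp
  qed
  have up: "\<bar>h (Tri i j u)\<bar> - 2 \<le> \<bar>h (Tri i (j + 1) u)\<bar>" for i j u
  proof (cases u)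
    case True
    then show ?thesis using lip[of Red "Tri i j True"] lip[of Blue "Tri i j False"] by simp
  next
    case False
    then show ?thesis using lip[of Blue "Tri i j False"] lip[of Red "Tri i (j + 1) True"] by simp
  qed
  have 1: "\<bar>h (Tri i j u)\<bar> - 2 * int p \<le> \<bar>h (Tri (i + int p) j u)\<bar>" for p
  proof (induction p)
    case (Suc p)
    then show ?case using right[of "i + int p" j u] by (simp add: algebra_simps)
  qed simp
  have 2: "\<bar>h (Tri i' j u)\<bar> - 2 * int q \<le> \<bar>h (Tri i' (j + int q) u)\<bar>" for i' q
  proof (induction q)
    case (Suc q)
    then show ?case using up[of i' "j + int q" u] by (simp add: algebra_simps)
  qed simp
  show ?thesis using 1[of p] 2[of "i + int p" q] T by simp
qed

text \<open>A unit step right or up changes a height by at most 2. From a triangle of absolute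
  height m the heights therefore stay nonzero on a parallelogram of side \<open>r\<close>, which is
  m / 4 rounded up, and its triangles of the same orientation all lie in \<open>S\<close>.\<close>

lemma height_bound:
  assumes h: "h \<in> heights"
  shows "(h T)\<^sup>2 \<le> 16 * int (card S)"
proof -
  define m where "m = nat \<bar>h T\<bar>"
  define r where "r = (m + 3) div 4"
  have im: "int m = \<bar>h T\<bar>" by (simp add: m_def)
  have mem: "shift (int p) (int q) T \<in> S" if "p < r" "q < r" for p q
  proof -
    have "4 * p < m" "4 * q < m" using that unfolding r_def by presburger+
    then have "2 * (p + q) < m" by presburger
    then have "h (shift (int p) (int q) T) \<noteq> 0"
      using heights_shift[OF h, of T p q] im by auto
    then show ?thesis using heights_zero[OF h] by blast
  qed
  have inj: "inj_on (\<lambda>(p, q). shift (int p) (int q) T) ({..<r} \<times> {..<r})"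
    by (cases T) (auto intro!: inj_onI)
  have "r * r = card ((\<lambda>(p, q). shift (int p) (int q) T) ` ({..<r} \<times> {..<r}))"
    by (simp add: card_image[OF inj] card_cartesian_product)
  also have "\<dots> \<le> card S"
    using mem finite_S by (intro card_mono) auto
  finally have rS: "r * r \<le> card S" .
  have "m \<le> 4 * r" unfolding r_def by linarith
  then have "m * m \<le> (4 * r) * (4 * r)" by (rule mult_le_mono) (use \<open>m \<le> 4 * r\<close> in simp)
  also have "\<dots> \<le> 16 * card S" using rS by simp
  finally have "int m * int m \<le> 16 * int (card S)" by (metis of_nat_le_iff of_nat_mult of_nat_numeral)
  then show ?thesis by (simp add: im power2_eq_square)
qed

lemma height_bound_sqrt: "h \<in> heights \<Longrightarrow> \<bar>real_of_int (h T)\<bar> \<le> 4 * sqrt (card S)"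
proof -
  assume "h \<in> heights"
  then have "real_of_int ((h T)\<^sup>2) \<le> real_of_int (16 * int (card S))" using height_bound by (simp only: of_int_le_iff)
  then have "(real_of_int (h T))\<^sup>2 \<le> 16 * real (card S)" by simp
  then have "\<bar>real_of_int (h T)\<bar> \<le> sqrt (16 * real (card S))" using real_le_rsqrt by force
  then show ?thesis by (simp add: real_sqrt_mult)
qed

lemma finite_heights: "finite heights"
proof (rule finite_subset)
  show "heights \<subseteq> {h. \<forall>T. (T \<in> S \<longrightarrow> h T \<in> {- 16 * int (card S) .. 16 * int (card S)}) \<and> (T \<notin> S \<longrightarrow> h T = 0)}"
  proof (intro subsetI CollectI allI conjI impI)
    fix h T assume h: "h \<in> heights" and "T \<in> S"
    have "\<bar>h T\<bar> \<le> (h T)\<^sup>2"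
      by (metis abs_ge_zero abs_le_square_iff abs_of_nonneg linorder_not_le mult_le_cancel_right1 power2_abs power2_eq_square zero_le_power2 zless_imp_add1_zle add_0)
    then show "h T \<in> {- 16 * int (card S) .. 16 * int (card S)}" using height_bound[OF h, of T] by auto
  qed (rule heights_zero)
  show "finite {h. \<forall>T. (T \<in> S \<longrightarrow> h T \<in> {- 16 * int (card S) .. 16 * int (card S)}) \<and> (T \<notin> S \<longrightarrow> h T = 0)}"
    by (rule finite_set_of_finite_funs[OF finite_S]) simp
qed

lemma dst_bound:
  assumes x: "x \<in> heights" and y: "y \<in> heights"
  shows "dst x y \<le> 4 * (card S * sqrt (card S))"
proof -
  have "(\<Sum>U\<in>S. \<bar>real_of_int (x U - y U)\<bar>) \<le> (\<Sum>U\<in>S. 8 * sqrt (card S))"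
  proof (rule sum_mono)
    fix U
    show "\<bar>real_of_int (x U - y U)\<bar> \<le> 8 * sqrt (card S)"
      using height_bound_sqrt[OF x, of U] height_bound_sqrt[OF y, of U] unfolding of_int_diff by linarith
  qed
  then show ?thesis by (simp add: dst_def)
qed

section \<open>Reversibility and Dirichlet form of the tower chain\<close>

definition tops :: "(tri \<Rightarrow> int) \<Rightarrow> tri \<Rightarrow> tri" where
  "tops h E = (THE U. U \<in> tower_set h E \<and> (\<forall>c. h (nbr c U) = h U - 1))"

lemma tops_eq:
  assumes t: "tower h a b k E"
  shows "tops h E = strip a b E k"
  unfolding tops_def
proof (rule the_equality)
  show "strip a b E k \<in> tower_set h E \<and> (\<forall>c. h (nbr c (strip a b E k)) = h (strip a b E k) - 1)"
    using towerD(2)[OF t, of k] tower_set_eq[OF t] by simp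
  fix U assume U: "U \<in> tower_set h E \<and> (\<forall>c. h (nbr c U) = h U - 1)"
  then obtain m where m: "m \<le> k" "U = strip a b E m" using tower_set_eq[OF t] by auto
  have "\<not> m < k" using towerD(2)[OF t m(1), of "alt a b m"] U m by (auto split: if_splits)
  then show "U = strip a b E k" using m by simp
qed

text \<open>A tower move is undone by the move of opposite sign whose last element is the former
  top. The tower is the same, hence so is the acceptance probability: this is detailed balance for
  the uniform distribution.\<close>

lemma tower_reversal:
  assumes h: "h \<in> heights" and s: "s \<in> {1, -1}" and ne: "tower_set (scale s h) E \<noteq> {}"
  defines "A \<equiv> tower_set (scale s h) E" and "E' \<equiv> tops (scale s h) E"
  defines "h' \<equiv> lower s A h"
  shows "h' \<in> heights" "E' \<in> S" "tower_set (scale (- s) h') E' = A" "tops (scale (- s) h') E' = E"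
    "lower (- s) A h' = h"
proof -
  have g: "scale s h \<in> heights" using scale_heights[OF h s] .
  obtain a b k where t: "tower (scale s h) a b k E" using ne by (metis tower_set_nonempty)
  have A: "A = strip a b E ` {..k}" unfolding A_def by (rule tower_set_eq[OF t])
  have E': "E' = strip a b E k" unfolding E'_def by (rule tops_eq[OF t])
  show "E' \<in> S" using towerD(1)[OF t, of k] E' by simp
  show "h' \<in> heights" unfolding h'_def A_def by (rule lower_tower_set_heights[OF h s])
  have "scale (- s) h' = scale (-1) (lower 1 A (scale s h))"
    using s by (auto simp: scale_def h'_def lower_def)
  then have t': "tower (scale (- s) h') (alt a b (k + 1)) (alt a b k) k E'"
    using lower_tower_heights(2)[OF g t] E' by (simp add: A_def)
  have "tower_set (scale (- s) h') E' = strip (alt a b (k + 1)) (alt a b k) E' ` {..k}"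
    by (rule tower_set_eq[OF t'])
  also have "\<dots> = (\<lambda>m. strip a b E (k - m)) ` {..k}"
    by (intro image_cong refl) (use strip_reverse[of _ k a b E] E' in auto)
  also have "\<dots> = A" unfolding A
  proof (intro equalityI subsetI)
    fix U assume "U \<in> strip a b E ` {..k}"
    then obtain m where "m \<le> k" "U = strip a b E m" by auto
    then show "U \<in> (\<lambda>m. strip a b E (k - m)) ` {..k}"
      by (intro image_eqI[of _ _ "k - m"]) auto
  qed auto
  finally show "tower_set (scale (- s) h') E' = A" .
  show "tops (scale (- s) h') E' = E"
    using tops_eq[OF t'] strip_reverse[of k k a b E] E' by simp
  show "lower (- s) A h' = h" by (auto simp: lower_def h'_def)
qed

definition moves :: "((tri \<Rightarrow> int) \<times> int \<times> tri) set" where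
  "moves = {(h, s, E). h \<in> heights \<and> s \<in> {1, -1} \<and> E \<in> S \<and> tower_set (scale s h) E \<noteq> {}}"

lemma sum_moves:
  fixes \<phi> :: "(tri \<Rightarrow> int) \<Rightarrow> int \<Rightarrow> tri \<Rightarrow> real"
  assumes "\<And>h s E. tower_set (scale s h) E = {} \<Longrightarrow> \<phi> h s E = 0"
  shows "(\<Sum>h\<in>heights. \<Sum>s\<in>{1,-1}. \<Sum>E\<in>S. \<phi> h s E) = (\<Sum>(h, s, E)\<in>moves. \<phi> h s E)"
proof -
  have "(\<Sum>h\<in>heights. \<Sum>s\<in>{1,-1}. \<Sum>E\<in>S. \<phi> h s E) = (\<Sum>(h, s, E)\<in>heights \<times> {1, -1} \<times> S. \<phi> h s E)"
    by (simp only: sum.cartesian_product split_def fst_conv snd_conv)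
  also have "\<dots> = (\<Sum>(h, s, E)\<in>moves. \<phi> h s E)"
    using assms by (intro sum.mono_neutral_right) (auto simp: moves_def finite_heights finite_S)
  finally show ?thesis .
qed

lemma moves_reversal:
  fixes \<phi> :: "nat \<Rightarrow> (tri \<Rightarrow> int) \<Rightarrow> (tri \<Rightarrow> int) \<Rightarrow> real"
  shows "(\<Sum>(h, s, E)\<in>moves. \<phi> (card (tower_set (scale s h) E)) h (lower s (tower_set (scale s h) E) h)) =
     (\<Sum>(h, s, E)\<in>moves. \<phi> (card (tower_set (scale s h) E)) (lower s (tower_set (scale s h) E) h) h)"
proof -
  define \<beta> where "\<beta> = (\<lambda>(h, s, E). (lower s (tower_set (scale s h) E) h, - s, tops (scale s h) E))"
  have inv: "\<beta> z \<in> moves \<and> \<beta> (\<beta> z) = z" if "z \<in> moves" for z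
  proof -
    obtain h s E where z: "z = (h, s, E)" by (cases z)
    then have m: "h \<in> heights" "s \<in> {1, -1}" "E \<in> S" "tower_set (scale s h) E \<noteq> {}"
      using that by (auto simp: moves_def)
    note r = tower_reversal[OF m(1,2,4)]
    show ?thesis using r m unfolding z \<beta>_def moves_def by auto
  qed
  have eq: "(case \<beta> z of (h, s, E) \<Rightarrow> \<phi> (card (tower_set (scale s h) E)) (lower s (tower_set (scale s h) E) h) h) =
    (case z of (h, s, E) \<Rightarrow> \<phi> (card (tower_set (scale s h) E)) h (lower s (tower_set (scale s h) E) h))" if "z \<in> moves" for z
  proof -
    obtain h s E where z: "z = (h, s, E)" by (cases z)
    then have m: "h \<in> heights" "s \<in> {1, -1}" "E \<in> S" "tower_set (scale s h) E \<noteq> {}"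
      using that by (auto simp: moves_def)
    note r = tower_reversal[OF m(1,2,4)]
    show ?thesis unfolding z \<beta>_def using r by simp
  qed
  show ?thesis
    by (rule sum.reindex_bij_witness[of _ \<beta> \<beta>]) (use inv eq in auto)
qed

lemma sum_tower_move: "(\<Sum>b<N. g (tower_move E s b h)) =
    real (threshold (card (tower_set (scale s h) E))) * (g (lower s (tower_set (scale s h) E) h) - g h) + real N * g h"
proof -
  let ?A = "tower_set (scale s h) E"
  have "g (tower_move E s b h) = of_bool (b < threshold (card ?A)) * (g (lower s ?A h) - g h) + g h" for b
    by (simp add: tower_move_def Let_def)
  then show ?thesis
    by (simp add: sum.distrib sum_distrib_right[symmetric] sum_below[OF threshold_le_N, symmetric])
qed

lemma tower_avg_eq:
  assumes S: "S \<noteq> {}"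
  shows "tower_avg g h = g h + (\<Sum>s\<in>{1,-1}. \<Sum>E\<in>S. real (threshold (card (tower_set (scale s h) E))) *
     (g (lower s (tower_set (scale s h) E) h) - g h)) / (2 * card S * N)"
proof -
  have c: "real (card S) > 0" "real N > 0" using S finite_S N_pos by (auto simp: card_gt_0_iff)
  have "tower_avg g h = ((\<Sum>s\<in>{1,-1}. \<Sum>E\<in>S. real (threshold (card (tower_set (scale s h) E))) *
     (g (lower s (tower_set (scale s h) E) h) - g h)) + 2 * card S * N * g h) / (2 * card S * N)"
    unfolding tower_avg_def sum_tower_move sum.distrib by simp
  then show ?thesis using c by (simp add: add_divide_distrib)
qed

lemma tower_avg_sym:
  assumes S: "S \<noteq> {}"
  shows "(\<Sum>h\<in>heights. f h * tower_avg g h) = (\<Sum>h\<in>heights. tower_avg f h * g h)"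
proof -
  let ?A = "\<lambda>h s E. tower_set (scale s h) E"
  let ?t = "\<lambda>h s E. real (threshold (card (?A h s E)))"
  have e: "(\<Sum>h\<in>heights. f h * tower_avg g h) = (\<Sum>h\<in>heights. f h * g h) +
     ((\<Sum>(h, s, E)\<in>moves. ?t h s E * (f h * g (lower s (?A h s E) h)))
      - (\<Sum>(h, s, E)\<in>moves. ?t h s E * (f h * g h))) / (2 * card S * N)" for f g
  proof -
    have "(\<Sum>h\<in>heights. f h * tower_avg g h) = (\<Sum>h\<in>heights. f h * g h + (\<Sum>s\<in>{1,-1}. \<Sum>E\<in>S.
        ?t h s E * (f h * g (lower s (?A h s E) h)) - ?t h s E * (f h * g h)) / (2 * card S * N))"
      unfolding tower_avg_eq[OF S] distrib_left times_divide_eq_right sum_distrib_left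
      by (simp only: right_diff_distrib mult.left_commute)
    also have "\<dots> = (\<Sum>h\<in>heights. f h * g h) + (\<Sum>h\<in>heights. \<Sum>s\<in>{1,-1}. \<Sum>E\<in>S.
        ?t h s E * (f h * g (lower s (?A h s E) h)) - ?t h s E * (f h * g h)) / (2 * card S * N)"
      by (simp only: sum.distrib sum_divide_distrib)
    also have "(\<Sum>h\<in>heights. \<Sum>s\<in>{1,-1}. \<Sum>E\<in>S.
        ?t h s E * (f h * g (lower s (?A h s E) h)) - ?t h s E * (f h * g h)) =
        (\<Sum>(h, s, E)\<in>moves. ?t h s E * (f h * g (lower s (?A h s E) h)) - ?t h s E * (f h * g h))"
      by (rule sum_moves) (simp add: threshold_def)
    finally show ?thesis by (simp add: split_def sum_subtractf)
  qed
  have "(\<Sum>(h, s, E)\<in>moves. ?t h s E * (f h * g (lower s (?A h s E) h))) =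
     (\<Sum>(h, s, E)\<in>moves. ?t h s E * (g h * f (lower s (?A h s E) h)))"
    using moves_reversal[of "\<lambda>k u v. real (threshold k) * (f u * g v)"] by (simp add: mult.commute)
  then show ?thesis using e[of f g] e[of g f] by (simp add: mult.commute)
qed

lemma tower_avg_const: "S \<noteq> {} \<Longrightarrow> tower_avg (\<lambda>_. c) h = c"
  by (simp add: tower_avg_eq)

lemma tower_avg_sum:
  assumes S: "S \<noteq> {}"
  shows "(\<Sum>h\<in>heights. tower_avg g h) = (\<Sum>h\<in>heights. g h)"
  using tower_avg_sym[OF S, of "\<lambda>_. 1" g] by (simp add: tower_avg_const[OF S])

lemma tower_avg_dirichlet:
  assumes S: "S \<noteq> {}"
  shows "4 * card S * N * ((\<Sum>h\<in>heights. (g h)\<^sup>2) - (\<Sum>h\<in>heights. g h * tower_avg g h)) =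
     (\<Sum>h\<in>heights. \<Sum>s\<in>{1,-1}. \<Sum>E\<in>S. real (threshold (card (tower_set (scale s h) E))) *
        (g h - g (lower s (tower_set (scale s h) E) h))\<^sup>2)"
proof -
  let ?A = "\<lambda>h s E. tower_set (scale s h) E"
  let ?t = "\<lambda>h s E. real (threshold (card (?A h s E)))"
  have c: "real (card S) > 0" "real N > 0" using S finite_S N_pos by (auto simp: card_gt_0_iff)
  have tp: "2 * card S * N * (tower_avg g h - g h) = (\<Sum>s\<in>{1,-1}. \<Sum>E\<in>S. ?t h s E * (g (lower s (?A h s E) h) - g h))" for g h
    using c by (simp add: tower_avg_eq[OF S])
  have pt: "(\<Sum>s\<in>{1,-1}. \<Sum>E\<in>S. ?t h s E * (g h - g (lower s (?A h s E) h))\<^sup>2) =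
     2 * card S * N * (tower_avg (\<lambda>h. (g h)\<^sup>2) h - (g h)\<^sup>2) - 2 * g h * (2 * card S * N * (tower_avg g h - g h))" for h
  proof -
    have "(\<Sum>s\<in>{1,-1}. \<Sum>E\<in>S. ?t h s E * (g h - g (lower s (?A h s E) h))\<^sup>2) =
      (\<Sum>s\<in>{1,-1}. \<Sum>E\<in>S. ?t h s E * ((g (lower s (?A h s E) h))\<^sup>2 - (g h)\<^sup>2)
        - 2 * g h * (?t h s E * (g (lower s (?A h s E) h) - g h)))"
      by (intro sum.cong refl) (simp add: power2_eq_square algebra_simps)
    also have "\<dots> = (\<Sum>s\<in>{1,-1}. \<Sum>E\<in>S. ?t h s E * ((g (lower s (?A h s E) h))\<^sup>2 - (g h)\<^sup>2))
      - 2 * g h * (\<Sum>s\<in>{1,-1}. \<Sum>E\<in>S. ?t h s E * (g (lower s (?A h s E) h) - g h))"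
      unfolding sum_distrib_left by (simp only: sum_subtractf)
    finally show ?thesis using tp[of "\<lambda>h. (g h)\<^sup>2" h] tp[of g h] by simp
  qed
  have "(\<Sum>h\<in>heights. \<Sum>s\<in>{1,-1}. \<Sum>E\<in>S. ?t h s E * (g h - g (lower s (?A h s E) h))\<^sup>2) =
     (\<Sum>h\<in>heights. 2 * card S * N * (tower_avg (\<lambda>h. (g h)\<^sup>2) h - (g h)\<^sup>2) - 4 * card S * N * (g h * tower_avg g h - (g h)\<^sup>2))"
    unfolding pt by (intro sum.cong refl) (simp add: power2_eq_square algebra_simps)
  also have "\<dots> = 2 * card S * N * ((\<Sum>h\<in>heights. tower_avg (\<lambda>h. (g h)\<^sup>2) h) - (\<Sum>h\<in>heights. (g h)\<^sup>2))
     - 4 * card S * N * ((\<Sum>h\<in>heights. g h * tower_avg g h) - (\<Sum>h\<in>heights. (g h)\<^sup>2))"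
    by (simp only: sum_subtractf sum_distrib_left[symmetric])
  also have "\<dots> = 4 * card S * N * ((\<Sum>h\<in>heights. (g h)\<^sup>2) - (\<Sum>h\<in>heights. g h * tower_avg g h))"
    unfolding tower_avg_sum[OF S] by (simp add: algebra_simps)
  finally show ?thesis by simp
qed

lemma tower_avg_gap:
  assumes S: "S \<noteq> {}" and mean: "(\<Sum>h\<in>heights. g h) = 0"
  shows "(\<Sum>h\<in>heights. (g h)\<^sup>2) / (128 * real (card S) ^ 4) \<le>
     (\<Sum>h\<in>heights. (g h)\<^sup>2) - (\<Sum>h\<in>heights. g h * tower_avg g h)"
proof -
  define f where "f = real (card S)"
  have "card S > 0" using S finite_S by (simp add: card_gt_0_iff)
  then have f1: "f \<ge> 1" by (simp add: f_def)
  \<comment> \<open>The diameter bound for \<open>dst\<close>. It fixes the rate: D^2 = 16 f^3, so 8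
    f D^2 = 128 f^4.\<close>
  define D where "D = 4 * (f * sqrt f)"
  have D1: "D \<ge> 1"
  proof -
    have "1 \<le> f * sqrt f" using f1 by (smt (verit) mult_le_cancel_left1 real_sqrt_ge_one)
    then show ?thesis by (simp add: D_def)
  qed
  have D2: "D\<^sup>2 = 16 * f ^ 3"
    using f1 by (simp add: D_def power_mult_distrib power2_eq_square power3_eq_cube)
  have dD: "dst x y \<le> D" if "x \<in> heights" "y \<in> heights" for x y
    using dst_bound[OF that] by (simp add: D_def f_def)
  define \<rho> where "\<rho> = 1 - 1 / (8 * card S * D\<^sup>2)"
  have r: "8 * card S * D\<^sup>2 = 128 * f ^ 4"
    unfolding D2 by (simp add: f_def power3_eq_cube power4_eq_xxxx)
  have "1 \<le> 128 * f ^ 4" using one_le_power[OF f1, of 4] by linarith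
  then have rho: "0 \<le> \<rho>" unfolding \<rho>_def r by (simp add: divide_le_eq_1)
  \<comment> \<open>Only the rate enters the Rayleigh bound, so any finite \<open>K\<close> serves.
    The concave function is at least 1 at distinct states, hence twice the total of |g| is large
    enough.\<close>
  define K where "K = 2 * (\<Sum>h\<in>heights. \<bar>g h\<bar>)"
  have K0: "0 \<le> K" by (simp add: K_def sum_nonneg)
  have psi: "dst x y * (2 * D - dst x y) \<le> D\<^sup>2" for x y
    using zero_le_power2[of "D - dst x y"] by (simp add: power2_eq_square algebra_simps)
  have K: "\<bar>g x - g y\<bar> \<le> K * (dst x y * (2 * D - dst x y))" if xy: "x \<in> heights" "y \<in> heights" for x y
  proof (cases "x = y")
    case False
    have d1: "1 \<le> dst x y" using dst_ge_one[OF xy False] .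
    have "1 * 1 \<le> dst x y * (2 * D - dst x y)" using d1 dD[OF xy] D1 by (intro mult_mono) auto
    then have "K * 1 \<le> K * (dst x y * (2 * D - dst x y))" using K0 by (intro mult_left_mono) auto
    moreover have "\<bar>g x\<bar> \<le> (\<Sum>h\<in>heights. \<bar>g h\<bar>)" "\<bar>g y\<bar> \<le> (\<Sum>h\<in>heights. \<bar>g h\<bar>)"
      using xy finite_heights by (auto intro!: member_le_sum)
    ultimately show ?thesis unfolding K_def by linarith
  qed simp
  have zero: "(\<Sum>h\<in>heights. (tower_avg ^^ t) g h) = 0" for t
    by (induction t) (auto simp: mean tower_avg_sum[OF S])
  \<comment> \<open>Every iterate has mean zero, so its value at \<open>x\<close> is the average of
    its differences from all values.\<close>
  have decay: "\<bar>(tower_avg ^^ t) g x\<bar> \<le> (K * D\<^sup>2) * \<rho> ^ t" if x: "x \<in> heights" for t x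
  proof -
    have n: "real (card heights) > 0" using x finite_heights by (auto simp: card_gt_0_iff)
    have "real (card heights) * \<bar>(tower_avg ^^ t) g x\<bar> = \<bar>\<Sum>y\<in>heights. (tower_avg ^^ t) g x - (tower_avg ^^ t) g y\<bar>"
      using zero[of t] by (simp add: sum_subtractf abs_mult)
    also have "\<dots> \<le> (\<Sum>y\<in>heights. \<bar>(tower_avg ^^ t) g x - (tower_avg ^^ t) g y\<bar>)" by (rule sum_abs)
    also have "\<dots> \<le> (\<Sum>y\<in>heights. (K * D\<^sup>2) * \<rho> ^ t)"
    proof (rule sum_mono)
      fix y assume y: "y \<in> heights"
      have "\<bar>(tower_avg ^^ t) g x - (tower_avg ^^ t) g y\<bar> \<le> K * \<rho> ^ t * (dst x y * (2 * D - dst x y))"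
        using D1 by (intro tower_avg_decay[OF dD _ S K K0 \<rho>_def rho x y]) auto
      also have "\<dots> \<le> K * \<rho> ^ t * D\<^sup>2" using K0 rho psi by (intro mult_left_mono) auto
      finally show "\<bar>(tower_avg ^^ t) g x - (tower_avg ^^ t) g y\<bar> \<le> (K * D\<^sup>2) * \<rho> ^ t" by (simp add: mult_ac)
    qed
    finally have "real (card heights) * \<bar>(tower_avg ^^ t) g x\<bar> \<le> real (card heights) * ((K * D\<^sup>2) * \<rho> ^ t)" by simp
    then show ?thesis using n by (simp only: mult_le_cancel_left_pos)
  qed
  have "(\<Sum>h\<in>heights. g h * tower_avg g h) \<le> \<rho> * (\<Sum>h\<in>heights. (g h)\<^sup>2)"
    by (rule rayleigh_le_decay_rate[OF tower_avg_sym[OF S] decay rho])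
  then show ?thesis unfolding \<rho>_def r by (simp add: left_diff_distrib f_def)
qed

end

section \<open>Comparison with single flips\<close>

definition flip_at :: "tri \<Rightarrow> (tri \<Rightarrow> int) \<Rightarrow> tri \<Rightarrow> int" where
  "flip_at T h = (if \<forall>c. h (nbr c T) = h T - 1 then h(T := h T - 2)
     else if \<forall>c. h (nbr c T) = h T + 1 then h(T := h T + 2) else h)"

lemma flip_at_local_max: "(\<And>c. h (nbr c T) = h T - 1) \<Longrightarrow> flip_at T h = h(T := h T - 2)"
  by (simp add: flip_at_def)

lemma flip_at_local_min:
  assumes "\<And>c. h (nbr c T) = h T + 1"
  shows "flip_at T h = h(T := h T + 2)"
proof -
  have "h (nbr Red T) \<noteq> h T - 1" using assms[of Red] by simp
  then show ?thesis using assms unfolding flip_at_def by presburger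
qed

lemma flip_at_flip_at: "flip_at T (flip_at T h) = h"
proof -
  consider (max) "\<And>c. h (nbr c T) = h T - 1" | (min) "\<And>c. h (nbr c T) = h T + 1"
    | (no) "\<not> (\<forall>c. h (nbr c T) = h T - 1)" "\<not> (\<forall>c. h (nbr c T) = h T + 1)" by blast
  then show ?thesis
  proof cases
    case max
    then have "flip_at T (h(T := h T - 2)) = h" by (subst flip_at_local_min) auto
    then show ?thesis using flip_at_local_max[OF max] by simp
  next
    case min
    then have "flip_at T (h(T := h T + 2)) = h" by (subst flip_at_local_max) auto
    then show ?thesis using flip_at_local_min[OF min] by simp
  next
    case no
    then have "flip_at T h = h" unfolding flip_at_def by presburger
    then show ?thesis by simp
  qed
qed

context region
begin

lemma flip_at_heights: "h \<in> heights \<Longrightarrow> T \<in> S \<Longrightarrow> flip_at T h \<in> heights"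
  using flip_heights[of h T 1] flip_heights[of h T "-1"] by (auto simp: flip_at_def)

section \<open>Decomposing a tower move into single flips\<close>

context
  fixes h s a b k E
  assumes h: "h \<in> heights" and s: "s \<in> {1, -1 :: int}" and t: "tower (scale s h) a b k E"
begin

text \<open>The state after the elements from the top down to position \<open>j\<close> have been
  moved. In this order each element is a local maximum of the scaled heights when its turn comes,
  since its only higher neighbour has just been lowered.\<close>

definition partial :: "nat \<Rightarrow> tri \<Rightarrow> int" where
  "partial j = lower s (strip a b E ` {j..k}) h"

lemma partial_top: "partial (Suc k) = h"
  by (simp add: partial_def)

lemma partial_zero: "partial 0 = lower s (tower_set (scale s h) E) h"
  using tower_set_eq[OF t] by (simp add: partial_def atLeast0AtMost)

lemma partial_local_max:
  assumes j: "j \<le> k"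
  shows "s * partial (Suc j) (nbr c (strip a b E j)) = s * partial (Suc j) (strip a b E j) - 1"
proof -
  have notin: "strip a b E i \<notin> strip a b E ` {Suc j..k}" if "i \<le> j" for i
    using tower_strip_eq[OF t, of i] that j by auto
  have z: "partial (Suc j) (strip a b E j) = h (strip a b E j)"
    using notin[of j] by (simp add: partial_def lower_def)
  show ?thesis
  proof (cases "j < k \<and> c = alt a b j")
    case True
    then have "nbr c (strip a b E j) = strip a b E (Suc j)" by simp
    moreover have "strip a b E (Suc j) \<in> strip a b E ` {Suc j..k}" by (rule imageI) (use True in simp)
    ultimately have "partial (Suc j) (nbr c (strip a b E j)) = h (nbr c (strip a b E j)) - 2 * s"
      by (simp add: partial_def lower_def del: strip.simps)
    then show ?thesis using z towerD(2)[OF t j, of c] True s by (auto simp: scale_def)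
  next
    case False
    have "nbr c (strip a b E j) \<notin> strip a b E ` {Suc j..k}"
    proof
      assume in_strip: "nbr c (strip a b E j) \<in> strip a b E ` {Suc j..k}"
      then have "nbr c (strip a b E j) \<in> strip a b E ` {..k}" by auto
      then have "nbr c (strip a b E j) = strip a b E (j - 1)"
        using tower_offstrip[OF t j] False by blast
      then show False using in_strip notin[of "j - 1"] by simp
    qed
    then have "partial (Suc j) (nbr c (strip a b E j)) = h (nbr c (strip a b E j))"
      by (simp add: partial_def lower_def)
    then show ?thesis using z towerD(2)[OF t j, of c] False by (auto simp: scale_def)
  qed
qed

lemma partial_step:
  assumes j: "j \<le> k"
  shows "partial j = flip_at (strip a b E j) (partial (Suc j))"
proof -
  let ?U = "strip a b E j"
  have notin: "?U \<notin> strip a b E ` {Suc j..k}"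
    using tower_strip_eq[OF t j] by auto
  have "{j..k} = insert j {Suc j..k}" using j by auto
  then have upd: "partial j = (partial (Suc j))(?U := partial (Suc j) ?U - 2 * s)"
    using notin by (auto simp: partial_def lower_def)
  have "s = 1 \<or> s = -1" using s by simp
  then show ?thesis
  proof
    assume "s = 1"
    then show ?thesis using partial_local_max[OF j] upd by (subst flip_at_local_max) auto
  next
    assume s1: "s = -1"
    have "partial (Suc j) (nbr c ?U) = partial (Suc j) ?U + 1" for c
      using partial_local_max[OF j, of c] s1 by simp
    then show ?thesis using upd s1 by (subst flip_at_local_min) auto
  qed
qed

lemma partial_heights: "partial j \<in> heights"
proof (cases "j \<le> Suc k")
  case True
  then show ?thesis
  proof (induction j rule: inc_induct)
    case base
    then show ?case using h by (simp add: partial_top)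
  next
    case (step j)
    then have "j \<le> k" by simp
    then show ?case using partial_step step.IH flip_at_heights towerD(1)[OF t] by simp
  qed
next
  case False
  then show ?thesis using h by (simp add: partial_def)
qed

lemma tower_move_telescope:
  "(g h - g (lower s (tower_set (scale s h) E) h))\<^sup>2 \<le>
     real (Suc k) * (\<Sum>j\<le>k. (g (partial (Suc j)) - g (flip_at (strip a b E j) (partial (Suc j))))\<^sup>2)"
proof -
  have "g h - g (lower s (tower_set (scale s h) E) h) = g (partial (Suc k)) - g (partial 0)"
    by (simp add: partial_top partial_zero)
  also have "\<dots> = (\<Sum>j\<le>k. g (partial (Suc j)) - g (partial j))"
    using sum_lessThan_telescope[of "\<lambda>j. g (partial j)" "Suc k"]
    by (simp add: lessThan_Suc_atMost)
  also have "\<dots> = (\<Sum>j\<le>k. g (partial (Suc j)) - g (flip_at (strip a b E j) (partial (Suc j))))"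
    using partial_step by (intro sum.cong refl) simp
  finally show ?thesis
    using Cauchy_Schwarz_ineq_sum[of "\<lambda>_. 1" "\<lambda>j. g (partial (Suc j)) - g (flip_at (strip a b E j) (partial (Suc j)))" "{..k}"]
    by simp
qed

end

text \<open>Heights have absolute value at most 4 sqrt (card S) and increase by 1 along a tower,
  whence the 8; the added 1 makes the bound on \<open>k\<close> strict.\<close>

definition L :: nat where "L = nat \<lfloor>8 * sqrt (card S)\<rfloor> + 1"

lemma tower_length:
  assumes h: "h \<in> heights" and t: "tower h a b k E"
  shows "k < L"
proof -
  have "real_of_int (h (strip a b E k)) = real_of_int (h E) + real k"
    using tower_height[OF t, of k] by simp
  then have "real k \<le> 8 * sqrt (card S)"
    using height_bound_sqrt[OF h, of E] height_bound_sqrt[OF h, of "strip a b E k"] by linarith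
  then show ?thesis unfolding L_def by linarith
qed

lemma L_bound: "S \<noteq> {} \<Longrightarrow> (real L)\<^sup>2 \<le> 81 * card S"
proof -
  assume "S \<noteq> {}"
  then have "1 \<le> real (card S)" using finite_S by (simp add: Suc_le_eq card_gt_0_iff)
  then have "1 \<le> sqrt (card S)" by simp
  then have "real L \<le> 9 * sqrt (card S)" unfolding L_def by linarith
  then have "(real L)\<^sup>2 \<le> (9 * sqrt (card S))\<^sup>2" by (intro power_mono) auto
  then show ?thesis by (simp add: power_mult_distrib)
qed

definition flip_form :: "((tri \<Rightarrow> int) \<Rightarrow> real) \<Rightarrow> real" where
  "flip_form g = (\<Sum>T\<in>S. \<Sum>h\<in>heights. (g h - g (flip_at T h))\<^sup>2)"

text \<open>Every flip \<open>(z, T)\<close> occurs at most once in position \<open>j\<close> of a tower move of given colours and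
  length: the last element is found by walking down the strip from \<open>T\<close>, and the initial state by
  undoing the flips above \<open>T\<close>.\<close>

lemma congestion:
  assumes s: "s \<in> {1, -1 :: int}" and j: "j \<le> k"
  shows "(\<Sum>(h, E)\<in>{(h, E). h \<in> heights \<and> E \<in> S \<and> tower (scale s h) a b k E}.
      (g (partial h s a b k E (Suc j)) - g (flip_at (strip a b E j) (partial h s a b k E (Suc j))))\<^sup>2) \<le> flip_form g"
proof -
  define M where "M = {(h, E). h \<in> heights \<and> E \<in> S \<and> tower (scale s h) a b k E}"
  define \<theta> where "\<theta> = (\<lambda>(h, E). (strip a b E j, partial h s a b k E (Suc j)))"
  define e where "e = (\<lambda>(T, z). (g z - g (flip_at T z))\<^sup>2)"
  have part: "partial h s a b k E i = lower s (strip a b E ` {i..k}) h" if "tower (scale s h) a b k E" "h \<in> heights" for h E i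
    using that s by (simp add: partial_def)
  have inj: "inj_on \<theta> M"
  proof (rule inj_onI)
    fix u v assume u: "u \<in> M" and v: "v \<in> M" and eq: "\<theta> u = \<theta> v"
    obtain h E where uu: "u = (h, E)" by (cases u)
    obtain h' E' where vv: "v = (h', E')" by (cases v)
    have "strip a b E j = strip a b E' j" using eq uu vv by (simp add: \<theta>_def)
    then have E: "E = E'" by (rule strip_inj)
    have "lower s (strip a b E ` {Suc j..k}) h = lower s (strip a b E ` {Suc j..k}) h'"
      using eq u v unfolding uu vv \<theta>_def M_def E by (simp add: part)
    then have "h U = h' U" for U by (metis (no_types, lifting) add_right_cancel diff_add_cancel lower_def)
    then show "u = v" using E uu vv by auto
  qed
  have sub: "\<theta> ` M \<subseteq> S \<times> heights"
    using partial_heights s towerD(1) j unfolding M_def \<theta>_def by fastforce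
  have "(\<Sum>(h, E)\<in>M. (g (partial h s a b k E (Suc j)) - g (flip_at (strip a b E j) (partial h s a b k E (Suc j))))\<^sup>2)
      = (\<Sum>u\<in>M. e (\<theta> u))"
    by (intro sum.cong refl) (auto simp: e_def \<theta>_def)
  also have "\<dots> = (\<Sum>v\<in>\<theta> ` M. e v)" by (simp add: sum.reindex[OF inj])
  also have "\<dots> \<le> (\<Sum>v\<in>S \<times> heights. e v)"
    using sub finite_S finite_heights by (intro sum_mono2) (auto simp: e_def)
  also have "\<dots> = flip_form g"
    by (simp add: flip_form_def sum.cartesian_product e_def split_def)
  finally show ?thesis by (simp add: M_def)
qed

lemma threshold_mult_le: "k \<le> card S \<Longrightarrow> real (threshold k) * real k \<le> real N / 2"
proof -
  assume k: "k \<le> card S"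
  consider "k = 0" | "k = 1" | "2 \<le> k" by linarith
  then show ?thesis
  proof cases
    case 3
    then show ?thesis using threshold_big[of k] k by (simp add: mult.commute)
  qed (use threshold_one in auto)
qed

text \<open>The Cauchy-Schwarz factor, which is the tower length, is absorbed by the acceptance
  probability (\<open>threshold_mult_le\<close>). What remains is the number of labels: each flip is
  met at most once per colour pair, length and position, hence at most 9 L^2 times.\<close>

lemma tower_form_le:
  assumes s: "s \<in> {1, -1 :: int}"
  shows "(\<Sum>h\<in>heights. \<Sum>E\<in>S. real (threshold (card (tower_set (scale s h) E))) * (g h - g (lower s (tower_set (scale s h) E) h))\<^sup>2)
    \<le> real N / 2 * (9 * (real L)\<^sup>2) * flip_form g"
proof -
  define e where "e h a b k E j = (g (partial h s a b k E (Suc j)) - g (flip_at (strip a b E j) (partial h s a b k E (Suc j))))\<^sup>2"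
    for h a b k E j
  define I where "I = (UNIV :: colour set) \<times> (UNIV :: colour set) \<times> {(k, j). k < L \<and> j \<le> k}"
  have KL: "{(k, j). k < L \<and> j \<le> k} \<subseteq> {..<L} \<times> {..<L}" by auto
  have finI: "finite I" unfolding I_def using finite_subset[OF KL] by (intro finite_cartesian_product) auto
  have "card I = 9 * card {(k, j). k < L \<and> j \<le> k}"
    unfolding I_def card_cartesian_product by (simp add: UNIV_colour)
  also have "\<dots> \<le> 9 * (L * L)" using card_mono[OF _ KL] by simp
  finally have cI: "real (card I) \<le> 9 * (real L)\<^sup>2"
    unfolding power2_eq_square by (metis of_nat_le_iff of_nat_mult of_nat_numeral)
  have one: "real (threshold (card (tower_set (scale s h) E))) * (g h - g (lower s (tower_set (scale s h) E) h))\<^sup>2 \<le>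
      real N / 2 * (\<Sum>(a, b, k, j)\<in>I. of_bool (tower (scale s h) a b k E) * e h a b k E j)" if h: "h \<in> heights" for h E
  proof (cases "tower_set (scale s h) E = {}")
    case True
    then show ?thesis by (auto simp: threshold_def e_def intro!: mult_nonneg_nonneg sum_nonneg)
  next
    case False
    then obtain a b k where t: "tower (scale s h) a b k E" by (metis tower_set_nonempty)
    have cd: "card (tower_set (scale s h) E) = Suc k" using card_tower_set[OF t] .
    have kS: "Suc k \<le> card S" using card_tower_set_le[of "scale s h" E] cd by simp
    have kL: "k < L" using tower_length[OF scale_heights[OF h s] t] .
    define Q where "Q = (\<Sum>j\<le>k. e h a b k E j)"
    have Q0: "0 \<le> Q" by (simp add: Q_def e_def sum_nonneg)
    have "real (threshold (Suc k)) * (g h - g (lower s (tower_set (scale s h) E) h))\<^sup>2 \<le> real (threshold (Suc k)) * (real (Suc k) * Q)"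
      using tower_move_telescope[OF h s t, of g] by (intro mult_left_mono) (auto simp: Q_def e_def)
    also have "\<dots> = (real (threshold (Suc k)) * real (Suc k)) * Q" by simp
    also have "\<dots> \<le> real N / 2 * Q" using threshold_mult_le[OF kS] Q0 by (intro mult_right_mono) auto
    also have "\<dots> \<le> real N / 2 * (\<Sum>(a, b, k, j)\<in>I. of_bool (tower (scale s h) a b k E) * e h a b k E j)"
    proof (rule mult_left_mono)
      \<comment> \<open>A short tower has several labels; one of them suffices here, and the others
        add nonnegative terms.\<close>
      have "Q = (\<Sum>(a, b, k, j)\<in>(\<lambda>j. (a, b, k, j)) ` {..k}. of_bool (tower (scale s h) a b k E) * e h a b k E j)"
        using t by (subst sum.reindex) (auto simp: inj_on_def Q_def)
      also have "\<dots> \<le> (\<Sum>(a, b, k, j)\<in>I. of_bool (tower (scale s h) a b k E) * e h a b k E j)"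
        using finI kL by (intro sum_mono2) (auto simp: I_def e_def)
      finally show "Q \<le> \<dots>" .
    qed simp
    finally show ?thesis by (simp add: cd)
  qed
  define \<phi> where "\<phi> h E = (\<Sum>(a, b, k, j)\<in>I. of_bool (tower (scale s h) a b k E) * e h a b k E j)" for h E
  have "(\<Sum>h\<in>heights. \<Sum>E\<in>S. real (threshold (card (tower_set (scale s h) E))) * (g h - g (lower s (tower_set (scale s h) E) h))\<^sup>2)
    \<le> (\<Sum>h\<in>heights. \<Sum>E\<in>S. real N / 2 * \<phi> h E)"
    unfolding \<phi>_def by (intro sum_mono one)
  also have "\<dots> = real N / 2 * (\<Sum>(h, E)\<in>heights \<times> S. \<phi> h E)"
    by (simp only: sum_distrib_left[symmetric] sum.cartesian_product)
  also have "\<dots> = real N / 2 * (\<Sum>z\<in>heights \<times> S. \<Sum>i\<in>I. case z of (h, E) \<Rightarrow> case i of (a, b, k, j) \<Rightarrow>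
       of_bool (tower (scale s h) a b k E) * e h a b k E j)"
    by (simp add: \<phi>_def split_def)
  also have "\<dots> = real N / 2 * (\<Sum>i\<in>I. \<Sum>z\<in>heights \<times> S. case z of (h, E) \<Rightarrow> case i of (a, b, k, j) \<Rightarrow>
       of_bool (tower (scale s h) a b k E) * e h a b k E j)"
    by (subst sum.swap) (rule refl)
  also have "\<dots> \<le> real N / 2 * (\<Sum>i\<in>I. flip_form g)"
  proof (intro mult_left_mono sum_mono)
    fix i assume i: "i \<in> I"
    obtain a b k j where ii: "i = (a, b, k, j)" by (cases i)
    then have j: "j \<le> k" using i by (simp add: I_def)
    have "(\<Sum>z\<in>heights \<times> S. case z of (h, E) \<Rightarrow> of_bool (tower (scale s h) a b k E) * e h a b k E j)
       = (\<Sum>(h, E)\<in>{(h, E). h \<in> heights \<and> E \<in> S \<and> tower (scale s h) a b k E}. e h a b k E j)"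
      using finite_heights finite_S by (intro sum.mono_neutral_cong_right) auto
    also have "\<dots> \<le> flip_form g" unfolding e_def by (rule congestion[OF s j])
    finally show "(\<Sum>z\<in>heights \<times> S. case z of (h, E) \<Rightarrow> case i of (a, b, k, j) \<Rightarrow>
       of_bool (tower (scale s h) a b k E) * e h a b k E j) \<le> flip_form g" by (simp add: ii)
  qed simp
  also have "\<dots> = real N / 2 * (real (card I) * flip_form g)" by simp
  also have "\<dots> \<le> real N / 2 * ((9 * (real L)\<^sup>2) * flip_form g)"
    using cI by (intro mult_left_mono mult_right_mono) (auto simp: flip_form_def sum_nonneg)
  finally show ?thesis by simp
qed

text \<open>93312 = 128 * 729, where 128 comes from the gap of the tower chain and 729 = 9 * 81 from
  the colour pairs and \<open>L_bound\<close>. The fifth power is f^4 times the f hidden in L^2. The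
  denominator on the right is the one used for lazy chains of involutions.\<close>

lemma flip_gap:
  assumes S: "S \<noteq> {}" and mean: "(\<Sum>h\<in>heights. g h) = 0"
  shows "1 / (93312 * real (card S) ^ 5) * (\<Sum>h\<in>heights. (g h)\<^sup>2) \<le> flip_form g / (4 * card S)"
proof -
  define f where "f = real (card S)"
  have f: "0 < f" using S finite_S by (simp add: f_def card_gt_0_iff)
  define V where "V = (\<Sum>h\<in>heights. (g h)\<^sup>2)"
  define DF where "DF = V - (\<Sum>h\<in>heights. g h * tower_avg g h)"
  have F0: "0 \<le> flip_form g" by (auto simp: flip_form_def intro!: sum_nonneg)
  have "4 * f * N * DF = (\<Sum>s\<in>{1,-1}. \<Sum>h\<in>heights. \<Sum>E\<in>S. real (threshold (card (tower_set (scale s h) E))) *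
        (g h - g (lower s (tower_set (scale s h) E) h))\<^sup>2)"
    using tower_avg_dirichlet[OF S, of g] by (subst sum.swap) (simp add: DF_def V_def f_def)
  also have "\<dots> \<le> (\<Sum>s\<in>{1,-1::int}. real N / 2 * (9 * (real L)\<^sup>2) * flip_form g)"
    by (intro sum_mono tower_form_le)
  also have "\<dots> = real N * (9 * ((real L)\<^sup>2 * flip_form g))" by simp
  also have "\<dots> \<le> real N * (9 * ((81 * f) * flip_form g))"
    using L_bound[OF S] F0 by (intro mult_left_mono mult_right_mono) (auto simp: f_def)
  finally have "(4 * f * N) * DF \<le> (4 * f * N) * (729 / 4 * flip_form g)" by (simp add: algebra_simps)
  moreover have "0 < 4 * f * N" using f N_pos by simp
  ultimately have "DF \<le> 729 / 4 * flip_form g" by (simp only: mult_le_cancel_left_pos)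
  moreover have "V / (128 * f ^ 4) \<le> DF" using tower_avg_gap[OF S mean] by (simp add: V_def DF_def f_def)
  ultimately have "V / (128 * f ^ 4) \<le> 729 / 4 * flip_form g" by linarith
  then have "V / (128 * f ^ 4) * (1 / (729 * f)) \<le> 729 / 4 * flip_form g * (1 / (729 * f))"
    using f by (intro mult_right_mono) auto
  moreover have "V / (128 * f ^ 4) * (1 / (729 * f)) = 1 / (93312 * f ^ 5) * V"
    by (simp add: power_Suc2[of f 4, simplified] field_simps)
  moreover have "729 / 4 * flip_form g * (1 / (729 * f)) = flip_form g / (4 * f)" by simp
  ultimately show ?thesis by (simp only: V_def f_def)
qed

end

section \<open>Geometry of the triangular lattice\<close>

text \<open>Coordinates in the lattice basis 1, cis (pi / 3). The lines of the lattice are the sets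
  where \<open>px\<close>, \<open>py\<close> or their sum is an integer.\<close>

definition px :: "complex \<Rightarrow> real" where "px z = Re z - Im z / sqrt 3"
definition py :: "complex \<Rightarrow> real" where "py z = 2 * Im z / sqrt 3"

lemma px_embed [simp]: "px (embed v) = fst v" and py_embed [simp]: "py (embed v) = snd v"
  by (simp_all add: px_def py_def embed_def cos_60 sin_60)

lemma px_linear [simp]: "px (z + w) = px z + px w" "px (z - w) = px z - px w" "px (r *\<^sub>R z) = r * px z"
  and py_linear [simp]: "py (z + w) = py z + py w" "py (z - w) = py z - py w" "py (r *\<^sub>R z) = r * py z"
  by (simp_all add: px_def py_def add_divide_distrib diff_divide_distrib algebra_simps)

lemma continuous_px [continuous_intros]: "continuous_on A px" and continuous_py [continuous_intros]: "continuous_on A py"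
  by (simp_all add: px_def[abs_def] py_def[abs_def] continuous_intros)

lemma coords_eqI: "px z = px w \<Longrightarrow> py z = py w \<Longrightarrow> z = w"
  by (rule complex_eqI) (simp_all add: px_def py_def)

definition of_coords :: "real \<Rightarrow> real \<Rightarrow> complex" where
  "of_coords x y = Complex (x + y / 2) (y * sqrt 3 / 2)"

lemma px_of_coords [simp]: "px (of_coords x y) = x" and py_of_coords [simp]: "py (of_coords x y) = y"
  by (simp_all add: px_def py_def of_coords_def)

lemma abs_px_le: "\<bar>px z\<bar> \<le> 2 * norm z" and abs_py_le: "\<bar>py z\<bar> \<le> 2 * norm z"
proof -
  have s: "1 \<le> sqrt 3" by simp
  have "\<bar>Im z\<bar> / sqrt 3 \<le> \<bar>Im z\<bar> / 1" using s by (intro divide_left_mono) auto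
  then have i: "\<bar>Im z / sqrt 3\<bar> \<le> norm z" using abs_Im_le_cmod[of z] by simp
  show "\<bar>py z\<bar> \<le> 2 * norm z" using i unfolding py_def by linarith
  show "\<bar>px z\<bar> \<le> 2 * norm z" using i abs_Re_le_cmod[of z] unfolding px_def by linarith
qed

section \<open>Open and closed triangles\<close>

fun otri :: "tri \<Rightarrow> complex set" where
  "otri (Tri i j u) = (if u then {z. i < px z \<and> j < py z \<and> px z + py z < i + j + 1}
     else {z. px z < i + 1 \<and> py z < j + 1 \<and> i + j + 1 < px z + py z})"

fun ctri :: "tri \<Rightarrow> complex set" where
  "ctri (Tri i j u) = (if u then {z. i \<le> px z \<and> j \<le> py z \<and> px z + py z \<le> i + j + 1}
     else {z. px z \<le> i + 1 \<and> py z \<le> j + 1 \<and> i + j + 1 \<le> px z + py z})"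

lemma otri_subset_ctri: "otri T \<subseteq> ctri T"
  by (cases T) auto

lemma open_otri: "open (otri T)"
  by (cases T) (auto intro!: open_Collect_conj open_Collect_less continuous_intros)

lemma closed_ctri: "closed (ctri T)"
  by (cases T) (auto intro!: closed_Collect_conj closed_Collect_le continuous_intros)

lemma ctri_box:
  assumes "z \<in> ctri (Tri i j u)"
  shows "i \<le> px z" "px z \<le> i + 1" "j \<le> py z" "py z \<le> j + 1"
  using assms by (auto split: if_splits)

lemma convex_otri: "convex (otri T)"
proof -
  have lin: "convex {z. l z < (c::real)}" "convex {z. c < l z}"
    if "\<And>u v z w. l (u *\<^sub>R z + v *\<^sub>R w) = u * l z + v * l w" for l :: "complex \<Rightarrow> real" and c
  proof -
    have *: "u * a + v * b < c" if "u + v = 1" "0 \<le> u" "0 \<le> v" "a < c" "b < c" for u v a b c :: real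
      using convex_bound_lt[of a c b u v] that by simp
    show "convex {z. l z < c}" by (auto simp: convex_def that intro!: *)
    have "u * a + v * b > c" if "u + v = 1" "0 \<le> u" "0 \<le> v" "a > c" "b > c" for u v a b c :: real
      using *[of u v "- a" "- c" "- b"] that by simp
    then show "convex {z. c < l z}" by (auto simp: convex_def that)
  qed
  have eq: "otri (Tri i j u) = (if u then {z. real_of_int i < px z} \<inter> {z. real_of_int j < py z} \<inter> {z. px z + py z < i + j + 1}
    else {z. px z < real_of_int i + 1} \<inter> {z. py z < real_of_int j + 1} \<inter> {z. real_of_int i + j + 1 < px z + py z})" for i j u
    by auto
  show ?thesis
    by (cases T) (auto simp only: eq intro!: convex_Int lin split: if_split, auto simp: algebra_simps)
qed

definition centroid :: "tri \<Rightarrow> complex" where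
  "centroid T = (if upward T then of_coords (tcol T + 1 / 3) (trow T + 1 / 3)
     else of_coords (tcol T + 2 / 3) (trow T + 2 / 3))"

lemma centroid_otri: "centroid T \<in> otri T"
  by (cases T) (auto simp: centroid_def)

lemma open_segment_otri:
  assumes z: "z \<in> ctri T" and w: "w \<in> otri T" and t: "0 < t" "t \<le> 1"
  shows "(1 - t) *\<^sub>R z + t *\<^sub>R w \<in> otri T"
proof -
  have lt: "(1 - t) * a + t * b < (c::real)" if "a \<le> c" "b < c" for a b c
  proof -
    have "(1 - t) * a \<le> (1 - t) * c" "t * b < t * c" using that t by (auto intro: mult_left_mono)
    then show ?thesis by (simp add: algebra_simps)
  qed
  have gt: "(c::real) < (1 - t) * a + t * b" if "c \<le> a" "c < b" for a b c
    using lt[of "- a" "- c" "- b"] that by simp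
  have sum: "(1 - t) * a + t * b + ((1 - t) * a' + t * b') = (1 - t) * (a + a') + t * (b + b')" for a b a' b' :: real
    by (simp add: algebra_simps)
  show ?thesis
    using z w by (cases T) (auto simp: sum intro!: lt gt split: if_splits)
qed

lemma closure_otri: "closure (otri T) = ctri T"
proof
  show "closure (otri T) \<subseteq> ctri T"
    by (rule closure_minimal[OF otri_subset_ctri closed_ctri])
  show "ctri T \<subseteq> closure (otri T)"
  proof
    fix z assume z: "z \<in> ctri T"
    have "((\<lambda>t. (1 - t) *\<^sub>R z + t *\<^sub>R centroid T) \<longlongrightarrow> (1 - 0) *\<^sub>R z + 0 *\<^sub>R centroid T) (at_right (0::real))"
      by (intro tendsto_intros)
    moreover have "eventually (\<lambda>t. (1 - t) *\<^sub>R z + t *\<^sub>R centroid T \<in> otri T) (at_right (0::real))"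
      unfolding eventually_at_right_field
      using open_segment_otri[OF z centroid_otri] by (intro exI[of _ 1]) auto
    then have "eventually (\<lambda>t. (1 - t) *\<^sub>R z + t *\<^sub>R centroid T \<in> closure (otri T)) (at_right (0::real))"
      by (rule eventually_mono) (use closure_subset in blast)
    ultimately have "(1 - 0) *\<^sub>R z + 0 *\<^sub>R centroid T \<in> closure (otri T)"
      by (intro Lim_in_closed_set[OF closed_closure]) auto
    then show "z \<in> closure (otri T)" by simp
  qed
qed

text \<open>The arcs from \<open>src\<close> to \<open>tgt\<close> run counterclockwise around each
  triangle, so the two triangles at an edge induce opposite arcs, and every directed lattice edge
  has exactly one triangle on its left.\<close>

fun src :: "colour \<Rightarrow> tri \<Rightarrow> vertex" and tgt :: "colour \<Rightarrow> tri \<Rightarrow> vertex" where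
  "src Red (Tri i j u) = (if u then (i + 1, j) else (i, j + 1))"
| "src Green (Tri i j u) = (if u then (i, j + 1) else (i + 1, j))"
| "src Blue (Tri i j u) = (if u then (i, j) else (i + 1, j + 1))"
| "tgt Red (Tri i j u) = (if u then (i, j + 1) else (i + 1, j))"
| "tgt Green (Tri i j u) = (if u then (i, j) else (i + 1, j + 1))"
| "tgt Blue (Tri i j u) = (if u then (i + 1, j) else (i, j + 1))"

definition edge :: "colour \<Rightarrow> tri \<Rightarrow> vertex set" where
  "edge c T = {src c T, tgt c T}"

lemma src_nbr [simp]: "src c (nbr c T) = tgt c T" and tgt_nbr [simp]: "tgt c (nbr c T) = src c T"
  by (cases T; cases c; auto)+

lemma edge_nbr [simp]: "edge c (nbr c T) = edge c T"
  by (auto simp: edge_def)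

lemma edge_in_lattice: "edge c T \<in> lattice_edges"
proof -
  have up: "edge c (Tri i j True) \<in> lattice_edges" for i j
  proof (cases c)
    case Red
    have "edge c (Tri i j True) = {(i, j + 1), (i + 1, (j + 1) - 1)}" using Red by (auto simp: edge_def)
    then show ?thesis unfolding lattice_edges_def by blast
  next
    case Green
    have "edge c (Tri i j True) = {(i, j), (i, j + 1)}" using Green by (auto simp: edge_def)
    then show ?thesis unfolding lattice_edges_def by blast
  next
    case Blue
    have "edge c (Tri i j True) = {(i, j), (i + 1, j)}" using Blue by (auto simp: edge_def)
    then show ?thesis unfolding lattice_edges_def by blast
  qed
  show ?thesis
  proof (cases "upward T")
    case True
    then show ?thesis using up by (cases T) auto
  next
    case False
    then have "upward (nbr c T)" by simp
    then have "edge c (nbr c T) \<in> lattice_edges" using up by (cases "nbr c T") auto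
    then show ?thesis by simp
  qed
qed

lemma lattice_edgeE:
  assumes "e \<in> lattice_edges"
  obtains c i j where "e = edge c (Tri i j True)"
proof -
  obtain i j where "e = {(i, j), (i + 1, j)} \<or> e = {(i, j), (i, j + 1)} \<or> e = {(i, j), (i + 1, j - 1)}"
    using assms unfolding lattice_edges_def by blast
  then have "e = edge Blue (Tri i j True) \<or> e = edge Green (Tri i j True) \<or> e = edge Red (Tri i (j - 1) True)"
    by (auto simp: edge_def)
  then show thesis using that by blast
qed

text \<open>Every edge borders exactly one upward triangle, so upward triangles can name all
  edges.\<close>

lemma edge_segment_iff:
  "z \<in> edge_segment (edge c (Tri i j True)) \<longleftrightarrow> (case c of
      Red \<Rightarrow> px z + py z = of_int i + of_int j + 1 \<and> of_int i \<le> px z \<and> px z \<le> of_int i + 1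
    | Green \<Rightarrow> px z = of_int i \<and> of_int j \<le> py z \<and> py z \<le> of_int j + 1
    | Blue \<Rightarrow> py z = of_int j \<and> of_int i \<le> px z \<and> px z \<le> of_int i + 1)"
proof -
  let ?a = "embed (src c (Tri i j True))" and ?b = "embed (tgt c (Tri i j True))"
  have "edge_segment (edge c (Tri i j True)) = closed_segment ?a ?b"
    by (simp add: edge_segment_def edge_def segment_convex_hull)
  then have "z \<in> edge_segment (edge c (Tri i j True)) \<longleftrightarrow> (\<exists>t. 0 \<le> t \<and> t \<le> 1 \<and> z = (1 - t) *\<^sub>R ?a + t *\<^sub>R ?b)"
    by (auto simp: in_segment)
  also have "\<dots> \<longleftrightarrow> (\<exists>t. 0 \<le> t \<and> t \<le> 1 \<and> px z = (1 - t) * px ?a + t * px ?b \<and> py z = (1 - t) * py ?a + t * py ?b)"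
    by (metis coords_eqI px_linear(1,3) py_linear(1,3))
  also have "\<dots> \<longleftrightarrow> (case c of
      Red \<Rightarrow> px z + py z = of_int i + of_int j + 1 \<and> of_int i \<le> px z \<and> px z \<le> of_int i + 1
    | Green \<Rightarrow> px z = of_int i \<and> of_int j \<le> py z \<and> py z \<le> of_int j + 1
    | Blue \<Rightarrow> py z = of_int j \<and> of_int i \<le> px z \<and> px z \<le> of_int i + 1)"
  proof (cases c)
    case Red
    then show ?thesis by (auto simp: algebra_simps intro!: exI[of _ "py z - j"])
  next
    case Green
    then show ?thesis by (auto simp: algebra_simps intro!: exI[of _ "j + 1 - py z"])
  next
    case Blue
    then show ?thesis by (auto simp: algebra_simps intro!: exI[of _ "px z - i"])
  qed
  finally show ?thesis .
qed

text \<open>Rounding picks one closed triangle at each point, so that a function on triangles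
  becomes a function on the plane.\<close>

definition canon :: "complex \<Rightarrow> tri" where
  "canon z = Tri \<lfloor>px z\<rfloor> \<lfloor>py z\<rfloor> (px z + py z < \<lfloor>px z\<rfloor> + \<lfloor>py z\<rfloor> + 1)"

lemma canon_mem: "z \<in> ctri (canon z)"
  using floor_correct[of "px z"] floor_correct[of "py z"] unfolding canon_def by auto

lemma canon_constant:
  fixes h :: "tri \<Rightarrow> 'a"
  assumes e: "\<And>T c. z \<in> edge_segment (edge c T) \<Longrightarrow> h (nbr c T) = h T" and z: "z \<in> ctri T"
  shows "h T = h (canon z)"
proof -
  have e1: "h (Tri a b False) = h (Tri a b True)" if "px z + py z = a + b + 1" "a \<le> px z" "px z \<le> a + 1" for a b
    using e[of Red "Tri a b True"] that by (simp add: edge_segment_iff)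
  have e2: "h (Tri (a - 1) b False) = h (Tri a b True)" if "px z = a" "b \<le> py z" "py z \<le> b + 1" for a b
    using e[of Green "Tri a b True"] that by (simp add: edge_segment_iff)
  have e3: "h (Tri a (b - 1) False) = h (Tri a b True)" if "py z = b" "a \<le> px z" "px z \<le> a + 1" for a b
    using e[of Blue "Tri a b True"] that by (simp add: edge_segment_iff)
  obtain a b u where T: "T = Tri a b u" by (cases T)
  show ?thesis
  proof (cases u)
    case True
    then have ineq: "a \<le> px z" "b \<le> py z" "px z + py z \<le> a + b + 1" using z T by auto
    consider "px z + py z < a + b + 1" | "px z + py z = a + b + 1" "px z < a + 1" "py z < b + 1"
      | "px z = a + 1" "py z = b" | "px z = a" "py z = b + 1" using ineq by linarith
    then show ?thesis
    proof cases
      case 1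
      then have "\<lfloor>px z\<rfloor> = a" "\<lfloor>py z\<rfloor> = b" using ineq by (auto simp: floor_eq_iff)
      then show ?thesis using 1 T True by (simp add: canon_def)
    next
      case 2
      then have "\<lfloor>px z\<rfloor> = a" "\<lfloor>py z\<rfloor> = b" using ineq by (auto simp: floor_eq_iff)
      then show ?thesis using 2 T True e1[of a b] ineq by (simp add: canon_def)
    next
      case 3
      then have "\<lfloor>px z\<rfloor> = a + 1" "\<lfloor>py z\<rfloor> = b" by (auto simp: floor_eq_iff)
      then show ?thesis using 3 T True e1[of a b] e2[of "a + 1" b] ineq by (simp add: canon_def)
    next
      case 4
      then have "\<lfloor>px z\<rfloor> = a" "\<lfloor>py z\<rfloor> = b + 1" by (auto simp: floor_eq_iff)
      then show ?thesis using 4 T True e1[of a b] e3[of "b + 1" a] ineq by (simp add: canon_def)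
    qed
  next
    case False
    then have ineq: "px z \<le> a + 1" "py z \<le> b + 1" "a + b + 1 \<le> px z + py z" using z T by auto
    consider "px z < a + 1" "py z < b + 1" | "px z = a + 1" "py z < b + 1"
      | "px z < a + 1" "py z = b + 1" | "px z = a + 1" "py z = b + 1" using ineq by linarith
    then show ?thesis
    proof cases
      case 1
      then have "\<lfloor>px z\<rfloor> = a" "\<lfloor>py z\<rfloor> = b" using ineq by (auto simp: floor_eq_iff)
      then show ?thesis using 1 T False ineq by (simp add: canon_def)
    next
      case 2
      then have "\<lfloor>px z\<rfloor> = a + 1" "\<lfloor>py z\<rfloor> = b" using ineq by (auto simp: floor_eq_iff)
      then show ?thesis using 2 T False e2[of "a + 1" b] ineq by (simp add: canon_def)
    next
      case 3
      then have "\<lfloor>px z\<rfloor> = a" "\<lfloor>py z\<rfloor> = b + 1" using ineq by (auto simp: floor_eq_iff)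
      then show ?thesis using 3 T False e3[of "b + 1" a] ineq by (simp add: canon_def)
    next
      case 4
      then have "\<lfloor>px z\<rfloor> = a + 1" "\<lfloor>py z\<rfloor> = b + 1" by (auto simp: floor_eq_iff)
      then show ?thesis using 4 T False e2[of "a + 1" b] e1[of "a + 1" b] e3[of "b + 1" "a + 1"] ineq
        by (simp add: canon_def)
    qed
  qed
qed

lemma finite_meeting:
  assumes "bounded B"
  shows "finite {T. ctri T \<inter> B \<noteq> {}}"
proof -
  obtain M where M: "\<And>z. z \<in> B \<Longrightarrow> norm z \<le> M" using assms by (auto simp: bounded_iff)
  let ?I = "{\<lfloor>- 2 * M\<rfloor> - 1 .. \<lceil>2 * M\<rceil>}"
  have "{T. ctri T \<inter> B \<noteq> {}} \<subseteq> (\<lambda>(i, j, u). Tri i j u) ` (?I \<times> ?I \<times> UNIV)"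
  proof
    fix T assume "T \<in> {T. ctri T \<inter> B \<noteq> {}}"
    then obtain z where z: "z \<in> ctri T" "z \<in> B" by blast
    obtain i j u where T: "T = Tri i j u" by (cases T)
    note box = ctri_box[OF z(1)[unfolded T]]
    have b: "\<bar>px z\<bar> \<le> 2 * M" "\<bar>py z\<bar> \<le> 2 * M" using abs_px_le[of z] abs_py_le[of z] M[OF z(2)] by linarith+
    have "i \<in> ?I" "j \<in> ?I" using box b by (auto simp: le_ceiling_iff floor_le_iff) linarith+
    then show "T \<in> (\<lambda>(i, j, u). Tri i j u) ` (?I \<times> ?I \<times> UNIV)" unfolding T by (force intro!: image_eqI[of _ _ "(i, j, u)"])
  qed
  then show ?thesis by (rule finite_subset) auto
qed

lemma nearby_triangles: "\<exists>\<epsilon>>0. \<forall>w\<in>ball z \<epsilon>. \<forall>T. w \<in> ctri T \<longrightarrow> z \<in> ctri T"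
proof -
  define K where "K = \<Union>(ctri ` {T. ctri T \<inter> ball z 1 \<noteq> {} \<and> z \<notin> ctri T})"
  have "finite {T. ctri T \<inter> ball z 1 \<noteq> {} \<and> z \<notin> ctri T}"
    by (rule finite_subset[OF _ finite_meeting[OF bounded_ball[of z 1]]]) auto
  then have "closed K" unfolding K_def by (intro closed_Union) (auto simp: closed_ctri)
  moreover have "z \<notin> K" by (auto simp: K_def)
  ultimately have "open (ball z 1 - K)" "z \<in> ball z 1 - K" by auto
  then obtain \<epsilon> where "0 < \<epsilon>" "ball z \<epsilon> \<subseteq> ball z 1 - K" using open_contains_ball by blast
  then show ?thesis unfolding K_def by blast
qed

text \<open>Composed with \<open>canon\<close>, \<open>h\<close> is locally constant on
  \<open>Q\<close>, because the closed triangles at points near a also contain a. Connectedness in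
  the plane thus yields statements about triangles without explicit paths of triangles.\<close>

lemma connected_constant:
  fixes h :: "tri \<Rightarrow> 'a"
  assumes conn: "connected Q"
    and e: "\<And>z T c. z \<in> Q \<Longrightarrow> z \<in> edge_segment (edge c T) \<Longrightarrow> h (nbr c T) = h T"
    and z: "z \<in> Q" "z \<in> ctri T" and w: "w \<in> Q" "w \<in> ctri T'"
  shows "h T = h T'"
proof -
  have "h (canon z) = h (canon w)"
  proof (rule connected_local_const[OF conn z(1) w(1)])
    show "\<forall>a\<in>Q. \<forall>\<^sub>F b in at a within Q. h (canon a) = h (canon b)"
    proof
      fix a assume a: "a \<in> Q"
      obtain \<epsilon> where eps: "\<epsilon> > 0" "\<And>b T. b \<in> ball a \<epsilon> \<Longrightarrow> b \<in> ctri T \<Longrightarrow> a \<in> ctri T"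
        using nearby_triangles[of a] by blast
      have "h (canon a) = h (canon b)" if "b \<in> ball a \<epsilon>" for b
      proof -
        have "a \<in> ctri (canon b)" using eps(2)[OF that canon_mem] .
        then show ?thesis using canon_constant[of a h "canon b"] e[OF a] by simp
      qed
      then show "\<forall>\<^sub>F b in at a within Q. h (canon a) = h (canon b)"
        unfolding eventually_at using eps(1) by (intro exI[of _ \<epsilon>]) (auto simp: dist_commute)
    qed
  qed
  then show ?thesis using canon_constant[of z h T] canon_constant[of w h T'] e z w by simp
qed

text \<open>Integrate \<omega> along the rows, starting from the far right where it vanishes. The
  rows are linked by the Blue edges; closedness around vertices makes the defect \<open>d\<close>
  there independent of the column, and far right it is zero. The group is general because both
  \<open>int\<close> and \<open>bit\<close> occur.\<close>

lemma discrete_poincare: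
  fixes \<omega> :: "tri \<Rightarrow> colour \<Rightarrow> 'a :: ab_group_add"
  assumes anti: "\<And>T c. \<omega> (nbr c T) c = - \<omega> T c"
    and closed: "\<And>i j. \<omega> (Tri i j True) Blue + \<omega> (Tri i (j - 1) False) Red + \<omega> (Tri i (j - 1) True) Green
      + \<omega> (Tri (i - 1) (j - 1) False) Blue + \<omega> (Tri (i - 1) j True) Red + \<omega> (Tri (i - 1) j False) Green = 0"
    and fin: "finite {T. \<exists>c. \<omega> T c \<noteq> 0}"
  shows "\<exists>h M. (\<forall>T c. h (nbr c T) = h T + \<omega> T c) \<and> (\<forall>i j u. M < i \<longrightarrow> h (Tri i j u) = 0)"
proof -
  define M where "M = Max (insert 0 (tcol ` {T. \<exists>c. \<omega> T c \<noteq> 0}))"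
  have far: "\<omega> (Tri i j u) c = 0" if "M < i" for i j u c
  proof (rule ccontr)
    assume "\<omega> (Tri i j u) c \<noteq> 0"
    then have "i \<in> tcol ` {T. \<exists>c. \<omega> T c \<noteq> 0}" by (intro image_eqI[of _ _ "Tri i j u"]) auto
    then have "i \<le> M" unfolding M_def using fin by (intro Max_ge) auto
    then show False using that by simp
  qed
  define r where "r k j = \<omega> (Tri k j True) Red + \<omega> (Tri k j False) Green" for k j
  define h where "h T = - (\<Sum>k\<in>{tcol T..M}. r k (trow T)) + (if upward T then 0 else \<omega> (Tri (tcol T) (trow T) True) Red)" for T
  have red: "h (Tri i j False) = h (Tri i j True) + \<omega> (Tri i j True) Red" for i j
    by (simp add: h_def)
  have green: "h (Tri (i + 1) j True) = h (Tri i j False) + \<omega> (Tri i j False) Green" for i j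
  proof (cases "i \<le> M")
    case True
    then have "{i..M} = insert i {i + 1..M}" by auto
    then have "(\<Sum>k\<in>{i..M}. r k j) = r i j + (\<Sum>k\<in>{i + 1..M}. r k j)" by simp
    then show ?thesis by (simp add: h_def r_def algebra_simps)
  next
    case False
    then show ?thesis using far[of i] by (simp add: h_def)
  qed
  have right: "h (Tri i j u) = 0" if "M < i" for i j u
    using that far[OF that] by (simp add: h_def)
  have blue: "h (Tri i (j - 1) False) = h (Tri i j True) + \<omega> (Tri i j True) Blue" for i j
  proof -
    define d where "d i = h (Tri i (j - 1) False) - h (Tri i j True) - \<omega> (Tri i j True) Blue" for i
    have step: "d (i - 1) = d i" for i
    proof -
      have 1: "h (Tri (i - 1) (j - 1) False) = h (Tri i (j - 1) False) - \<omega> (Tri i (j - 1) True) Red - \<omega> (Tri (i - 1) (j - 1) False) Green"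
        using red[of i "j - 1"] green[of "i - 1" "j - 1"] by (simp add: algebra_simps)
      have 2: "h (Tri (i - 1) j True) = h (Tri i j True) - \<omega> (Tri (i - 1) j True) Red - \<omega> (Tri (i - 1) j False) Green"
        using red[of "i - 1" j] green[of "i - 1" j] by (simp add: algebra_simps)
      have a1: "\<omega> (Tri i (j - 1) False) Red = - \<omega> (Tri i (j - 1) True) Red"
        using anti[of Red "Tri i (j - 1) True"] by simp
      have a2: "\<omega> (Tri (i - 1) (j - 1) False) Green = - \<omega> (Tri i (j - 1) True) Green"
        using anti[of Green "Tri i (j - 1) True"] by simp
      have a3: "\<omega> (Tri (i - 1) (j - 1) False) Blue = - \<omega> (Tri (i - 1) j True) Blue"
        using anti[of Blue "Tri (i - 1) j True"] by simp
      have "d (i - 1) - d i = \<omega> (Tri i j True) Blue + \<omega> (Tri i (j - 1) False) Red + \<omega> (Tri i (j - 1) True) Green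
      + \<omega> (Tri (i - 1) (j - 1) False) Blue + \<omega> (Tri (i - 1) j True) Red + \<omega> (Tri (i - 1) j False) Green"
        unfolding d_def 1 2 a1 a2 a3 by (simp add: algebra_simps)
      then show ?thesis using closed[of i j] by simp
    qed
    have "d i = d (i + int n)" for n
    proof (induction n)
      case (Suc n)
      then show ?case using step[of "i + int (Suc n)"] by (simp add: algebra_simps)
    qed simp
    from this[of "nat (M + 1 - i)"] have "d i = d (max i (M + 1))"
      by (cases "i \<le> M + 1") (auto simp: max_def)
    also have "\<dots> = 0" unfolding d_def using right far by simp
    finally show ?thesis by (simp add: d_def algebra_simps)
  qed
  have up: "h (nbr c (Tri i j True)) = h (Tri i j True) + \<omega> (Tri i j True) c" for c i j
  proof (cases c)
    case Green
    then show ?thesis using green[of "i - 1" j] anti[of Green "Tri i j True"] by (simp add: algebra_simps)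
  qed (use red blue in simp_all)
  have "h (nbr c T) = h T + \<omega> T c" for T c
  proof (cases "upward T")
    case True
    then show ?thesis using up by (cases T) simp
  next
    case False
    then obtain i j where n: "nbr c T = Tri i j True" by (cases "nbr c T") (metis upward_nbr tri.sel(3))
    have "h T = h (nbr c T) + \<omega> (nbr c T) c" using up[of c i j] n by (metis nbr_nbr)
    then show ?thesis using anti[of c T] by (simp add: algebra_simps)
  qed
  then show ?thesis using right by blast
qed

lemma arc_inj: "src c T = src c' T' \<Longrightarrow> tgt c T = tgt c' T' \<Longrightarrow> c = c' \<and> T = T'"
  by (cases T; cases T'; cases c; cases c') (auto split: if_splits)

lemma edge_eqD:
  assumes "edge c T = edge c' T'"
  shows "c' = c \<and> (T' = T \<or> T' = nbr c T)"
proof -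
  have "src c T = src c' T' \<and> tgt c T = tgt c' T' \<or> src c T = tgt c' T' \<and> tgt c T = src c' T'"
    using assms by (auto simp: edge_def doubleton_eq_iff)
  then show ?thesis
  proof
    assume "src c T = tgt c' T' \<and> tgt c T = src c' T'"
    then have "c = c' \<and> T = nbr c' T'" using arc_inj[of c T c' "nbr c' T'"] by simp
    then show ?thesis by simp
  qed (use arc_inj in blast)
qed

lemma arc_of_edge:
  assumes "{u, v} \<in> lattice_edges"
  obtains c T where "u = src c T" "v = tgt c T"
proof -
  obtain c i j where "{u, v} = edge c (Tri i j True)" using assms by (rule lattice_edgeE)
  then consider "u = src c (Tri i j True)" "v = tgt c (Tri i j True)" | "v = src c (Tri i j True)" "u = tgt c (Tri i j True)"
    by (auto simp: edge_def doubleton_eq_iff)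
  then show thesis
  proof cases
    case 2
    then show thesis using that[of c "nbr c (Tri i j True)"] by (simp del: nbr.simps src.simps tgt.simps)
  qed (rule that)
qed

definition star :: "vertex \<Rightarrow> vertex set" where
  "star v = (case v of (i, j) \<Rightarrow> {(i + 1, j), (i + 1, j - 1), (i, j - 1), (i - 1, j), (i - 1, j + 1), (i, j + 1)})"

lemma star_tgt: "tgt c T \<in> star (src c T)"
  by (cases T; cases c) (auto simp: star_def)

lemma star_nbrs: "{u, v} \<in> lattice_edges \<Longrightarrow> u \<in> star v \<and> v \<in> star u"
proof -
  assume "{u, v} \<in> lattice_edges"
  then obtain c T where "u = src c T" "v = tgt c T" by (rule arc_of_edge)
  then show ?thesis using star_tgt[of c T] star_tgt[of c "nbr c T"] by simp
qed

lemma sum_star: "(\<Sum>w\<in>star (i, j). F w) = F (i + 1, j) + F (i + 1, j - 1) + F (i, j - 1) + F (i - 1, j)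
    + F (i - 1, j + 1) + F (i, j + 1)" for F :: "vertex \<Rightarrow> 'a :: comm_monoid_add"
  by (simp add: star_def add.assoc)

lemma finite_star [simp]: "finite (star v)"
  by (cases v) (simp add: star_def)

lemma finite_src: "finite V \<Longrightarrow> finite {T. src c T \<in> V}"
proof (rule finite_subset)
  let ?D = "{0, 1 :: int}"
  show "{T. src c T \<in> V} \<subseteq> (\<lambda>(v, a, b, u). Tri (fst v - a) (snd v - b) u) ` (V \<times> ?D \<times> ?D \<times> UNIV)"
  proof
    fix T assume T: "T \<in> {T. src c T \<in> V}"
    have "\<exists>a b. a \<in> ?D \<and> b \<in> ?D \<and> T = Tri (fst (src c T) - a) (snd (src c T) - b) (upward T)"
      by (cases T; cases c) (auto split: if_splits)
    then show "T \<in> (\<lambda>(v, a, b, u). Tri (fst v - a) (snd v - b) u) ` (V \<times> ?D \<times> ?D \<times> UNIV)"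
      using T by (force intro!: image_eqI)
  qed
qed auto

text \<open>The intended change of height on crossing the edge out of \<open>T\<close>: 1 if the arc
  in \<open>X\<close> has the triangle entered on its left, -1 if it has \<open>T\<close>
  there.\<close>

definition flow :: "(vertex \<times> vertex) set \<Rightarrow> tri \<Rightarrow> colour \<Rightarrow> int" where
  "flow X T c = of_bool ((tgt c T, src c T) \<in> X) - of_bool ((src c T, tgt c T) \<in> X)"

text \<open>One turn around a vertex crosses its six edges, each counted by whether its arc enters
  or leaves. Balance at the vertex is therefore closedness of the flow.\<close>

lemma star_flow:
  assumes lat: "\<And>u v. (u, v) \<in> X \<Longrightarrow> {u, v} \<in> lattice_edges"
  shows "flow X (Tri i j True) Blue + flow X (Tri i (j - 1) False) Red + flow X (Tri i (j - 1) True) Green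
      + flow X (Tri (i - 1) (j - 1) False) Blue + flow X (Tri (i - 1) j True) Red + flow X (Tri (i - 1) j False) Green
    = int (card {u. (u, (i, j)) \<in> X}) - int (card {w. ((i, j), w) \<in> X})"
proof -
  define v where "v = (i, j)"
  have inc: "{u. (u, v) \<in> X} = {u \<in> star v. (u, v) \<in> X}" using lat star_nbrs by blast
  have outc: "{w. (v, w) \<in> X} = {w \<in> star v. (v, w) \<in> X}" using lat star_nbrs by blast
  have "int (card {u. (u, v) \<in> X}) = (\<Sum>u\<in>star v. of_bool ((u, v) \<in> X))"
    unfolding inc by (simp add: of_bool_def sum.If_cases Int_def)
  moreover have "int (card {w. (v, w) \<in> X}) = (\<Sum>u\<in>star v. of_bool ((v, u) \<in> X))"
    unfolding outc by (simp add: of_bool_def sum.If_cases Int_def)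
  ultimately have "int (card {u. (u, v) \<in> X}) - int (card {w. (v, w) \<in> X})
      = (\<Sum>u\<in>star v. of_bool ((u, v) \<in> X) - of_bool ((v, u) \<in> X))"
    by (simp add: sum_subtractf)
  then show ?thesis unfolding v_def sum_star by (simp add: flow_def)
qed

lemma flow_potential:
  assumes fin: "finite X" and lat: "\<And>u v. (u, v) \<in> X \<Longrightarrow> {u, v} \<in> lattice_edges"
    and bal: "\<And>v. card {u. (u, v) \<in> X} = card {w. (v, w) \<in> X}"
  shows "\<exists>h M. (\<forall>T c. h (nbr c T) = h T + flow X T c) \<and> (\<forall>i j u. M < i \<longrightarrow> h (Tri i j u) = 0)"
proof (rule discrete_poincare)
  show "flow X (nbr c T) c = - flow X T c" for T c
    by (simp add: flow_def)
  have "{T. flow X T c \<noteq> 0} \<subseteq> {T. src c T \<in> fst ` X \<union> snd ` X}" for c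
  proof
    fix T assume "T \<in> {T. flow X T c \<noteq> 0}"
    then have "(tgt c T, src c T) \<in> X \<or> (src c T, tgt c T) \<in> X" by (auto simp: flow_def)
    then show "T \<in> {T. src c T \<in> fst ` X \<union> snd ` X}" by (metis (no_types, lifting) UnCI fst_conv imageI mem_Collect_eq snd_conv)
  qed
  then have "finite {T. flow X T c \<noteq> 0}" for c
    using fin finite_src[of "fst ` X \<union> snd ` X" c] finite_subset by (metis finite_UnI finite_imageI)
  then have "finite (\<Union>c. {T. flow X T c \<noteq> 0})" by simp
  moreover have "{T. \<exists>c. flow X T c \<noteq> 0} = (\<Union>c. {T. flow X T c \<noteq> 0})" by auto
  ultimately show "finite {T. \<exists>c. flow X T c \<noteq> 0}" by simp
next
  fix i j :: int
  show "flow X (Tri i j True) Blue + flow X (Tri i (j - 1) False) Red + flow X (Tri i (j - 1) True) Green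
      + flow X (Tri (i - 1) (j - 1) False) Blue + flow X (Tri (i - 1) j True) Red + flow X (Tri (i - 1) j False) Green = 0"
    using star_flow[OF lat, of X i j] bal[of "(i, j)"] by simp
qed

lemma card_successors:
  assumes "distinct xs" "length ys = length xs"
  shows "card {w. (v, w) \<in> set (zip xs ys)} = of_bool (v \<in> set xs)"
proof (cases "v \<in> set xs")
  case True
  then obtain k where k: "k < length xs" "xs ! k = v" by (auto simp: in_set_conv_nth)
  have "{w. (v, w) \<in> set (zip xs ys)} = {ys ! k}"
    using k assms by (auto simp: set_zip nth_eq_iff_index_eq)
  then show ?thesis using True by simp
next
  case False
  then have "{w. (v, w) \<in> set (zip xs ys)} = {}" by (auto dest: set_zip_leftD)
  then show ?thesis using False by simp
qed

lemma cycle_arcs_balanced: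
  assumes "distinct vs"
  shows "card {u. (u, v) \<in> cycle_arcs vs} = card {w. (v, w) \<in> cycle_arcs vs}"
proof -
  have "card {w. (v, w) \<in> set (zip vs (rotate1 vs))} = of_bool (v \<in> set vs)"
    using assms by (intro card_successors) auto
  moreover have "{u. (u, v) \<in> set (zip vs (rotate1 vs))} = {u. (v, u) \<in> set (zip (rotate1 vs) vs)}"
    by (auto simp: set_zip)
  moreover have "card {u. (v, u) \<in> set (zip (rotate1 vs) vs)} = of_bool (v \<in> set (rotate1 vs))"
    using assms by (intro card_successors) auto
  ultimately show ?thesis by (simp add: cycle_arcs_def)
qed

lemma cycle_arcs_nth:
  "cycle_arcs vs = {(vs ! k, vs ! (Suc k mod length vs)) | k. k < length vs}"
  by (auto simp: cycle_arcs_def set_zip nth_rotate1)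

lemma cycle_arcs_antisym:
  assumes "distinct vs" "3 \<le> length vs" "(u, v) \<in> cycle_arcs vs"
  shows "(v, u) \<notin> cycle_arcs vs"
proof
  assume "(v, u) \<in> cycle_arcs vs"
  define n where "n = length vs"
  have n: "3 \<le> n" using assms by (simp add: n_def)
  obtain k where k: "k < n" "u = vs ! k" "v = vs ! (Suc k mod n)" using assms(3) by (auto simp: cycle_arcs_nth n_def)
  obtain l where l: "l < n" "v = vs ! l" "u = vs ! (Suc l mod n)" using \<open>(v, u) \<in> cycle_arcs vs\<close> by (auto simp: cycle_arcs_nth n_def)
  have "vs ! l = vs ! (Suc k mod n)" "vs ! k = vs ! (Suc l mod n)" using k l by simp_all
  then have "l = Suc k mod n" "k = Suc l mod n"
    using k(1) l(1) n nth_eq_iff_index_eq[OF assms(1), folded n_def, of l "Suc k mod n"]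
      nth_eq_iff_index_eq[OF assms(1), folded n_def, of k "Suc l mod n"] by simp_all
  moreover have "Suc m mod n = (if Suc m = n then 0 else Suc m)" if "m < n" for m
    using that by (simp add: mod_Suc)
  ultimately have "l = (if Suc k = n then 0 else Suc k)" "k = (if Suc l = n then 0 else Suc l)"
    using k(1) l(1) by metis+
  then show False using n by presburger
qed

definition mid :: "colour \<Rightarrow> tri \<Rightarrow> complex" where
  "mid c T = midpoint (embed (src c T)) (embed (tgt c T))"

lemma mid_nbr [simp]: "mid c (nbr c T) = mid c T"
  by (simp add: mid_def midpoint_sym)

lemma px_mid: "px (mid c T) = (fst (src c T) + fst (tgt c T)) / 2"
  and py_mid: "py (mid c T) = (snd (src c T) + snd (tgt c T)) / 2"
  by (simp_all add: mid_def midpoint_def)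

lemma edge_segment_subset_ctri: "edge_segment (edge c T) \<subseteq> ctri T"
proof -
  have up: "edge_segment (edge c (Tri i j True)) \<subseteq> ctri (Tri i j True) \<inter> ctri (nbr c (Tri i j True))" for i j
    by (auto simp: edge_segment_iff split: colour.splits)
  show ?thesis
  proof (cases "upward T")
    case True
    then show ?thesis using up by (cases T) auto
  next
    case False
    then obtain i j where n: "nbr c T = Tri i j True" by (cases "nbr c T") (metis upward_nbr tri.sel(3))
    then have "edge c T = edge c (Tri i j True)" "T = nbr c (Tri i j True)" by (metis edge_nbr, metis nbr_nbr)
    then show ?thesis using up[of i j] by simp
  qed
qed

lemma mid_in_segment: "mid c T \<in> edge_segment (edge c T)"
  by (simp add: mid_def edge_segment_def edge_def segment_convex_hull[symmetric])

lemma half_le: "real_of_int a \<le> (2 * real_of_int i + 1) / 2 \<longleftrightarrow> a \<le> i"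
  and half_ge: "(2 * real_of_int i + 1) / 2 \<le> real_of_int a \<longleftrightarrow> i < a"
proof -
  have "real_of_int a \<le> (2 * real_of_int i + 1) / 2 \<longleftrightarrow> real_of_int (2 * a) \<le> real_of_int (2 * i + 1)" by auto
  also have "\<dots> \<longleftrightarrow> a \<le> i" unfolding of_int_le_iff by presburger
  finally show "real_of_int a \<le> (2 * real_of_int i + 1) / 2 \<longleftrightarrow> a \<le> i" .
  have "(2 * real_of_int i + 1) / 2 \<le> real_of_int a \<longleftrightarrow> real_of_int (2 * i + 1) \<le> real_of_int (2 * a)" by auto
  also have "\<dots> \<longleftrightarrow> i < a" unfolding of_int_le_iff by presburger
  finally show "(2 * real_of_int i + 1) / 2 \<le> real_of_int a \<longleftrightarrow> i < a" .
qed

text \<open>This makes a single point of the plane identify an edge. The coordinates of a midpoint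
  are integers or half-integers, which reduces the inequalities to integer ones.\<close>

lemma mid_in_ctri:
  assumes "mid c T \<in> ctri T'"
  shows "T' = T \<or> T' = nbr c T"
proof -
  have up: "T' = Tri i j True \<or> T' = nbr c (Tri i j True)" if m: "mid c (Tri i j True) \<in> ctri T'" for i j
  proof -
    obtain a b u where T': "T' = Tri a b u" by (cases T')
    have s2: "(2 * real_of_int i + 1) / 2 + real_of_int j = (2 * real_of_int (i + j) + 1) / 2"
      and s3: "real_of_int i + (2 * real_of_int j + 1) / 2 = (2 * real_of_int (i + j) + 1) / 2" by (simp_all add: field_simps)
    have p1: "px (mid c (Tri i j True)) = (case c of Red \<Rightarrow> (2 * real_of_int i + 1) / 2 | Green \<Rightarrow> real_of_int i | Blue \<Rightarrow> (2 * real_of_int i + 1) / 2)"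
      and p2: "py (mid c (Tri i j True)) = (case c of Red \<Rightarrow> (2 * real_of_int j + 1) / 2 | Green \<Rightarrow> (2 * real_of_int j + 1) / 2 | Blue \<Rightarrow> real_of_int j)"
      by (cases c; simp add: px_mid py_mid)+
    have gen: "real_of_int a \<le> px w" "px w \<le> real_of_int (a + 1)" "real_of_int b \<le> py w" "py w \<le> real_of_int (b + 1)"
      "u \<Longrightarrow> px w + py w \<le> real_of_int (a + b + 1)" "\<not> u \<Longrightarrow> real_of_int (a + b + 1) \<le> px w + py w"
      if "w \<in> ctri (Tri a b u)" for w using that ctri_box[OF that] by auto
    note box = gen[OF m[unfolded T']]
    show ?thesis
    proof (cases c)
      case Red
      have "a = i" "b = j" using box(1-4)[unfolded p1 p2] unfolding Red colour.case half_le half_ge by auto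
      then show ?thesis using Red T' by (cases u) auto
    next
      case Green
      have bj: "b = j" using box(3,4)[unfolded p1 p2] unfolding Green colour.case half_le half_ge by auto
      have "a \<le> i" "i \<le> a + 1" using box(1,2)[unfolded p1 p2] unfolding Green colour.case of_int_le_iff by auto
      moreover have "u \<Longrightarrow> i + j < a + b + 1" using box(5)[unfolded p1 p2] unfolding Green colour.case s3 half_ge by auto
      moreover have "\<not> u \<Longrightarrow> a + b + 1 \<le> i + j" using box(6)[unfolded p1 p2] unfolding Green colour.case s3 half_le by auto
      ultimately show ?thesis using Green T' bj by (cases u) auto
    next
      case Blue
      have ai: "a = i" using box(1,2)[unfolded p1 p2] unfolding Blue colour.case half_le half_ge by auto
      have "b \<le> j" "j \<le> b + 1" using box(3,4)[unfolded p1 p2] unfolding Blue colour.case of_int_le_iff by auto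
      moreover have "u \<Longrightarrow> i + j < a + b + 1" using box(5)[unfolded p1 p2] unfolding Blue colour.case s2 half_ge by auto
      moreover have "\<not> u \<Longrightarrow> a + b + 1 \<le> i + j" using box(6)[unfolded p1 p2] unfolding Blue colour.case s2 half_le by auto
      ultimately show ?thesis using Blue T' ai by (cases u) auto
    qed
  qed
  show ?thesis
  proof (cases "upward T")
    case True
    then show ?thesis using up assms by (cases T) auto
  next
    case False
    then obtain i j where n: "nbr c T = Tri i j True" by (cases "nbr c T") (metis upward_nbr tri.sel(3))
    then have "mid c (Tri i j True) \<in> ctri T'" using assms by (metis mid_nbr)
    from up[OF this] show ?thesis using n by (metis nbr_nbr)
  qed
qed

lemma mid_in_edge:
  assumes "mid c T \<in> edge_segment (edge c' T')"
  shows "edge c' T' = edge c T"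
proof -
  have "mid c T \<in> ctri T'" "mid c T \<in> ctri (nbr c' T')"
    using assms edge_segment_subset_ctri[of c' T'] edge_segment_subset_ctri[of c' "nbr c' T'"] by auto
  then have 1: "T' = T \<or> T' = nbr c T" and 2: "nbr c' T' = T \<or> nbr c' T' = nbr c T"
    using mid_in_ctri by blast+
  then have "c' = c" by (metis nbr_eq_nbr nbr_neq(1) nbr_nbr)
  then show ?thesis using 1 by auto
qed

lemma otri_disjoint_edge: "otri T \<inter> edge_segment (edge c T') = {}"
proof -
  have up: "otri T \<inter> edge_segment (edge c (Tri a b True)) = {}" for a b
  proof (rule ccontr)
    assume "otri T \<inter> edge_segment (edge c (Tri a b True)) \<noteq> {}"
    then obtain z where z: "z \<in> otri T" "z \<in> edge_segment (edge c (Tri a b True))" by blast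
    obtain i j u where T: "T = Tri i j u" by (cases T)
    have no: "\<not> (real_of_int m < real_of_int n \<and> real_of_int n < real_of_int m + 1)" for m n :: int by auto
    have "real_of_int i < px z \<and> px z < real_of_int i + 1" "real_of_int j < py z \<and> py z < real_of_int j + 1"
      "(real_of_int (i + j) < px z + py z \<and> px z + py z < real_of_int (i + j) + 1) \<or>
       (real_of_int (i + j + 1) < px z + py z \<and> px z + py z < real_of_int (i + j + 1) + 1)"
      using z(1) T by (auto split: if_splits)
    moreover have "px z = real_of_int a \<or> py z = real_of_int b \<or> px z + py z = real_of_int (a + b + 1)"
      using z(2) by (auto simp: edge_segment_iff split: colour.splits)
    ultimately show False using no by metis
  qed
  show ?thesis
  proof (cases "upward T'")
    case True
    then show ?thesis using up by (cases T') auto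
  next
    case False
    then obtain i j where n: "nbr c T' = Tri i j True" by (cases "nbr c T'") (metis upward_nbr tri.sel(3))
    then have "edge c T' = edge c (Tri i j True)" by (metis edge_nbr)
    then show ?thesis using up by simp
  qed
qed

text \<open>Applied to the predicate that singles out \<open>T\<close>,
  \<open>canon_constant\<close> shows that every closed triangle containing a point interior to
  \<open>T\<close> is \<open>T\<close>.\<close>

lemma otri_inj: "otri T \<inter> ctri T' \<noteq> {} \<Longrightarrow> T = T'"
proof -
  assume "otri T \<inter> ctri T' \<noteq> {}"
  then obtain z where z: "z \<in> otri T" "z \<in> ctri T'" by blast
  have off: "\<And>U c. z \<in> edge_segment (edge c U) \<Longrightarrow> (nbr c U = T) = (U = T)"
    using otri_disjoint_edge z(1) by blast
  have "(T = T) = (canon z = T)"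
    using canon_constant[of z "\<lambda>U. U = T" T] off otri_subset_ctri z(1) by blast
  moreover have "(T' = T) = (canon z = T)"
    using canon_constant[of z "\<lambda>U. U = T" T'] off z(2) by blast
  ultimately show ?thesis by simp
qed

section \<open>Solid subgraphs\<close>

locale solid =
  fixes vs :: "vertex list"
  assumes cycle: "lattice_cycle vs"
begin

abbreviation "C \<equiv> cycle_curve vs"
abbreviation "G \<equiv> solid_graph vs"

definition S :: "tri set" where "S = {T. otri T \<subseteq> inside C}"

lemma verts_G: "v \<in> verts G \<longleftrightarrow> embed v \<in> C \<union> inside C"
  by (simp add: solid_graph_def Let_def)

lemma edges_G: "e \<in> edges G \<longleftrightarrow> e \<in> lattice_edges \<and> edge_segment e \<subseteq> C \<union> inside C"
  by (simp add: solid_graph_def Let_def)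

lemma distinct_vs: "distinct vs" "3 \<le> length vs"
  and cycle_arc_lattice: "(u, v) \<in> cycle_arcs vs \<Longrightarrow> {u, v} \<in> lattice_edges"
  using cycle by (auto simp: lattice_cycle_def)

lemma finite_cycle_arcs: "finite (cycle_arcs vs)"
  by (simp add: cycle_arcs_def)

lemma compact_C: "compact C"
  unfolding cycle_curve_def
  by (intro compact_UN finite_cycle_arcs)
    (auto simp: edge_segment_def segment_convex_hull[symmetric])

lemma closed_C: "closed C" and bounded_C: "bounded C"
  using compact_C compact_imp_closed compact_imp_bounded by auto

lemma bounded_region: "bounded (C \<union> inside C)"
  using bounded_C bounded_inside by auto

lemma in_C:
  assumes "z \<in> C"
  obtains u v c T where "(u, v) \<in> cycle_arcs vs" "u = src c T" "v = tgt c T" "z \<in> edge_segment (edge c T)"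
proof -
  obtain u v where uv: "(u, v) \<in> cycle_arcs vs" "z \<in> edge_segment {u, v}"
    using assms unfolding cycle_curve_def by auto
  obtain c T where "u = src c T" "v = tgt c T" using arc_of_edge[OF cycle_arc_lattice[OF uv(1)]] .
  then show thesis using that uv by (simp add: edge_def)
qed

lemma cycle_arc_in_C: "(src c T, tgt c T) \<in> cycle_arcs vs \<Longrightarrow> edge_segment (edge c T) \<subseteq> C"
  unfolding cycle_curve_def edge_def by auto

lemma otri_disjoint_C: "otri T \<inter> C = {}"
proof (rule ccontr)
  assume "otri T \<inter> C \<noteq> {}"
  then obtain z where "z \<in> otri T" "z \<in> C" by blast
  then show False using in_C otri_disjoint_edge by (metis disjoint_iff)
qed

lemma S_meets: "otri T \<inter> inside C \<noteq> {} \<Longrightarrow> T \<in> S"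
proof -
  assume "otri T \<inter> inside C \<noteq> {}"
  then obtain z where z: "z \<in> otri T" "z \<in> inside C" by blast
  have "w \<in> inside C" if "w \<in> otri T" for w
  proof (rule inside_same_component[OF _ z(2)])
    show "connected_component (- C) z w"
      using convex_connected[OF convex_otri] otri_disjoint_C[of T] z(1) that
      unfolding connected_component_def by (intro exI[of _ "otri T"]) auto
  qed
  then show ?thesis by (auto simp: S_def)
qed

lemma not_S_outside: "T \<notin> S \<Longrightarrow> \<exists>z. z \<in> otri T \<and> z \<in> outside C"
proof -
  assume "T \<notin> S"
  then have "centroid T \<notin> inside C" using S_meets[of T] centroid_otri[of T] by blast
  moreover have "centroid T \<notin> C" using otri_disjoint_C[of T] centroid_otri[of T] by blast
  ultimately show ?thesis using centroid_otri[of T] inside_Un_outside[of C] by blast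
qed

lemma ctri_in_region: "T \<in> S \<Longrightarrow> ctri T \<subseteq> C \<union> inside C"
proof -
  assume "T \<in> S"
  then have "closure (otri T) \<subseteq> closure (inside C)" by (intro closure_mono) (simp add: S_def)
  then show ?thesis using closure_inside_subset[OF closed_C] closure_otri by blast
qed

lemma finite_S: "finite S"
proof (rule finite_subset[OF _ finite_meeting[OF bounded_inside[OF bounded_C]]])
  show "S \<subseteq> {T. ctri T \<inter> inside C \<noteq> {}}"
    using centroid_otri otri_subset_ctri unfolding S_def by blast
qed

text \<open>The outside of a bounded plane set is connected and reaches the far right, so the value
  there spreads to every triangle that is not inside the cycle.\<close>

lemma outside_constant:
  fixes h :: "tri \<Rightarrow> 'a"
  assumes e: "\<And>z T c. z \<in> outside C \<Longrightarrow> z \<in> edge_segment (edge c T) \<Longrightarrow> h (nbr c T) = h T"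
    and far: "\<And>i j u. M < i \<Longrightarrow> h (Tri i j u) = v0" and T: "T \<notin> S"
  shows "h T = v0"
proof -
  obtain B where B: "\<And>z. z \<in> C \<union> inside C \<Longrightarrow> norm z \<le> B" using bounded_region by (auto simp: bounded_iff)
  define w where "w = of_coords (max (2 * B) (real_of_int M) + 2) 0"
  have "w \<in> outside C"
  proof (rule ccontr)
    assume "w \<notin> outside C"
    then have "w \<in> C \<union> inside C" by (simp add: union_with_inside)
    then have "norm w \<le> B" using B by blast
    then show False using abs_px_le[of w] by (simp add: w_def)
  qed
  moreover have "real_of_int (M + 1) \<le> px w" by (simp add: w_def)
  then have "M + 1 \<le> \<lfloor>px w\<rfloor>" by (simp only: le_floor_iff)
  then have "M < tcol (canon w)" by (simp add: canon_def)
  then have "h (canon w) = v0" using far by (metis tri.collapse)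
  moreover obtain z where "z \<in> outside C" "z \<in> ctri T"
    using not_S_outside[OF T] otri_subset_ctri by blast
  moreover have "connected (outside C)" using bounded_C by (intro connected_outside) simp_all
  ultimately show ?thesis using connected_constant[of "outside C" h z T w "canon w"] e canon_mem by metis
qed

text \<open>The cycle is itself a balanced set of arcs, and its potential is a discrete winding
  number: zero outside, with a jump of 1 across every cycle edge. Hence the two sides of such an
  edge cannot both be outside.\<close>

lemma cycle_edge_borders_S:
  assumes "(src c T, tgt c T) \<in> cycle_arcs vs"
  shows "T \<in> S \<or> nbr c T \<in> S"
proof (rule ccontr)
  assume no: "\<not> (T \<in> S \<or> nbr c T \<in> S)"
  let ?X = "cycle_arcs vs"
  obtain h M where h: "\<And>T c. h (nbr c T) = h T + flow ?X T c" and far: "\<And>i j u. M < i \<Longrightarrow> h (Tri i j u) = 0"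
    using flow_potential[OF finite_cycle_arcs cycle_arc_lattice cycle_arcs_balanced[OF distinct_vs(1)]] by blast
  have "h (nbr c T) = h T" if z: "z \<in> outside C" "z \<in> edge_segment (edge c T)" for z T c
  proof -
    have "z \<notin> C" using z(1) outside_no_overlap by blast
    then have "(src c T, tgt c T) \<notin> ?X" "(tgt c T, src c T) \<notin> ?X"
      using cycle_arc_in_C[of c T] cycle_arc_in_C[of c "nbr c T"] z(2) by auto
    then show ?thesis by (simp add: h flow_def)
  qed
  then have "h T = 0" "h (nbr c T) = 0" using outside_constant[of h M 0] far no by blast+
  moreover have "flow ?X T c = - 1"
    using assms cycle_arcs_antisym[OF distinct_vs assms] by (simp add: flow_def)
  ultimately show False using h[of c T] by simp
qed

lemma S_nonempty: "S \<noteq> {}"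
proof -
  have "vs \<noteq> []" using distinct_vs(2) by auto
  then have "(vs ! 0, vs ! (Suc 0 mod length vs)) \<in> cycle_arcs vs" unfolding cycle_arcs_nth by blast
  then obtain u v where uv: "(u, v) \<in> cycle_arcs vs" by blast
  obtain c T where "u = src c T" "v = tgt c T" using arc_of_edge[OF cycle_arc_lattice[OF uv]] .
  then show ?thesis using cycle_edge_borders_S uv by blast
qed

text \<open>Turns the topological definition of the graph into combinatorics. The midpoint decides:
  on the curve it identifies the edge as one of the cycle, and otherwise the open inside meets the
  adjacent triangle.\<close>

lemma edge_in_G: "edge c T \<in> edges G \<longleftrightarrow> T \<in> S \<or> nbr c T \<in> S"
proof
  assume "T \<in> S \<or> nbr c T \<in> S"
  then have "edge_segment (edge c T) \<subseteq> C \<union> inside C"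
    using edge_segment_subset_ctri[of c T] edge_segment_subset_ctri[of c "nbr c T"] ctri_in_region by auto
  then show "edge c T \<in> edges G" by (simp add: edges_G edge_in_lattice)
next
  assume "edge c T \<in> edges G"
  then have m: "mid c T \<in> C \<union> inside C" using mid_in_segment[of c T] by (auto simp: edges_G)
  show "T \<in> S \<or> nbr c T \<in> S"
  proof (cases "mid c T \<in> C")
    case True
    then obtain u v c' T' where *: "(u, v) \<in> cycle_arcs vs" "u = src c' T'" "v = tgt c' T'" "mid c T \<in> edge_segment (edge c' T')"
      by (rule in_C)
    have "edge c' T' = edge c T" using mid_in_edge[OF *(4)] .
    then have "c' = c \<and> (T' = T \<or> T' = nbr c T)" using edge_eqD[of c T c' T'] by simp
    moreover have "T' \<in> S \<or> nbr c' T' \<in> S" using cycle_edge_borders_S * by simp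
    ultimately show ?thesis by auto
  next
    case False
    then have "mid c T \<in> inside C" using m by blast
    moreover have "mid c T \<in> closure (otri T)"
      unfolding closure_otri using mid_in_segment edge_segment_subset_ctri by blast
    ultimately have "otri T \<inter> inside C \<noteq> {}"
      using open_inside[OF closed_C] by (metis Int_commute disjoint_iff open_Int_closure_eq_empty)
    then show ?thesis using S_meets by blast
  qed
qed

lemma G_arc:
  assumes "{u, v} \<in> edges G"
  obtains c T where "u = src c T" "v = tgt c T" "T \<in> S \<or> nbr c T \<in> S"
proof -
  have "{u, v} \<in> lattice_edges" using assms by (simp add: edges_G)
  then obtain c T where "u = src c T" "v = tgt c T" by (rule arc_of_edge)
  then show thesis using that edge_in_G[of c T] assms by (simp add: edge_def)
qed

lemma edge_endpoint: "e \<in> edges G \<Longrightarrow> v \<in> e \<Longrightarrow> v \<in> verts G"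
  unfolding verts_G edges_G edge_segment_def by (meson hull_inc imageI subsetD)

section \<open>Eulerian orientations as height functions\<close>

sublocale region S
  by unfold_locales (rule finite_S)

text \<open>The higher triangle lies to the left of an arc, as \<open>src\<close> and \<open>tgt\<close> run counterclockwise.\<close>

definition orient :: "(tri \<Rightarrow> int) \<Rightarrow> orientation" where
  "orient h = {(src c T, tgt c T) | c T. h T = h (nbr c T) + 1}"

lemma orient_arc: "(src c T, tgt c T) \<in> orient h \<longleftrightarrow> h T = h (nbr c T) + 1"
proof
  assume "(src c T, tgt c T) \<in> orient h"
  then obtain c' T' where "src c T = src c' T'" "tgt c T = tgt c' T'" "h T' = h (nbr c' T') + 1"
    unfolding orient_def by auto
  then show "h T = h (nbr c T) + 1" using arc_inj by metis
qed (auto simp: orient_def)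

lemma orient_arc_rev: "(tgt c T, src c T) \<in> orient h \<longleftrightarrow> h (nbr c T) = h T + 1"
  using orient_arc[of c "nbr c T" h] by simp

lemma orient_in_G:
  assumes h: "h \<in> heights" and uv: "(u, v) \<in> orient h"
  shows "{u, v} \<in> edges G"
proof -
  obtain c T where *: "u = src c T" "v = tgt c T" "h T = h (nbr c T) + 1" using uv unfolding orient_def by auto
  then have "T \<in> S \<or> nbr c T \<in> S" using heights_zero[OF h, of T] heights_zero[OF h, of "nbr c T"] by fastforce
  then show ?thesis using * edge_in_G[of c T] by (simp add: edge_def)
qed

lemma flow_orient:
  assumes h: "h \<in> heights"
  shows "flow (orient h) T c = h (nbr c T) - h T"
proof -
  have "h (nbr c T) = h T - 1 \<or> h (nbr c T) = h T \<or> h (nbr c T) = h T + 1"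
    using heights_lipschitz[OF h, of c T] by linarith
  then show ?thesis unfolding flow_def orient_arc orient_arc_rev by (elim disjE) simp_all
qed

lemma orient_EO:
  assumes h: "h \<in> heights"
  shows "orient h \<in> EO G"
  unfolding EO_def orientations_def
proof (intro CollectI conjI ballI allI impI)
  fix p assume "p \<in> orient h"
  then show "case p of (u, v) \<Rightarrow> {u, v} \<in> edges G" using orient_in_G[OF h] by (cases p) auto
next
  fix u v assume "{u, v} \<in> edges G"
  then obtain c T where *: "u = src c T" "v = tgt c T" "T \<in> S \<or> nbr c T \<in> S" by (rule G_arc)
  then have "h (nbr c T) = h T + 1 \<or> h (nbr c T) = h T - 1"
    using heights_step[OF h, of T c] heights_step[OF h, of "nbr c T" c] by auto
  then show "((u, v) \<in> orient h) \<noteq> ((v, u) \<in> orient h)"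
    unfolding *(1,2) orient_arc orient_arc_rev by presburger
next
  fix v :: vertex
  obtain i j where v: "v = (i, j)" by (cases v)
  have lat: "{a, b} \<in> lattice_edges" if "(a, b) \<in> orient h" for a b
    using orient_in_G[OF h that] by (simp add: edges_G)
  show "card {u. (u, v) \<in> orient h} = card {w. (v, w) \<in> orient h}"
    using star_flow[OF lat, of "orient h" i j] unfolding flow_orient[OF h] v by simp
qed

lemma finite_orientation: "X \<in> EO G \<Longrightarrow> X \<subseteq> (\<lambda>(c, T). (src c T, tgt c T)) ` (UNIV \<times> (S \<union> (\<Union>c. nbr c ` S)))"
proof
  fix p assume X: "X \<in> EO G" and p: "p \<in> X"
  obtain u v where uv: "p = (u, v)" by (cases p)
  then have "{u, v} \<in> edges G" using X p by (auto simp: EO_def orientations_def)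
  then obtain c T where "u = src c T" "v = tgt c T" "T \<in> S \<or> nbr c T \<in> S" by (rule G_arc)
  moreover from this have "T \<in> S \<union> (\<Union>c. nbr c ` S)" by (metis UNIV_I UN_I UnI1 UnI2 imageI nbr_nbr)
  ultimately show "p \<in> (\<lambda>(c, T). (src c T, tgt c T)) ` (UNIV \<times> (S \<union> (\<Union>c. nbr c ` S)))"
    using uv by (intro image_eqI[of _ _ "(c, T)"]) auto
qed

text \<open>The flow of a balanced orientation has an integer potential. No edge of the graph meets
  the outside of the cycle, so the potential is constant there, with the value 0 taken far
  right.\<close>

lemma EO_orient:
  assumes X: "X \<in> EO G"
  shows "\<exists>h\<in>heights. X = orient h"
proof -
  have XG: "{u, v} \<in> edges G" if "(u, v) \<in> X" for u v
    using X that by (auto simp: EO_def orientations_def)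
  have one: "((u, v) \<in> X) \<noteq> ((v, u) \<in> X)" if "{u, v} \<in> edges G" for u v
    using X that unfolding EO_def orientations_def by blast
  have fin: "finite X"
    by (rule finite_subset[OF finite_orientation[OF X]]) (simp add: finite_S)
  have bal: "card {u. (u, v) \<in> X} = card {w. (v, w) \<in> X}" for v
  proof (cases "v \<in> verts G")
    case True
    then show ?thesis using X by (simp add: EO_def)
  next
    case False
    then have none: "{u. (u, v) \<in> X} = {}" "{w. (v, w) \<in> X} = {}" using XG edge_endpoint by blast+
    show ?thesis by (simp only: none)
  qed
  have lat: "{u, v} \<in> lattice_edges" if "(u, v) \<in> X" for u v using XG[OF that] by (simp add: edges_G)
  obtain h M where h: "\<And>T c. h (nbr c T) = h T + flow X T c" and far: "\<And>i j u. M < i \<Longrightarrow> h (Tri i j u) = 0"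
    using flow_potential[OF fin lat bal] by blast
  have noedge: "flow X T c = 0" if "edge c T \<notin> edges G" for T c
    using that XG[of "src c T" "tgt c T"] XG[of "tgt c T" "src c T"]
    by (auto simp: flow_def edge_def insert_commute)
  have "h (nbr c T) = h T" if z: "z \<in> outside C" "z \<in> edge_segment (edge c T)" for z T c
  proof -
    have "z \<notin> C \<union> inside C" using z(1) by (simp add: union_with_inside)
    then have "edge c T \<notin> edges G" using z(2) by (auto simp: edges_G)
    then show ?thesis using noedge h by simp
  qed
  then have zero: "h T = 0" if "T \<notin> S" for T using outside_constant[of h M 0] far that by blast
  have unit: "flow X T c = (if (src c T, tgt c T) \<in> X then - 1 else 1)" if "edge c T \<in> edges G" for T c
    using one[of "src c T" "tgt c T"] that by (auto simp: flow_def edge_def)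
  have "h \<in> heights"
    unfolding heights_def
  proof (intro CollectI conjI allI impI ballI)
    fix T c assume "T \<in> S"
    then have "edge c T \<in> edges G" using edge_in_G by blast
    then show "\<bar>h (nbr c T) - h T\<bar> = 1" using unit[of c T] h[of c T] by (auto split: if_splits)
  qed (rule zero)
  moreover have "X = orient h"
  proof (intro set_eqI)
    fix p :: "vertex \<times> vertex"
    obtain u v where p: "p = (u, v)" by (cases p)
    show "p \<in> X \<longleftrightarrow> p \<in> orient h"
    proof
      assume pX: "p \<in> X"
      obtain c T where ct: "u = src c T" "v = tgt c T" using arc_of_edge[OF lat] pX p by blast
      then have "edge c T \<in> edges G" using XG pX p by (simp add: edge_def)
      then have "flow X T c = - 1" using unit ct pX p by simp
      then show "p \<in> orient h" using h[of c T] ct p by (simp add: orient_arc)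
    next
      assume "p \<in> orient h"
      then obtain c T where ct: "u = src c T" "v = tgt c T" "h T = h (nbr c T) + 1" unfolding orient_def p by auto
      then have "flow X T c = - 1" using h[of c T] by simp
      then show "p \<in> X" using p ct
        by (cases "(src c T, tgt c T) \<in> X"; cases "(tgt c T, src c T) \<in> X") (simp_all add: flow_def)
    qed
  qed
  ultimately show ?thesis by blast
qed

lemma orient_inj: "inj_on orient heights"
proof (rule inj_onI)
  fix x y assume x: "x \<in> heights" and y: "y \<in> heights" and eq: "orient x = orient y"
  have "{T. x T \<noteq> y T} = {}"
  proof (rule escape)
    show "{T. x T \<noteq> y T} \<subseteq> S" using heights_zero[OF x] heights_zero[OF y] by force
    fix T c assume "T \<in> {T. x T \<noteq> y T}"
    then show "nbr c T \<in> {T. x T \<noteq> y T}"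
      using flow_orient[OF x, of T c] flow_orient[OF y, of T c] eq by simp
  qed
  then show "x = y" by auto
qed

lemma bij_orient: "bij_betw orient heights (EO G)"
  using orient_inj orient_EO EO_orient unfolding bij_betw_def by blast

text \<open>Even degrees make the edge set a closed form modulo 2. Its potential two-colours the
  triangles, changing across each edge of the graph and vanishing off \<open>S\<close>; read as 0
  and 1 it is a height function.\<close>

lemma heights_nonempty:
  assumes "eulerian G"
  shows "heights \<noteq> {}"
proof -
  define \<omega> :: "tri \<Rightarrow> colour \<Rightarrow> bit" where "\<omega> T c = of_bool (edge c T \<in> edges G)" for T c
  have "\<exists>h M. (\<forall>T c. h (nbr c T) = h T + \<omega> T c) \<and> (\<forall>i j u. M < i \<longrightarrow> h (Tri i j u) = 0)"
  proof (rule discrete_poincare)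
    show "\<omega> (nbr c T) c = - \<omega> T c" for c T by (simp add: \<omega>_def)
    have "{T. \<exists>c. \<omega> T c \<noteq> 0} \<subseteq> S \<union> (\<Union>c. nbr c ` S)"
    proof
      fix T assume "T \<in> {T. \<exists>c. \<omega> T c \<noteq> 0}"
      then obtain c where "T \<in> S \<or> nbr c T \<in> S" using edge_in_G by (auto simp: \<omega>_def)
      then show "T \<in> S \<union> (\<Union>c. nbr c ` S)" by (metis UNIV_I UN_I UnI1 UnI2 imageI nbr_nbr)
    qed
    then show "finite {T. \<exists>c. \<omega> T c \<noteq> 0}" by (rule finite_subset) (simp add: finite_S)
  next
    fix i j :: int
    define v where "v = (i, j)"
    have "{e \<in> edges G. v \<in> e} = (\<lambda>w. {v, w}) ` {w \<in> star v. {v, w} \<in> edges G}"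
    proof (intro equalityI subsetI)
      fix e assume e: "e \<in> {e \<in> edges G. v \<in> e}"
      then have "e \<in> lattice_edges" by (simp add: edges_G)
      then obtain c i' j' where "e = edge c (Tri i' j' True)" by (rule lattice_edgeE)
      then obtain a b where "e = {a, b}" by (simp add: edge_def)
      then obtain w where w: "e = {v, w}" using e by (metis (no_types, lifting) insertE insert_commute mem_Collect_eq singletonD)
      then show "e \<in> (\<lambda>w. {v, w}) ` {w \<in> star v. {v, w} \<in> edges G}"
        using e star_nbrs[of v w] by (auto simp: edges_G)
    qed auto
    moreover have "inj_on (\<lambda>w. {v, w}) {w \<in> star v. {v, w} \<in> edges G}"
      by (auto intro!: inj_onI simp: doubleton_eq_iff)
    ultimately have deg: "degree G v = card {w \<in> star v. {v, w} \<in> edges G}"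
      by (simp add: degree_def card_image)
    have ev: "even (degree G v)"
    proof (cases "v \<in> verts G")
      case True
      then show ?thesis using assms by (simp add: eulerian_def)
    next
      case False
      then have none: "{e \<in> edges G. v \<in> e} = {}" using edge_endpoint by blast
      show ?thesis by (simp only: degree_def none card.empty even_zero)
    qed
    have "(\<Sum>w\<in>star v. of_bool ({v, w} \<in> edges G) :: bit) = of_nat (degree G v)"
      unfolding deg by (simp add: of_bool_def sum.If_cases Int_def)
    also have "\<dots> = 0" using ev by (auto elim!: evenE)
    finally have "(\<Sum>w\<in>star v. of_bool ({v, w} \<in> edges G) :: bit) = 0" .
    then show "\<omega> (Tri i j True) Blue + \<omega> (Tri i (j - 1) False) Red + \<omega> (Tri i (j - 1) True) Green
      + \<omega> (Tri (i - 1) (j - 1) False) Blue + \<omega> (Tri (i - 1) j True) Red + \<omega> (Tri (i - 1) j False) Green = 0"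
      unfolding v_def sum_star by (simp add: \<omega>_def edge_def)
  qed
  then obtain h M where h: "\<And>T c. h (nbr c T) = h T + \<omega> T c" and far: "\<And>i j u. M < i \<Longrightarrow> h (Tri i j u) = 0"
    by blast
  have "h (nbr c T) = h T" if z: "z \<in> outside C" "z \<in> edge_segment (edge c T)" for z T c
  proof -
    have "z \<notin> C \<union> inside C" using z(1) by (simp add: union_with_inside)
    then have "edge c T \<notin> edges G" using z(2) by (auto simp: edges_G)
    then show ?thesis by (simp add: h \<omega>_def)
  qed
  then have zero: "h T = 0" if "T \<notin> S" for T using outside_constant[of h M 0] far that by blast
  have "(\<lambda>T. if h T = 0 then 0 else 1) \<in> heights"
    unfolding heights_def
  proof (intro CollectI conjI allI impI ballI)
    fix T c assume "T \<in> S"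
    then have "h (nbr c T) = h T + 1" using edge_in_G h by (simp add: \<omega>_def)
    then show "\<bar>(if h (nbr c T) = 0 then 0 else 1) - (if h T = 0 then 0 else 1)\<bar> = (1::int)"
      by (cases "h T") auto
  qed (simp add: zero)
  then show ?thesis by blast
qed

end

section \<open>Bounded faces are the triangles in \<open>S\<close>, and face reversal is a
  flip\<close>

lemma ctri_boundary:
  assumes "z \<in> ctri T" "z \<notin> otri T"
  shows "\<exists>c. z \<in> edge_segment (edge c T)"
proof -
  obtain i j u where T: "T = Tri i j u" by (cases T)
  note box = ctri_box[OF assms(1)[unfolded T]]
  have nb: "edge Red T = edge Red (nbr Red T)" "edge Green T = edge Green (nbr Green T)" "edge Blue T = edge Blue (nbr Blue T)"
    by simp_all
  show ?thesis
  proof (cases u)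
    case True
    then have "px z = i \<or> py z = j \<or> px z + py z = of_int i + of_int j + 1" using assms T by auto
    then have "z \<in> edge_segment (edge Green T) \<or> z \<in> edge_segment (edge Blue T) \<or> z \<in> edge_segment (edge Red T)"
      using box True T by (auto simp: edge_segment_iff)
    then show ?thesis by blast
  next
    case False
    then have "px z = i + 1 \<or> py z = j + 1 \<or> px z + py z = of_int i + of_int j + 1" using assms T by auto
    then have "z \<in> edge_segment (edge Green T) \<or> z \<in> edge_segment (edge Blue T) \<or> z \<in> edge_segment (edge Red T)"
      using box False T unfolding nb by (auto simp: edge_segment_iff)
    then show ?thesis by blast
  qed
qed

lemma frontier_otri: "frontier (otri T) = ctri T - otri T"
  by (simp add: frontier_def closure_otri interior_open open_otri)

lemma embed_in_edge: "\<exists>c T. embed v \<in> edge_segment (edge c T)"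
proof -
  obtain i j where v: "v = (i, j)" by (cases v)
  have "embed v \<in> edge_segment (edge Blue (Tri i j True))" by (simp add: edge_segment_iff v)
  then show ?thesis by blast
qed

lemma inj_otri: "inj otri"
proof (rule injI)
  fix T T' assume "otri T = otri T'"
  then have "centroid T \<in> otri T \<inter> ctri T'" using centroid_otri otri_subset_ctri by blast
  then show "T = T'" using otri_inj by blast
qed

fun nxt :: "colour \<Rightarrow> colour" where
  "nxt Blue = Red" | "nxt Red = Green" | "nxt Green = Blue"

lemma tgt_nxt: "tgt c T = src (nxt c) T"
  by (cases T; cases c) auto

lemma src_inj: "src c T = src d T \<longleftrightarrow> c = d"
  by (cases T; cases c; cases d) auto

lemma cycle_arcs_in_unique:
  assumes "distinct vs" "(u, w) \<in> cycle_arcs vs" "(v, w) \<in> cycle_arcs vs"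
  shows "u = v"
proof -
  have "card {u. (w, u) \<in> set (zip (rotate1 vs) vs)} = of_bool (w \<in> set (rotate1 vs))"
    using assms(1) by (intro card_successors) auto
  then have "card {u. (u, w) \<in> cycle_arcs vs} \<le> 1"
    by (auto simp: cycle_arcs_def set_zip conj_commute split: if_splits)
  moreover have "finite {u. (u, w) \<in> cycle_arcs vs}"
    by (rule finite_subset[of _ "fst ` cycle_arcs vs"]) (force simp: cycle_arcs_def)+
  ultimately have "\<forall>a\<in>{u. (u, w) \<in> cycle_arcs vs}. \<forall>b\<in>{u. (u, w) \<in> cycle_arcs vs}. a = b"
    by (simp only: card_le_Suc0_iff_eq One_nat_def)
  then show ?thesis using assms(2,3) by blast
qed

context solid
begin

lemma drawing_in_region: "drawing G \<subseteq> C \<union> inside C"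
  unfolding drawing_def using verts_G edges_G by blast

lemma edge_in_drawing: "e \<in> edges G \<Longrightarrow> edge_segment e \<subseteq> drawing G"
  unfolding drawing_def by blast

lemma C_in_drawing: "C \<subseteq> drawing G"
proof
  fix z assume "z \<in> C"
  then obtain u v c T where *: "(u, v) \<in> cycle_arcs vs" "u = src c T" "v = tgt c T" "z \<in> edge_segment (edge c T)"
    by (rule in_C)
  then have "edge c T \<in> edges G" using cycle_edge_borders_S edge_in_G by simp
  then show "z \<in> drawing G" using edge_in_drawing *(4) by blast
qed

lemma otri_disjoint_drawing: "otri T \<inter> drawing G = {}"
proof -
  have "otri T \<inter> edge_segment e = {}" if e: "e \<in> edges G" for e
  proof -
    have "e \<in> lattice_edges" using e by (simp add: edges_G)
    then obtain c i j where "e = edge c (Tri i j True)" by (rule lattice_edgeE)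
    then show ?thesis using otri_disjoint_edge by simp
  qed
  moreover have "embed v \<notin> otri T" for v using embed_in_edge[of v] otri_disjoint_edge by blast
  ultimately show ?thesis unfolding drawing_def by blast
qed

lemma otri_component:
  assumes T: "T \<in> S"
  shows "otri T \<in> components (- drawing G)"
  unfolding in_components_maximal
proof (intro conjI allI impI)
  show "otri T \<noteq> {}" using centroid_otri by blast
  show "otri T \<subseteq> - drawing G" using otri_disjoint_drawing by blast
  show "connected (otri T)" by (rule convex_connected[OF convex_otri])
  fix D assume D: "D \<noteq> {} \<and> otri T \<subseteq> D \<and> D \<subseteq> - drawing G \<and> connected D"
  show "D = otri T"
  proof (rule ccontr)
    assume "D \<noteq> otri T"
    then have "D \<inter> frontier (otri T) \<noteq> {}"
      using D centroid_otri[of T] by (intro connected_Int_frontier) auto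
    then obtain z where z: "z \<in> D" "z \<in> ctri T" "z \<notin> otri T" unfolding frontier_otri by blast
    then obtain c where "z \<in> edge_segment (edge c T)" using ctri_boundary by blast
    moreover have "edge c T \<in> edges G" using T edge_in_G by blast
    ultimately show False using edge_in_drawing D z(1) by blast
  qed
qed

lemma near_inside: "z \<in> ctri T \<Longrightarrow> z \<in> inside C \<Longrightarrow> T \<in> S"
proof -
  assume "z \<in> ctri T" "z \<in> inside C"
  then have "inside C \<inter> closure (otri T) \<noteq> {}" using closure_otri by blast
  then have "otri T \<inter> inside C \<noteq> {}"
    using open_inside[OF closed_C] by (metis Int_commute open_Int_closure_eq_empty)
  then show ?thesis by (rule S_meets)
qed

text \<open>Any further component would avoid the triangles of \<open>S\<close> and their edges,
  hence lie in the outside of the cycle; being maximal connected it would contain the whole outside,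
  which is unbounded.\<close>

lemma bounded_faces_G: "bounded_faces G = otri ` S"
proof (intro equalityI subsetI)
  fix F assume "F \<in> otri ` S"
  then obtain T where T: "T \<in> S" "F = otri T" by blast
  have "bounded (otri T)" using T bounded_inside[OF bounded_C] bounded_subset by (auto simp: S_def)
  then show "F \<in> bounded_faces G" using T otri_component by (simp add: bounded_faces_def)
next
  fix F assume "F \<in> bounded_faces G"
  then have F: "F \<in> components (- drawing G)" and bF: "bounded F" by (auto simp: bounded_faces_def)
  show "F \<in> otri ` S"
  proof (rule ccontr)
    assume no: "F \<notin> otri ` S"
    have disj: "F \<inter> otri T = {}" if "T \<in> S" for T
      using components_nonoverlap[OF F otri_component[OF that]] no that by blast
    have "F \<subseteq> outside C"
    proof
      fix z assume z: "z \<in> F"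
      then have zd: "z \<notin> drawing G" using in_components_subset[OF F] by blast
      show "z \<in> outside C"
      proof (rule ccontr)
        assume "z \<notin> outside C"
        then have "z \<in> C \<union> inside C" by (simp add: union_with_inside)
        then have zi: "z \<in> inside C" using C_in_drawing zd by blast
        then have TS: "canon z \<in> S" using near_inside[OF canon_mem] by blast
        then have "z \<notin> otri (canon z)" using disj z by blast
        then obtain c where "z \<in> edge_segment (edge c (canon z))" using ctri_boundary[OF canon_mem] by blast
        moreover have "edge c (canon z) \<in> edges G" using TS edge_in_G by blast
        ultimately show False using edge_in_drawing zd by blast
      qed
    qed
    moreover have "connected (outside C)" using bounded_C by (intro connected_outside) simp_all
    moreover have "outside C \<subseteq> - drawing G" using drawing_in_region by (auto simp: union_with_inside)
    moreover have "F \<noteq> {}" using in_components_nonempty[OF F] .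
    ultimately have "outside C \<subseteq> F" by (intro components_maximal[OF F]) auto
    then have "bounded (outside C)" using bF bounded_subset by blast
    then show False using unbounded_outside[OF bounded_C] by blast
  qed
qed

lemma card_faces: "card (bounded_faces G) = card S"
  unfolding bounded_faces_G by (rule card_image) (rule inj_on_subset[OF inj_otri subset_UNIV])

lemma face_edges_otri:
  assumes T: "T \<in> S"
  shows "e \<in> face_edges G (otri T) \<longleftrightarrow> (\<exists>c. e = edge c T)"
proof
  assume "e \<in> face_edges G (otri T)"
  then have e: "e \<in> lattice_edges" "edge_segment e \<subseteq> ctri T" by (auto simp: face_edges_def edges_G frontier_otri)
  obtain c i j where ec: "e = edge c (Tri i j True)" using lattice_edgeE[OF e(1)] .
  then have "mid c (Tri i j True) \<in> ctri T" using e(2) mid_in_segment by blast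
  then have "T = Tri i j True \<or> T = nbr c (Tri i j True)" by (rule mid_in_ctri)
  then show "\<exists>c. e = edge c T" using ec edge_nbr by metis
next
  assume "\<exists>c. e = edge c T"
  then obtain c where c: "e = edge c T" by blast
  then show "e \<in> face_edges G (otri T)"
    using T edge_in_G edge_segment_subset_ctri[of c T] otri_disjoint_edge[of T c T]
    by (auto simp: face_edges_def frontier_otri)
qed

lemma face_arcs_otri:
  assumes T: "T \<in> S"
  shows "p \<in> face_arcs G X (otri T) \<longleftrightarrow> p \<in> X \<and> (\<exists>c. p = (src c T, tgt c T) \<or> p = (tgt c T, src c T))"
proof -
  have "({fst p, snd p} = edge c T) = (p = (src c T, tgt c T) \<or> p = (tgt c T, src c T))" for c
    by (cases p) (auto simp: edge_def doubleton_eq_iff)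
  then show ?thesis unfolding face_arcs_def using face_edges_otri[OF T] by (cases p) auto
qed

lemma orient_flip:
  assumes h: "h \<in> heights" and T: "T \<in> S" and s: "s \<in> {1, -1}" and ext: "\<And>c. h (nbr c T) = h T - s"
  shows "reverse_face G (orient h) (otri T) = orient (h(T := h T - 2 * s))"
proof -
  let ?A = "face_arcs G (orient h) (otri T)" and ?h' = "h(T := h T - 2 * s)"
  have A_arc: "(src c U, tgt c U) \<in> ?A \<longleftrightarrow> (src c U, tgt c U) \<in> orient h \<and> (U = T \<or> nbr c U = T)" for c U
  proof -
    have "(\<exists>d. (src c U, tgt c U) = (src d T, tgt d T) \<or> (src c U, tgt c U) = (tgt d T, src d T)) \<longleftrightarrow> (U = T \<or> nbr c U = T)"
    proof
      assume "\<exists>d. (src c U, tgt c U) = (src d T, tgt d T) \<or> (src c U, tgt c U) = (tgt d T, src d T)"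
      then obtain d where "src c U = src d T \<and> tgt c U = tgt d T \<or> src c U = src d (nbr d T) \<and> tgt c U = tgt d (nbr d T)" by auto
      then have "c = d \<and> (U = T \<or> U = nbr d T)" using arc_inj by blast
      then show "U = T \<or> nbr c U = T" by auto
    next
      assume "U = T \<or> nbr c U = T"
      then show "\<exists>d. (src c U, tgt c U) = (src d T, tgt d T) \<or> (src c U, tgt c U) = (tgt d T, src d T)"
        by (metis src_nbr tgt_nbr)
    qed
    then show ?thesis using face_arcs_otri[OF T] by blast
  qed
  have lat: "\<exists>c U. p = (src c U, tgt c U)" if "p \<in> orient k" for p k using that unfolding orient_def by auto
  have main: "(src c U, tgt c U) \<in> reverse_face G (orient h) (otri T) \<longleftrightarrow> (src c U, tgt c U) \<in> orient ?h'" for c U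
  proof -
    have rev: "(src c U, tgt c U) \<in> ?A\<inverse> \<longleftrightarrow> (tgt c U, src c U) \<in> orient h \<and> (U = T \<or> nbr c U = T)"
      using A_arc[of c "nbr c U"] by auto
    have "(src c U, tgt c U) \<in> reverse_face G (orient h) (otri T) \<longleftrightarrow>
        (if U = T \<or> nbr c U = T then h (nbr c U) = h U + 1 else h U = h (nbr c U) + 1)"
      unfolding reverse_face_def Un_iff Diff_iff A_arc rev unfolding orient_arc orient_arc_rev by auto
    also have "\<dots> \<longleftrightarrow> ?h' U = ?h' (nbr c U) + 1"
    proof (cases "U = T \<or> nbr c U = T")
      case True
      then consider "U = T" | "U = nbr c T" using nbr_swap by blast
      then show ?thesis
      proof cases
        case 1
        then show ?thesis using ext[of c] s by auto
      next
        case 2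
        then show ?thesis using ext[of c] s by auto
      qed
    next
      case False
      then show ?thesis by simp
    qed
    finally show ?thesis by (simp only: orient_arc)
  qed
  have lat': "\<exists>c U. p = (src c U, tgt c U)" if "p \<in> reverse_face G (orient h) (otri T)" for p
  proof -
    have "p \<in> orient h \<or> (snd p, fst p) \<in> orient h"
      using that face_arcs_otri[OF T] unfolding reverse_face_def by (cases p) auto
    then show ?thesis
    proof
      assume "(snd p, fst p) \<in> orient h"
      then obtain c U where "snd p = src c U" "fst p = tgt c U" using lat by blast
      then have "p = (src c (nbr c U), tgt c (nbr c U))" by (cases p) auto
      then show ?thesis by blast
    qed (rule lat)
  qed
  show ?thesis using main lat lat' by (intro set_eqI) metis
qed

lemma directed_otri:
  assumes h: "h \<in> heights" and T: "T \<in> S"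
  shows "directed_face G (orient h) (otri T) \<longleftrightarrow> (\<forall>c. h (nbr c T) = h T - 1) \<or> (\<forall>c. h (nbr c T) = h T + 1)"
proof
  let ?A = "face_arcs G (orient h) (otri T)"
  have fwd: "(src c T, tgt c T) \<in> ?A \<longleftrightarrow> h (nbr c T) = h T - 1" for c
    using face_arcs_otri[OF T] orient_arc[of c T h] by auto
  have bwd: "(tgt c T, src c T) \<in> ?A \<longleftrightarrow> h (nbr c T) = h T + 1" for c
    using face_arcs_otri[OF T] orient_arc_rev[of c T h] by auto
  have A: "p \<in> ?A \<Longrightarrow> \<exists>c. p = (src c T, tgt c T) \<or> p = (tgt c T, src c T)" for p
    using face_arcs_otri[OF T] by blast
  have dist: "src Blue T \<noteq> src Red T" "src Red T \<noteq> src Green T" "src Blue T \<noteq> src Green T" by (simp_all add: src_inj)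
  {
    assume "directed_face G (orient h) (otri T)"
    then obtain ws where ws: "distinct ws" "?A = cycle_arcs ws" by (auto simp: directed_face_def)
    show "(\<forall>c. h (nbr c T) = h T - 1) \<or> (\<forall>c. h (nbr c T) = h T + 1)"
    proof (rule ccontr)
      assume no: "\<not> ?thesis"
      have alt: "h (nbr c T) = h T + 1 \<or> h (nbr c T) = h T - 1" for c using heights_step[OF h T] .
      \<comment> \<open>If the signs are mixed, some side run counterclockwise is followed by one
        run clockwise. Both arcs enter the corner between them, which cannot happen in a directed
        cycle.\<close>
      have "\<exists>c. h (nbr c T) = h T - 1 \<and> h (nbr (nxt c) T) = h T + 1"
        using no alt[of Red] alt[of Green] alt[of Blue] unfolding all_colour by (metis nxt.simps)
      then obtain c where "(src c T, tgt c T) \<in> ?A" "(tgt (nxt c) T, src (nxt c) T) \<in> ?A" using fwd bwd by blast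
      then have "src c T = tgt (nxt c) T"
        using cycle_arcs_in_unique[OF ws(1), of "src c T" "tgt c T" "tgt (nxt c) T"] ws(2) tgt_nxt[of c T] by simp
      then have "c = nxt (nxt c)" using tgt_nxt[of "nxt c" T] src_inj by metis
      then show False by (cases c) auto
    qed
  next
    assume "(\<forall>c. h (nbr c T) = h T - 1) \<or> (\<forall>c. h (nbr c T) = h T + 1)"
    then show "directed_face G (orient h) (otri T)"
    proof
      assume up: "\<forall>c. h (nbr c T) = h T - 1"
      then have "?A = range (\<lambda>c. (src c T, tgt c T))" using fwd bwd A by force
      also have "\<dots> = cycle_arcs [src Blue T, src Red T, src Green T]"
        unfolding tgt_nxt cycle_arcs_def UNIV_colour by auto
      finally show ?thesis unfolding directed_face_def
        using dist by (intro exI[of _ "[src Blue T, src Red T, src Green T]"]) auto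
    next
      assume dn: "\<forall>c. h (nbr c T) = h T + 1"
      then have "?A = range (\<lambda>c. (tgt c T, src c T))" using fwd bwd A by force
      also have "\<dots> = cycle_arcs [src Blue T, src Green T, src Red T]"
        unfolding tgt_nxt cycle_arcs_def UNIV_colour by auto
      finally show ?thesis unfolding directed_face_def
        using dist by (intro exI[of _ "[src Blue T, src Green T, src Red T]"]) auto
    qed
  }
qed

lemma face_move:
  assumes h: "h \<in> heights" and T: "T \<in> S"
  shows "(if directed_face G (orient h) (otri T) then reverse_face G (orient h) (otri T) else orient h) = orient (flip_at T h)"
proof -
  consider (max) "\<And>c. h (nbr c T) = h T - 1" | (min) "\<And>c. h (nbr c T) = h T + 1"
    | (no) "\<not> (\<forall>c. h (nbr c T) = h T - 1)" "\<not> (\<forall>c. h (nbr c T) = h T + 1)" by blast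
  then show ?thesis
  proof cases
    case max
    then have "flip_at T h = h(T := h T - 2 * 1)" by (simp add: flip_at_local_max)
    then show ?thesis using max directed_otri[OF h T] orient_flip[OF h T, of 1] by simp
  next
    case min
    then have "flip_at T h = h(T := h T - 2 * (-1))" by (simp add: flip_at_local_min)
    then show ?thesis using min directed_otri[OF h T] orient_flip[OF h T, of "-1"] by simp
  next
    case no
    then have "flip_at T h = h" unfolding flip_at_def by presburger
    then show ?thesis using no directed_otri[OF h T] by auto
  qed
qed

end

section \<open>The mixing time\<close>

context solid
begin

definition face_flip :: "complex set \<Rightarrow> orientation \<Rightarrow> orientation" where
  "face_flip F X = (if directed_face G X F then reverse_face G X F else X)"

lemma face_flip_orient: "h \<in> heights \<Longrightarrow> T \<in> S \<Longrightarrow> face_flip (otri T) (orient h) = orient (flip_at T h)"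
  unfolding face_flip_def by (rule face_move)

lemma finite_EO: "finite (EO G)"
  using bij_betw_finite[OF bij_orient] finite_heights by simp

lemma chain: "lazy_involution_chain (EO G) (bounded_faces G) face_flip (face_step G)"
proof
  show "finite (EO G)" by (rule finite_EO)
  show "finite (bounded_faces G)" "bounded_faces G \<noteq> {}"
    using finite_S S_nonempty by (simp_all add: bounded_faces_G)
  fix F X assume "F \<in> bounded_faces G" "X \<in> EO G"
  then obtain T h where *: "T \<in> S" "F = otri T" "h \<in> heights" "X = orient h"
    using bounded_faces_G EO_orient by blast
  then show "face_flip F X \<in> EO G" by (simp add: face_flip_orient orient_EO flip_at_heights)
  show "face_flip F (face_flip F X) = X" using * by (simp add: face_flip_orient flip_at_heights flip_at_flip_at)
next
  show "face_step G X = bind_pmf (bernoulli_pmf (1 / 2))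
      (\<lambda>stay. if stay then return_pmf X else map_pmf (\<lambda>F. face_flip F X) (pmf_of_set (bounded_faces G)))" for X
    unfolding face_step_def face_flip_def by (rule refl)
qed

lemma face_poincare:
  fixes g :: "orientation \<Rightarrow> real"
  assumes mean: "(\<Sum>X\<in>EO G. g X) = 0"
  shows "1 / (93312 * real (card S) ^ 5) * (\<Sum>X\<in>EO G. (g X)\<^sup>2) \<le>
    (\<Sum>F\<in>bounded_faces G. \<Sum>X\<in>EO G. (g X - g (face_flip F X))\<^sup>2) / (4 * real (card (bounded_faces G)))"
proof -
  have re: "(\<Sum>X\<in>EO G. \<phi> X) = (\<Sum>h\<in>heights. \<phi> (orient h))" for \<phi> :: "orientation \<Rightarrow> real"
    using sum.reindex_bij_betw[OF bij_orient, of \<phi>] by simp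
  have "(\<Sum>F\<in>bounded_faces G. \<Sum>X\<in>EO G. (g X - g (face_flip F X))\<^sup>2)
      = (\<Sum>T\<in>S. \<Sum>X\<in>EO G. (g X - g (face_flip (otri T) X))\<^sup>2)"
    unfolding bounded_faces_G by (subst sum.reindex) (auto intro: inj_on_subset[OF inj_otri])
  also have "\<dots> = flip_form (\<lambda>h. g (orient h))"
    unfolding re flip_form_def by (intro sum.cong refl) (simp add: face_flip_orient)
  finally show ?thesis
    using flip_gap[OF S_nonempty, of "\<lambda>h. g (orient h)"] mean unfolding re card_faces by simp
qed

text \<open>A crude count: an orientation is a set of arcs at triangles of \<open>S\<close> or their
  neighbours, at most 4 card S triangles with 3 arcs each. The exponent linear in card S is what
  raises f^5 to f^6 in the mixing bound.\<close>

lemma card_EO: "card (EO G) \<le> 2 ^ (12 * card S)"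
proof -
  define A where "A = (\<lambda>(c, T). (src c T, tgt c T)) ` ((UNIV :: colour set) \<times> (S \<union> (\<Union>c. nbr c ` S)))"
  have finA: "finite A" using finite_S by (simp add: A_def)
  have "card (\<Union>c. nbr c ` S) \<le> (\<Sum>c\<in>(UNIV :: colour set). card (nbr c ` S))" by (rule card_UN_le) simp
  also have "\<dots> \<le> (\<Sum>c\<in>(UNIV :: colour set). card S)" using finite_S by (intro sum_mono card_image_le)
  finally have "card (\<Union>c. nbr c ` S) \<le> 3 * card S" by (simp add: UNIV_colour)
  then have "card (S \<union> (\<Union>c. nbr c ` S)) \<le> 4 * card S" using card_Un_le[of S "\<Union>c. nbr c ` S"] by linarith
  then have "card ((UNIV :: colour set) \<times> (S \<union> (\<Union>c. nbr c ` S))) \<le> 12 * card S"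
    by (simp add: card_cartesian_product UNIV_colour)
  then have "card A \<le> 12 * card S"
    unfolding A_def using finite_S by (intro order_trans[OF card_image_le]) auto
  moreover have "card (EO G) \<le> card (Pow A)"
    using finite_orientation finA by (intro card_mono) (auto simp: A_def)
  ultimately show ?thesis
    using finA by (simp add: card_Pow) (meson le_trans one_le_numeral power_increasing)
qed

lemma mixing:
  assumes eul: "eulerian G" and eps: "0 < \<epsilon>" "\<epsilon> < 1"
  shows "real (face_mixing_time G \<epsilon>) \<le> 1306369 * real (card (bounded_faces G)) ^ 6 * real_of_int \<lceil>ln (1 / \<epsilon>)\<rceil>"
proof -
  interpret lazy_involution_chain "EO G" "bounded_faces G" face_flip "face_step G" by (rule chain)
  define f where "f = real (card S)"
  have "card S > 0" using S_nonempty finite_S by (simp add: card_gt_0_iff)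
  then have f1: "f \<ge> 1" by (simp add: f_def)
  define \<gamma> where "\<gamma> = 1 / (93312 * f ^ 5)"
  define l where "l = ln (1 / \<epsilon>)"
  define L where "L = real_of_int \<lceil>l\<rceil>"
  have l0: "0 < l" using eps by (simp add: l_def)
  have lL: "l \<le> L" unfolding L_def by linarith
  \<comment> \<open>Here the ceiling enters: being at least 1, \<open>L\<close> can absorb the
    rounding of \<open>t\<close> and the term 6 f, which does not shrink as \<epsilon> tends to
    1.\<close>
  have L1: "1 \<le> L" unfolding L_def using l0 by (simp add: one_le_ceiling)
  have gpos: "0 < \<gamma>" using f1 by (simp add: \<gamma>_def)
  \<comment> \<open>Chosen so that exp (6 f - \<gamma> t / 2) \<le> \<epsilon>, where exp (6 f)
    bounds the square root of the number of states, at most 2^(12 f).\<close>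
  define t where "t = nat \<lceil>2 / \<gamma> * (6 * f + l)\<rceil>"
  have t_ge: "2 / \<gamma> * (6 * f + l) \<le> real t" unfolding t_def by linarith
  have "0 \<le> 2 / \<gamma> * (6 * f + l)" using gpos f1 l0 by simp
  then have t_le: "real t \<le> 2 / \<gamma> * (6 * f + l) + 1" unfolding t_def by linarith
  have ne: "EO G \<noteq> {}" using heights_nonempty[OF eul] orient_EO by blast
  have tv: "tv_dist (chain_power (face_step G) t X) (pmf_of_set (EO G)) \<le> \<epsilon>" if X: "X \<in> EO G" for X
  proof -
    have n: "0 < real (card (EO G))" using X finite_EO by (auto simp: card_gt_0_iff)
    have "real (card (EO G)) \<le> real (2 ^ (12 * card S))" using card_EO by (simp only: of_nat_le_iff)
    also have "\<dots> = 2 ^ (12 * card S)" by simp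
    also have "\<dots> \<le> exp 1 ^ (12 * card S)" using exp_ge_add_one_self[of 1] by (intro power_mono) auto
    also have "\<dots> = exp (12 * f)" by (simp add: f_def exp_of_nat_mult[symmetric])
    finally have "sqrt (real (card (EO G))) \<le> sqrt (exp (12 * f))" by simp
    also have "\<dots> = exp (6 * f)"
    proof -
      have "exp (12 * f) = (exp (6 * f))\<^sup>2" by (simp add: power2_eq_square exp_add[symmetric])
      then show ?thesis by simp
    qed
    finally have sq: "sqrt (real (card (EO G))) \<le> exp (6 * f)" .
    have "\<gamma> / 2 * (2 / \<gamma> * (6 * f + l)) \<le> \<gamma> / 2 * real t" using t_ge gpos by (intro mult_left_mono) auto
    then have ex: "6 * f + l \<le> \<gamma> * real t / 2" using gpos by simp
    have "tv_dist (chain_power (face_step G) t X) (pmf_of_set (EO G))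
        \<le> sqrt (real (card (EO G))) * exp (- \<gamma> * real t / 2)"
      using face_poincare by (intro tv_dist_chain_le X) (simp add: \<gamma>_def f_def)
    also have "\<dots> \<le> exp (6 * f) * exp (- \<gamma> * real t / 2)" using sq by (intro mult_right_mono) auto
    also have "\<dots> = exp (6 * f - \<gamma> * real t / 2)" by (simp add: exp_add[symmetric])
    also have "\<dots> \<le> exp (- l)" using ex by simp
    also have "\<dots> = \<epsilon>" using eps by (simp add: l_def ln_div)
    finally show ?thesis .
  qed
  have "face_mixing_time G \<epsilon> \<le> t"
    unfolding face_mixing_time_def mixing_time_def
    using ne finite_EO tv by (auto intro!: Max.boundedI Least_le)
  then have "real (face_mixing_time G \<epsilon>) \<le> 2 / \<gamma> * (6 * f + l) + 1" using t_le by linarith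
  also have "\<dots> = 186624 * f ^ 5 * (6 * f + l) + 1" by (simp add: \<gamma>_def)
  \<comment> \<open>186624 = 2 * 93312. The 7 collects 6 f and \<open>l\<close>, the last summand
    covers the rounding of \<open>t\<close>, and 7 * 186624 + 1 = 1306369.\<close>
  also have "\<dots> \<le> 186624 * f ^ 5 * (7 * (f * L)) + f ^ 6 * L"
  proof (intro add_mono mult_left_mono)
    have "f * 1 \<le> f * L" "1 * L \<le> f * L" using f1 L1 by (auto intro!: mult_left_mono mult_right_mono)
    then show "6 * f + l \<le> 7 * (f * L)" using lL by simp
    have "1 * 1 \<le> f ^ 6 * L" using f1 L1 by (intro mult_mono) auto
    then show "1 \<le> f ^ 6 * L" by simp
  qed (use f1 in simp)
  also have "\<dots> = 1306369 * f ^ 6 * L" by (simp add: power_numeral_reduce algebra_simps)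
  finally show ?thesis by (simp add: f_def L_def l_def card_faces)
qed

end

theorem theorem11:
  shows "\<exists>c::real. c > 0 \<and>
    (\<forall>(G::graph) (\<epsilon>::real).
       solid_subgraph G \<longrightarrow> eulerian G \<longrightarrow> 0 < \<epsilon> \<longrightarrow> \<epsilon> < 1 \<longrightarrow>
       real (face_mixing_time G \<epsilon>) \<le>
         c * real (card (bounded_faces G)) ^ 6 * real_of_int \<lceil>ln (1 / \<epsilon>)\<rceil>)"
proof (intro exI[of _ 1306369] conjI allI impI)
  fix G :: graph and \<epsilon> :: real
  assume "solid_subgraph G" and eul: "eulerian G" and eps: "0 < \<epsilon>" "\<epsilon> < 1"
  then obtain vs where vs: "lattice_cycle vs" "G = solid_graph vs" by (auto simp: solid_subgraph_def)
  interpret solid vs by unfold_locales (rule vs(1))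
  show "real (face_mixing_time G \<epsilon>) \<le> 1306369 * real (card (bounded_faces G)) ^ 6 * real_of_int \<lceil>ln (1 / \<epsilon>)\<rceil>"
    using mixing[of \<epsilon>] eul eps vs(2) by simp
qed simp

end
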